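(* Let $\lambda\in\mathcal I$ be $k$-quasiregular. Then the eigenvalue polynomial $f_\lambda$ of the Capelli operator $D_\lambda$ is $$f_\lambda=\lim_{\kappa\to k}\left(\frac{P_\lambda^\kappa}{H_\lambda(\kappa)}+\frac{P_{\lambda^\dagger}^\kappa}{H_{\lambda^\dagger}(\kappa)}\right).$$
   Context: Setting. Let $V=V_{\bar 0}\oplus V_{\bar 1}$ be a complex vector superspace with $\dim V_{\bar 0}=2m$, $\dim V_{\bar 1}=2n$, where $m,n$ are positive integers and $k:=n-m\ge 0$, equipped with a non-degenerate even supersymmetric bilinear form $\omega$. Let $\mathfrak g:=\mathfrak{gosp}(V,\omega):=\mathfrak{osp}(V,\omega)\oplus\mathbb C z$, with $z$ central and acting on $V$ by $-\mathrm{id}_V$. Let $\mathcal P(V)=\bigoplus_{d\ge0}\mathcal P^d(V)\cong \mathcal S(V^* )$ be the superalgebra of superpolynomials on $V$ graded by degree, $\mathcal D(V)=\bigoplus_{d\ge 0}\mathcal D^d(V)\cong\mathcal S(V)$ the superalgebra of constant-coefficient superdifferential operators graded by order, and $\mathcal{PD}(V)\cong\mathcal P(V)\otimes\mathcal D(V)$ the superalgebra of superdifferential operators with superpolynomial coefficients, with $\mathfrak g$ acting by supercommutator; $\mathcal{PD}(V)^{\mathfrak g}$ is the algebra of $\mathfrak g$-invariants. Partitions. $\mathcal I:=\{(\lambda_1,\lambda_2)\in\mathbb Z^2:\lambda_1\ge\lambda_2\ge0\}$, $|\lambda|:=\lambda_1+\lambda_2$. An element $\lambda\in\mathcal I$ is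 $k$-regular if $\lambda_1\le k$ or $\lambda_1-\lambda_2=k+1$ or $\lambda_1-\lambda_2\ge 2k+3$; it is $k$-quasiregular if $\lambda_1\ge k+1$ and $\lambda_1-\lambda_2\le k$; it is $k$-singular if $k+2\le\lambda_1-\lambda_2\le 2k+2$. $\mathcal I'_k$ is the set of all $k$-regular and $k$-quasiregular elements. The involution $\lambda^\dagger:=(\lambda_2+k+1,\lambda_1-k-1)$ interchanges $k$-quasiregular and $k$-singular elements. Modules $V_\lambda$. Let $C$ be the Casimir operator of $\mathfrak g$ acting on $\mathcal P(V)$, normalized so that it acts on the irreducible $\mathfrak{osp}(V,\omega)$-module of highest weight $a\varepsilon_1$ by $a(a-2k-2)$ (here the Borel subalgebra has simple roots $\varepsilon_1-\varepsilon_2,\dots,\varepsilon_{m-1}-\varepsilon_m,\varepsilon_m-\delta_1,\dots,\delta_{n-1}-\delta_n,2\delta_n$). For $\lambda\in\mathcal I'_k$ put $c_\lambda:=(\lambda_1-\lambda_2)(\lambda_1-\lambda_2-2k-2)$ and let $V_\lambda$ be the generalized $c_\lambda$-eigenspace of $C$ on $\mathcal P^{|\lambda|}(V)$. Each $V_\lambda$ is an indecomposable $\mathfrak g$-module, $\mathcal P^d(V)=\bigoplus_{\lambda\in\mathcal I'_k,|\lambda|=d}V_\lambda$, and distinct $V_\lambda$ share no composition factors. The pairing $\mathcal D^d(V)\otimes\mathcal P^d(V)\to\mathbb C$, $(D,p)\mapsto Dp$, identifies $\mathcal D^d(V)\cong\mathcal P^d(V)^*$ and hence $\mathcal{PD}(V)^{\mathfrak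 g}\cong\bigoplus_{\lambda\in\mathcal I'_k}\mathrm{Hom}_{\mathfrak g}(V_\lambda,V_\lambda)$. Capelli operators. For $\lambda\in\mathcal I'_k$, $D_\lambda\in\mathcal{PD}(V)^{\mathfrak g}$ is the element corresponding to $\mathrm{id}_{V_\lambda}$ under this isomorphism. Every $D\in\mathcal{PD}(V)^{\mathfrak g}$ preserves each $V_\mu$ and has a single eigenvalue there; the eigenvalue polynomial of $D$ is the unique symmetric polynomial $f_D\in\mathbb C[x,y]$ such that the eigenvalue of $D$ on $V_\mu$ is $f_D(\mu_1-k-1,\mu_2)$ for all $\mu\in\mathcal I'_k$. Write $f_\lambda:=f_{D_\lambda}$. Knop–Sahi polynomials. With $a^{\underline r}:=a(a-1)\cdots(a-r+1)$, for $\lambda\in\mathcal I$ let $P_\lambda^\kappa\in\mathbb Q(\kappa)[x,y]$ be $$P_\lambda^\kappa(x,y):=\sum_{i+j\le\lambda_1-\lambda_2}\frac{(\lambda_1-\lambda_2)!\,(\kappa+1)^{\underline{\lambda_1-\lambda_2-i}}(\kappa+1)^{\underline{\lambda_1-\lambda_2-j}}}{i!\,j!\,(\lambda_1-\lambda_2-i-j)!\,(\kappa+1)^{\underline{\lambda_1-\lambda_2}}}\,x^{\underline{\lambda_2+i}}y^{\underline{\lambda_2+j}}$$ (sum over $i,j\ge0$), and $H_\lambda(\kappa):=(\lambda_1-\lambda_2)!\,\lambda_2!\,(\lambda_1-1-\kappa)^{\underline{\lambda_2}}$. Limits of polynomials are taken coefficientwise. *)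

theory Defs
  imports
    "HOL-Analysis.Analysis"
    "HOL-Library.Poly_Mapping"
    "HOL-Library.Function_Algebras"
    "HOL-Computational_Algebra.Polynomial"
begin

section \<open>The superspace and the orthosymplectic Lie superalgebra\<close>

text \<open>
  The superspace is \<open>V = complex^('a + 'b)\<close>: the standard basis vectors indexed by \<open>Inl i\<close> are
  even and those indexed by \<open>Inr j\<close> are odd, so \<open>CARD('a)\<close> and \<open>CARD('b)\<close> are the even and the odd
  dimension. The form \<open>\<omega>\<close> is arbitrary. The linear order on \<open>'b\<close> only serves to
  choose signs of the monomials in the odd coordinates. Parities are the natural numbers 0 and 1.
\<close>

fun parity_index :: "'a + 'b \<Rightarrow> nat" where
  "parity_index (Inl i) = 0"
| "parity_index (Inr j) = 1"

definition homog_vec :: "nat \<Rightarrow> (complex^('a::finite + 'b::finite)) set" where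
  "homog_vec s = {v. \<forall>i. v $ i \<noteq> 0 \<longrightarrow> parity_index i = s}"

definition supersymmetric_form ::
    "(complex^('a::finite + 'b::finite) \<Rightarrow> complex^('a + 'b) \<Rightarrow> complex) \<Rightarrow> bool" where
  "supersymmetric_form \<omega> \<longleftrightarrow>
     (\<forall>v. Vector_Spaces.linear (*s) (*) (\<lambda>w. \<omega> v w)) \<and>
     (\<forall>w. Vector_Spaces.linear (*s) (*) (\<lambda>v. \<omega> v w)) \<and>
     (\<forall>s\<in>{0,1}. \<forall>t\<in>{0,1}. \<forall>v\<in>homog_vec s. \<forall>w\<in>homog_vec t.
        (s \<noteq> t \<longrightarrow> \<omega> v w = 0) \<and> \<omega> v w = (-1) ^ (s * t) * \<omega> w v) \<and>
     (\<forall>v. (\<forall>w. \<omega> v w = 0) \<longrightarrow> v = 0)"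

definition gl_part :: "nat \<Rightarrow> (complex^('a::finite + 'b::finite)^('a + 'b)) set" where
  "gl_part b = {X. \<forall>i j. X $ i $ j \<noteq> 0 \<longrightarrow> (parity_index i + parity_index j) mod 2 = b}"

text \<open>The component of parity \<open>b\<close> of \<open>osp(V,\<omega>)\<close>, as matrices acting on \<open>V\<close> by \<open>X *v v\<close>.\<close>

definition osp_part ::
    "(complex^('a::finite + 'b::finite) \<Rightarrow> complex^('a + 'b) \<Rightarrow> complex) \<Rightarrow> nat
      \<Rightarrow> (complex^('a + 'b)^('a + 'b)) set" where
  "osp_part \<omega> b = {X \<in> gl_part b. \<forall>s\<in>{0,1}. \<forall>v\<in>homog_vec s. \<forall>w.
      \<omega> (X *v v) w + (-1) ^ (b * s) * \<omega> v (X *v w) = 0}"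

definition supertrace :: "complex^('a::finite + 'b::finite)^('a + 'b) \<Rightarrow> complex" where
  "supertrace X = (\<Sum>i\<in>UNIV. (-1) ^ parity_index i * X $ i $ i)"


section \<open>Superpolynomials\<close>

text \<open>
  The key \<open>(\<alpha>, S)\<close> stands for the monomial \<open>x^\<alpha> \<theta>\<^bsub>j1\<^esub> \<dots> \<theta>\<^bsub>jr\<^esub>\<close>, where \<open>S = {j1 < \<dots> < jr}\<close>,
  in the coordinates on \<open>V\<close> dual to the standard basis: \<open>x\<close> even and \<open>\<theta>\<close> odd.
\<close>

type_synonym ('a, 'b) superpoly = "(('a \<Rightarrow> nat) \<times> 'b set) \<Rightarrow>\<^sub>0 complex"

definition scl :: "complex \<Rightarrow> ('u \<Rightarrow>\<^sub>0 complex) \<Rightarrow> ('u \<Rightarrow>\<^sub>0 complex)" where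
  "scl c p = Poly_Mapping.map ((*) c) p"

lemma lookup_scl [simp]: "Poly_Mapping.lookup (scl c p) u = c * Poly_Mapping.lookup p u"
  unfolding scl_def by transfer (simp add: when_def)

global_interpretation superpoly: vector_space "scl :: complex \<Rightarrow> ('u \<Rightarrow>\<^sub>0 complex) \<Rightarrow> _"
  by unfold_locales
    (simp_all add: poly_mapping_eq_iff fun_eq_iff lookup_add algebra_simps)

definition op_scl :: "complex \<Rightarrow> ('x \<Rightarrow> ('u \<Rightarrow>\<^sub>0 complex)) \<Rightarrow> 'x \<Rightarrow> ('u \<Rightarrow>\<^sub>0 complex)" where
  "op_scl c D = (\<lambda>p. scl c (D p))"

global_interpretation superop:
    vector_space "op_scl :: complex \<Rightarrow> ('x \<Rightarrow> ('u \<Rightarrow>\<^sub>0 complex)) \<Rightarrow> _"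
  by unfold_locales
    (simp_all add: op_scl_def fun_eq_iff superpoly.scale_right_distrib superpoly.scale_left_distrib)

definition lin_ext :: "('u \<Rightarrow> ('w \<Rightarrow>\<^sub>0 complex)) \<Rightarrow> ('u \<Rightarrow>\<^sub>0 complex) \<Rightarrow> ('w \<Rightarrow>\<^sub>0 complex)" where
  "lin_ext F p = (\<Sum>u\<in>Poly_Mapping.keys p. scl (Poly_Mapping.lookup p u) (F u))"

definition mono_degree :: "('a::finite \<Rightarrow> nat) \<times> 'b::finite set \<Rightarrow> nat" where
  "mono_degree = (\<lambda>(\<alpha>, S). (\<Sum>i\<in>UNIV. \<alpha> i) + card S)"

definition homog_poly :: "nat \<Rightarrow> ('a::finite, 'b::finite) superpoly set" where
  "homog_poly d = {p. \<forall>u\<in>Poly_Mapping.keys p. mono_degree u = d}"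

definition parity_involution :: "('a, 'b) superpoly \<Rightarrow> ('a, 'b) superpoly" where
  "parity_involution = lin_ext (\<lambda>(\<alpha>, S). Poly_Mapping.single (\<alpha>, S) ((-1) ^ card S))"

text \<open>
  Left multiplication by a coordinate function and the corresponding left (super)derivation.
  The sign for an odd coordinate comes from moving it past the smaller factors of the monomial.
\<close>

fun coord_mult :: "'a + 'b::linorder \<Rightarrow> ('a, 'b) superpoly \<Rightarrow> ('a, 'b) superpoly" where
  "coord_mult (Inl i) p =
     lin_ext (\<lambda>(\<alpha>, S). Poly_Mapping.single (\<alpha>(i := \<alpha> i + 1), S) 1) p"
| "coord_mult (Inr j) p =
     lin_ext (\<lambda>(\<alpha>, S). if j \<in> S then 0
       else Poly_Mapping.single (\<alpha>, insert j S) ((-1) ^ card {l \<in> S. l < j})) p"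

fun coord_deriv :: "'a + 'b::linorder \<Rightarrow> ('a, 'b) superpoly \<Rightarrow> ('a, 'b) superpoly" where
  "coord_deriv (Inl i) p =
     lin_ext (\<lambda>(\<alpha>, S). Poly_Mapping.single (\<alpha>(i := \<alpha> i - 1), S) (of_nat (\<alpha> i))) p"
| "coord_deriv (Inr j) p =
     lin_ext (\<lambda>(\<alpha>, S). if j \<in> S
       then Poly_Mapping.single (\<alpha>, S - {j}) ((-1) ^ card {l \<in> S. l < j}) else 0) p"


section \<open>The action on superpolynomials and superdifferential operators\<close>

text \<open>
  The action on the linear forms is \<open>(X \<cdot> l) v = - (-1)^(|X||l|) l (X v)\<close>. On coordinate functions
  it is \<open>X \<cdot> x\<^sub>i = - (\<Sum>j. (-1)^(|i|(|i| + |j|)) X\<^sub>i\<^sub>j x\<^sub>j)\<close>, and it is extended by superderivations.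
\<close>

definition act :: "complex^('a::finite + 'b::{finite,linorder})^('a + 'b)
    \<Rightarrow> ('a, 'b) superpoly \<Rightarrow> ('a, 'b) superpoly" where
  "act X p = - (\<Sum>i\<in>UNIV. \<Sum>j\<in>UNIV.
     scl ((-1) ^ (parity_index i * (parity_index i + parity_index j)) * X $ i $ j)
       (coord_mult j (coord_deriv i p)))"

text \<open>
  Superdifferential operators are viewed as operators on superpolynomials. \<open>diff_ops_part d e\<close> is
  the copy of \<open>P^d(V) \<otimes> D^e(V)\<close> consisting of the normally ordered operators.
\<close>

definition diff_ops_part ::
    "nat \<Rightarrow> nat \<Rightarrow> (('a, 'b::linorder) superpoly \<Rightarrow> ('a, 'b) superpoly) set" where
  "diff_ops_part d e =
     superop.span {foldr coord_mult us \<circ> foldr coord_deriv vs |us vs. length us = d \<and> length vs = e}"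

definition diff_ops :: "(('a, 'b::linorder) superpoly \<Rightarrow> ('a, 'b) superpoly) set" where
  "diff_ops = superop.span {foldr coord_mult us \<circ> foldr coord_deriv vs |us vs. True}"

text \<open>
  The supercommutator \<open>[A, D]\<close> for \<open>A\<close> of parity \<open>b\<close>: conjugation with the parity involution
  multiplies the homogeneous components of \<open>D\<close> by \<open>(-1)^|D|\<close>.
\<close>

definition supercommutator ::
    "nat \<Rightarrow> (('a, 'b) superpoly \<Rightarrow> ('a, 'b) superpoly) \<Rightarrow> (('a, 'b) superpoly \<Rightarrow> ('a, 'b) superpoly)
      \<Rightarrow> ('a, 'b) superpoly \<Rightarrow> ('a, 'b) superpoly" where
  "supercommutator b A D = (\<lambda>p. A (D p) -
     (parity_involution ^^ b) (D ((parity_involution ^^ b) (A p))))"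

text \<open>
  Invariants of \<open>gosp(V,\<omega>) = osp(V,\<omega>) \<oplus> \<complex>z\<close>, where the central element \<open>z\<close> is \<open>- id\<^sub>V\<close>, i.e.
  \<open>mat (-1)\<close>.
\<close>

definition invariant_diff_ops ::
    "(complex^('a::finite + 'b::{finite,linorder}) \<Rightarrow> complex^('a + 'b) \<Rightarrow> complex)
      \<Rightarrow> (('a, 'b) superpoly \<Rightarrow> ('a, 'b) superpoly) set" where
  "invariant_diff_ops \<omega> = {D \<in> diff_ops.
     (\<forall>b\<in>{0,1}. \<forall>X\<in>osp_part \<omega> b. \<forall>p. supercommutator b (act X) D p = 0) \<and>
     (\<forall>p. supercommutator 0 (act (mat (-1))) D p = 0)}"


section \<open>The Casimir operator\<close>

text \<open>
  \<open>X\<close> and \<open>Y\<close> are homogeneous bases of \<open>osp(V,\<omega>)\<close> that are dual with respect to the invariant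
  form \<open>(A, B) \<mapsto> c str(AB)\<close>. Linear independence is a consequence of the duality equations. The
  order of the arguments matters on the odd part: \<open>Y i\<close> on the left is what makes
  \<open>\<Sum>i. X i \<cdot> Y i\<close> central.
\<close>

definition dual_osp_bases ::
    "(complex^('a::finite + 'b::finite) \<Rightarrow> complex^('a + 'b) \<Rightarrow> complex) \<Rightarrow> complex \<Rightarrow> nat
      \<Rightarrow> (nat \<Rightarrow> complex^('a + 'b)^('a + 'b)) \<Rightarrow> (nat \<Rightarrow> complex^('a + 'b)^('a + 'b)) \<Rightarrow> bool" where
  "dual_osp_bases \<omega> c N X Y \<longleftrightarrow>
     (\<forall>i<N. \<exists>b\<in>{0,1}. X i \<in> osp_part \<omega> b \<and> Y i \<in> osp_part \<omega> b) \<and>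
     (\<forall>i<N. \<forall>j<N. c * supertrace (Y i ** X j) = (if i = j then 1 else 0)) \<and>
     (\<forall>b\<in>{0,1}. \<forall>Z\<in>osp_part \<omega> b. \<exists>a. \<forall>r s. Z $ r $ s = (\<Sum>i<N. a i * X i $ r $ s))"

text \<open>
  The scalar \<open>c\<close> is fixed by the normalization. It suffices to impose it on the irreducible
  module \<open>V\<close> itself, which has highest weight \<open>\<epsilon>\<^sub>1\<close>: there the Casimir operator has to act by
  \<open>a (a - 2k - 2)\<close> with \<open>a = 1\<close>, i.e. by \<open>-(2k + 1)\<close>, which is nonzero. (This
  gives \<open>c = 1/2\<close>, hence \<open>a (a - 2k - 2)\<close> on the irreducible module of highest weight \<open>a \<epsilon>\<^sub>1\<close>.)
\<close>

definition is_casimir ::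
    "nat \<Rightarrow> (complex^('a::finite + 'b::{finite,linorder}) \<Rightarrow> complex^('a + 'b) \<Rightarrow> complex)
      \<Rightarrow> (('a, 'b) superpoly \<Rightarrow> ('a, 'b) superpoly) \<Rightarrow> bool" where
  "is_casimir k \<omega> C \<longleftrightarrow> (\<exists>c N X Y. dual_osp_bases \<omega> c N X Y \<and>
     (\<Sum>i<N. X i ** Y i) = mat (1 * (1 - 2 * of_nat k - 2)) \<and>
     C = (\<lambda>p. \<Sum>i<N. act (X i) (act (Y i) p)))"

definition casimir ::
    "nat \<Rightarrow> (complex^('a::finite + 'b::{finite,linorder}) \<Rightarrow> complex^('a + 'b) \<Rightarrow> complex)
      \<Rightarrow> ('a, 'b) superpoly \<Rightarrow> ('a, 'b) superpoly" where
  "casimir k \<omega> = (THE C. is_casimir k \<omega> C)"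


section \<open>Partitions and the modules \<open>V\<^sub>\<lambda>\<close>\<close>

definition partitions2 :: "(nat \<times> nat) set" where
  "partitions2 = {(l1, l2). l1 \<ge> l2}"

definition regular :: "nat \<Rightarrow> nat \<times> nat \<Rightarrow> bool" where
  "regular k = (\<lambda>(l1, l2). (l1, l2) \<in> partitions2 \<and>
     (l1 \<le> k \<or> l1 - l2 = k + 1 \<or> l1 - l2 \<ge> 2 * k + 3))"

definition quasiregular :: "nat \<Rightarrow> nat \<times> nat \<Rightarrow> bool" where
  "quasiregular k = (\<lambda>(l1, l2). (l1, l2) \<in> partitions2 \<and> l1 \<ge> k + 1 \<and> l1 - l2 \<le> k)"

definition index_set :: "nat \<Rightarrow> (nat \<times> nat) set" where
  "index_set k = {l. regular k l \<or> quasiregular k l}"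

text \<open>Only meaningful if \<open>l1 \<ge> k + 1\<close>, which holds for quasiregular partitions.\<close>

definition dagger :: "nat \<Rightarrow> nat \<times> nat \<Rightarrow> nat \<times> nat" where
  "dagger k = (\<lambda>(l1, l2). (l2 + k + 1, l1 - k - 1))"

definition psize :: "nat \<times> nat \<Rightarrow> nat" where
  "psize = (\<lambda>(l1, l2). l1 + l2)"

definition casimir_value :: "nat \<Rightarrow> nat \<times> nat \<Rightarrow> complex" where
  "casimir_value k = (\<lambda>(l1, l2).
     (of_nat l1 - of_nat l2) * (of_nat l1 - of_nat l2 - 2 * of_nat k - 2))"

definition V_module ::
    "nat \<Rightarrow> (complex^('a::finite + 'b::{finite,linorder}) \<Rightarrow> complex^('a + 'b) \<Rightarrow> complex)
      \<Rightarrow> nat \<times> nat \<Rightarrow> ('a, 'b) superpoly set" where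
  "V_module k \<omega> l = {p \<in> homog_poly (psize l).
     \<exists>r. ((\<lambda>q. casimir k \<omega> q - scl (casimir_value k l) q) ^^ r) p = 0}"


section \<open>Capelli operators and eigenvalue polynomials\<close>

text \<open>
  The identification of \<open>P^d(V) \<otimes> D^d(V)\<close> with \<open>End (P^d(V))\<close>, where \<open>D^d(V)\<close> is dual
  to \<open>P^d(V)\<close> via \<open>(D, p) \<mapsto> D p\<close>, sends a normally ordered operator to its restriction to
  \<open>P^d(V)\<close>. So the operator corresponding to the identity of \<open>V\<^sub>\<lambda>\<close> is the one in
  \<open>P^d(V) \<otimes> D^d(V)\<close>, \<open>d = |\<lambda>|\<close>, that restricts to the projection onto \<open>V\<^sub>\<lambda>\<close> along the other \<open>V\<^sub>\<mu>\<close>.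
\<close>

definition capelli ::
    "nat \<Rightarrow> (complex^('a::finite + 'b::{finite,linorder}) \<Rightarrow> complex^('a + 'b) \<Rightarrow> complex)
      \<Rightarrow> nat \<times> nat \<Rightarrow> ('a, 'b) superpoly \<Rightarrow> ('a, 'b) superpoly" where
  "capelli k \<omega> l = (THE D. D \<in> invariant_diff_ops \<omega> \<and> D \<in> diff_ops_part (psize l) (psize l) \<and>
     (\<forall>p\<in>V_module k \<omega> l. D p = p) \<and>
     (\<forall>u\<in>index_set k. psize u = psize l \<and> u \<noteq> l \<longrightarrow> (\<forall>p\<in>V_module k \<omega> u. D p = 0)))"

definition eigenvalues_on ::
    "(('u \<Rightarrow>\<^sub>0 complex) \<Rightarrow> ('u \<Rightarrow>\<^sub>0 complex)) \<Rightarrow> ('u \<Rightarrow>\<^sub>0 complex) set \<Rightarrow> complex set" where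
  "eigenvalues_on D U = {c. \<exists>p\<in>U. p \<noteq> 0 \<and> D p = scl c p}"

text \<open>
  Polynomials in \<open>x\<close> and \<open>y\<close> are represented by \<open>complex poly poly\<close>, i.e. as polynomials in \<open>y\<close>
  whose coefficients are polynomials in \<open>x\<close>.
\<close>

definition poly2 :: "complex poly poly \<Rightarrow> complex \<Rightarrow> complex \<Rightarrow> complex" where
  "poly2 f x y = poly (poly f [:y:]) x"

definition symmetric_poly2 :: "complex poly poly \<Rightarrow> bool" where
  "symmetric_poly2 f \<longleftrightarrow> (\<forall>i j. coeff (coeff f i) j = coeff (coeff f j) i)"

definition eigenvalue_poly ::
    "nat \<Rightarrow> (complex^('a::finite + 'b::{finite,linorder}) \<Rightarrow> complex^('a + 'b) \<Rightarrow> complex)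
      \<Rightarrow> (('a, 'b) superpoly \<Rightarrow> ('a, 'b) superpoly) \<Rightarrow> complex poly poly" where
  "eigenvalue_poly k \<omega> D = (THE f. symmetric_poly2 f \<and> (\<forall>u\<in>index_set k.
     eigenvalues_on D (V_module k \<omega> u) = {poly2 f (of_nat (fst u) - of_nat k - 1) (of_nat (snd u))}))"


section \<open>Knop--Sahi polynomials\<close>

definition falling :: "'c::comm_ring_1 \<Rightarrow> nat \<Rightarrow> 'c" where
  "falling a r = (\<Prod>i<r. a - of_nat i)"

text \<open>
  The parameter \<open>\<kappa>\<close> is a complex number. Apart from finitely many values of \<open>\<kappa>\<close>, at which
  denominators vanish, this is the specialization of the polynomial over the field of rational
  functions in \<open>\<kappa>\<close>.
\<close>

definition knop_sahi :: "nat \<times> nat \<Rightarrow> complex \<Rightarrow> complex poly poly" where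
  "knop_sahi = (\<lambda>(l1, l2) \<kappa>. let a = l1 - l2 in
     \<Sum>(i, j)\<in>{(i, j). i + j \<le> a}.
       smult [:fact a * falling (\<kappa> + 1) (a - i) * falling (\<kappa> + 1) (a - j) /
               (fact i * fact j * fact (a - i - j) * falling (\<kappa> + 1) a):]
         (falling [:[:0, 1:]:] (l2 + i) * falling [:0, 1:] (l2 + j)))"

definition knop_sahi_norm :: "nat \<times> nat \<Rightarrow> complex \<Rightarrow> complex" where
  "knop_sahi_norm = (\<lambda>(l1, l2) \<kappa>. fact (l1 - l2) * fact l2 * falling (of_nat l1 - 1 - \<kappa>) l2)"

end

theory Submission
  imports Defs
begin

text \<open>
  Write \<open>R\<close> for the quadratic form of \<open>\<omega>\<close>, \<open>\<Delta>\<close> for the dual Laplacian and \<open>E\<close> for the Euler operator.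
  The tensor of any pair of dual bases of \<open>osp\<close> can be computed from the projection of \<open>gl\<close> onto \<open>osp\<close>;
  this gives \<open>C = E(E - 2k - 2) - R\<Delta>\<close>. So \<open>V\<^sub>\<lambda>\<close> is the generalized eigenspace of
  \<open>Q = R\<Delta>/4\<close> in degree \<open>d = |\<lambda>|\<close> for the eigenvalue \<open>\<tau>\<^sub>s = s(d - k - 1 - s)\<close>, \<open>s = \<lambda>\<^sub>2\<close>. From
  \<open>R\<^sup>a\<Delta>\<^sup>a = 4\<^sup>a \<Prod>\<^bsub>s<a\<^esub> (Q - \<tau>\<^sub>s)\<close> in degree \<open>d\<close> it follows that every polynomial in \<open>Q\<close> on \<open>P\<^sup>d(V)\<close> extends to an
  invariant normally ordered operator with an explicit eigenvalue polynomial, in Newton form with nodes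
  \<open>\<tau>\<^sub>0, \<tau>\<^sub>1, \<dots>\<close>. For quasiregular \<open>\<lambda>\<close> exactly the nodes of \<open>\<lambda>\<close> and \<open>\<lambda>\<^sup>\<dagger>\<close> coincide at \<open>\<tau>\<^sub>s\<close>, and \<open>D\<^sub>\<lambda>\<close>
  is the Hermite interpolation polynomial that is 1 to second order at this double node and vanishes at
  all other nodes.

  On the other side, the Chu--Vandermonde identity shows that \<open>P\<^sub>\<lambda>/H\<^sub>\<lambda>\<close> is, for generic \<open>\<kappa>\<close>, the Newton
  form of the Lagrange interpolation polynomial at the node of \<open>\<lambda>\<close>, where the nodes are now simple. The sum of the
  Lagrange polynomials of two colliding nodes converges to the Hermite polynomial.
\<close>


section \<open>Linear operators on superpolynomials\<close>

text \<open>The numbers \<tau>_s come from an sl_2-triple: the superdimension is -2k, so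
  [\<Delta>, R] = 4(E - k), and R^s h with h harmonic of degree d - 2s has Q-eigenvalue s(d - k - 1
  - s). For s different from s', \<tau>_s = \<tau>_s' exactly if s + s' = d - k - 1, and \<lambda>_1
  - k - 1 is the second entry of the dagger of \<lambda>: this is the origin of the involution. At
  such a pair Q need not be diagonalizable, so the projection onto V_\<lambda> has to be a
  polynomial that is right to second order. There each of the two Lagrange polynomials has a pole at
  \<kappa> = k; only their sum stays finite. The Casimir operator, the Capelli operator and the
  eigenvalue polynomial are definite descriptions, so each needs existence and uniqueness. The
  tensor of dual bases is unique and an explicit pair of bases exists; an operator of order d is
  determined by its restriction to degree d; a polynomial is determined by its values on the index
  set, and its existence also requires an actual eigenvector in every V_\<mu>, obtained from powers
  of an isotropic linear form.\<close>

abbreviation linear_op :: "(('u \<Rightarrow>\<^sub>0 complex) \<Rightarrow> ('w \<Rightarrow>\<^sub>0 complex)) \<Rightarrow> bool" where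
  "linear_op \<equiv> Vector_Spaces.linear scl scl"

lemma linear_op_iff:
  "linear_op A \<longleftrightarrow> (\<forall>p q. A (p + q) = A p + A q) \<and> (\<forall>c p. A (scl c p) = scl c (A p))"
  by (auto simp: Vector_Spaces.linear_def module_hom_def module_hom_axioms_def
      superpoly.vector_space_axioms superpoly.module_axioms)

lemma linear_opI:
  "(\<And>p q. A (p + q) = A p + A q) \<Longrightarrow> (\<And>c p. A (scl c p) = scl c (A p)) \<Longrightarrow> linear_op A"
  by (simp add: linear_op_iff)

lemma linear_op_add: "linear_op A \<Longrightarrow> A (p + q) = A p + A q"
  and linear_op_scl: "linear_op A \<Longrightarrow> A (scl c p) = scl c (A p)"
  by (simp_all add: linear_op_iff)

lemma linear_op_zero: "linear_op A \<Longrightarrow> A 0 = 0"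
  using linear_op_scl[of A 0 0] by simp

lemma linear_op_uminus: "linear_op A \<Longrightarrow> A (- p) = - A p"
  using linear_op_scl[of A "-1" p] by simp

lemma linear_op_diff: "linear_op A \<Longrightarrow> A (p - q) = A p - A q"
  using linear_op_add[of A p "- q"] by (simp add: linear_op_uminus)

lemma linear_op_sum: "linear_op A \<Longrightarrow> A (\<Sum>i\<in>I. f i) = (\<Sum>i\<in>I. A (f i))"
  by (induction I rule: infinite_finite_induct) (simp_all add: linear_op_zero linear_op_add)

lemmas linear_op_simps = linear_op_add linear_op_scl linear_op_zero linear_op_uminus
  linear_op_diff linear_op_sum

lemma linear_op_id: "linear_op (\<lambda>p. p)"
  and linear_op_comp: "linear_op A \<Longrightarrow> linear_op B \<Longrightarrow> linear_op (\<lambda>p. A (B p))"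
  and linear_op_plus: "linear_op A' \<Longrightarrow> linear_op B' \<Longrightarrow> linear_op (\<lambda>p. A' p + B' p)"
  and linear_op_minus: "linear_op A' \<Longrightarrow> linear_op B' \<Longrightarrow> linear_op (\<lambda>p. A' p - B' p)"
  and linear_op_neg: "linear_op A' \<Longrightarrow> linear_op (\<lambda>p. - A' p)"
  and linear_op_scaled: "linear_op A' \<Longrightarrow> linear_op (\<lambda>p. scl c (A' p))"
  and linear_op_const0: "linear_op (\<lambda>p. 0)"
  by (auto simp: linear_op_iff algebra_simps superpoly.scale_right_distrib
      superpoly.scale_right_diff_distrib)

lemma linear_op_sum_fun:
  "(\<And>i. i \<in> I \<Longrightarrow> linear_op (A i)) \<Longrightarrow> linear_op (\<lambda>p. \<Sum>i\<in>I. A i p)"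
  by (induction I rule: infinite_finite_induct) (simp_all add: linear_op_const0 linear_op_plus)

lemma linear_op_funpow: "linear_op A \<Longrightarrow> linear_op (A ^^ n)"
  for A :: "('u \<Rightarrow>\<^sub>0 complex) \<Rightarrow> ('u \<Rightarrow>\<^sub>0 complex)"
  by (induction n) (auto simp: linear_op_iff)

lemmas linear_op_intros = linear_op_id linear_op_plus linear_op_minus linear_op_neg
  linear_op_scaled linear_op_const0 linear_op_sum_fun linear_op_funpow

lemma scl_single [simp]: "scl c (Poly_Mapping.single u a) = Poly_Mapping.single u (c * a)"
  by (rule poly_mapping_eqI) (auto simp: lookup_single when_def)

lemma superpoly_eq_sum_single:
  "p = (\<Sum>u\<in>Poly_Mapping.keys p. scl (Poly_Mapping.lookup p u) (Poly_Mapping.single u 1))"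
  by (rule poly_mapping_eqI)
    (simp add: lookup_sum lookup_single when_def in_keys_iff if_distrib[of "(*) _"] cong: if_cong)

lemma lin_ext_eq_sum:
  assumes "finite K" "Poly_Mapping.keys p \<subseteq> K"
  shows "lin_ext F p = (\<Sum>u\<in>K. scl (Poly_Mapping.lookup p u) (F u))"
  unfolding lin_ext_def using assms by (intro sum.mono_neutral_left) (auto simp: in_keys_iff)

lemma linear_op_lin_ext [intro, simp]: "linear_op (lin_ext F)"
proof (rule linear_opI)
  fix p q :: "'a \<Rightarrow>\<^sub>0 complex" and c
  let ?K = "Poly_Mapping.keys p \<union> Poly_Mapping.keys q"
  have *: "finite ?K" by simp
  have "Poly_Mapping.keys (p + q) \<subseteq> ?K" by (rule Poly_Mapping.keys_add)
  then show "lin_ext F (p + q) = lin_ext F p + lin_ext F q"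
    by (simp add: lin_ext_eq_sum[OF *] lookup_add superpoly.scale_left_distrib sum.distrib)
  have "Poly_Mapping.keys (scl c p) \<subseteq> Poly_Mapping.keys p"
    by (auto simp: in_keys_iff)
  then have "lin_ext F (scl c p) = (\<Sum>u\<in>Poly_Mapping.keys p. scl (c * Poly_Mapping.lookup p u) (F u))"
    by (simp add: lin_ext_eq_sum[of "Poly_Mapping.keys p"])
  then show "lin_ext F (scl c p) = scl c (lin_ext F p)"
    by (simp add: lin_ext_def superpoly.scale_sum_right)
qed

lemma lin_ext_single [simp]: "lin_ext F (Poly_Mapping.single u c) = scl c (F u)"
  by (cases "c = 0") (simp_all add: lin_ext_def linear_op_zero)

lemma linear_op_ext:
  assumes "linear_op A" "linear_op B"
    and "\<And>u. A (Poly_Mapping.single u 1) = B (Poly_Mapping.single u 1)"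
  shows "A = B"
proof
  fix p
  show "A p = B p"
    by (subst (1 2) superpoly_eq_sum_single[of p])
      (simp only: linear_op_sum[OF assms(1)] linear_op_sum[OF assms(2)] linear_op_scl[OF assms(1)]
        linear_op_scl[OF assms(2)] assms(3))
qed

lemma linear_op_coord_mult [intro, simp]: "linear_op (coord_mult i)"
proof (cases i)
  case (Inl a)
  then have "coord_mult i = lin_ext (\<lambda>(\<alpha>, S). Poly_Mapping.single (\<alpha>(a := \<alpha> a + 1), S) 1)"
    by auto
  then show ?thesis by simp
next
  case (Inr b)
  then have "coord_mult i = lin_ext (\<lambda>(\<alpha>, S). if b \<in> S then 0
       else Poly_Mapping.single (\<alpha>, insert b S) ((-1) ^ card {l \<in> S. l < b}))"
    by auto
  then show ?thesis by simp
qed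

lemma linear_op_coord_deriv [intro, simp]: "linear_op (coord_deriv i)"
proof (cases i)
  case (Inl a)
  then have "coord_deriv i
      = lin_ext (\<lambda>(\<alpha>, S). Poly_Mapping.single (\<alpha>(a := \<alpha> a - 1), S) (of_nat (\<alpha> a)))"
    by auto
  then show ?thesis by simp
next
  case (Inr b)
  then have "coord_deriv i = lin_ext (\<lambda>(\<alpha>, S). if b \<in> S
       then Poly_Mapping.single (\<alpha>, S - {b}) ((-1) ^ card {l \<in> S. l < b}) else 0)"
    by auto
  then show ?thesis by simp
qed

lemma linear_op_coord_mult_comp: "linear_op A \<Longrightarrow> linear_op (\<lambda>p. coord_mult i (A p))"
  and linear_op_coord_deriv_comp: "linear_op A \<Longrightarrow> linear_op (\<lambda>p. coord_deriv i (A p))"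
  by (auto intro: linear_op_comp)

lemmas linear_op_intros' = linear_op_intros linear_op_coord_mult_comp linear_op_coord_deriv_comp

lemma linear_op_if: "linear_op A \<Longrightarrow> linear_op B \<Longrightarrow> linear_op (\<lambda>p. if b then A p else B p)"
  by (cases b) simp_all

section \<open>The relations of the Weyl-Clifford superalgebra\<close>

abbreviation sgn2 :: "'a + 'b \<Rightarrow> 'c + 'd \<Rightarrow> complex" where
  "sgn2 i j \<equiv> (-1) ^ (parity_index i * parity_index j)"

lemma scl_minus_one [simp]: "scl (-1) p = - p"
  by (rule poly_mapping_eqI) simp

text \<open>The sign in \<open>coord_mult\<close> and \<open>coord_deriv\<close> under a name of its
  own, so that its behaviour under insertion and deletion becomes a rewrite rule instead of a count
  of sets.\<close>

definition pass_sign :: "'b::linorder set \<Rightarrow> 'b \<Rightarrow> complex" where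
  "pass_sign S j = (-1) ^ card {l \<in> S. l < j}"

lemma pass_sign_insert [simp]:
  fixes j :: "'b::{finite,linorder}"
  assumes "i \<notin> S"
  shows "pass_sign (insert i S) j = (if i < j then - pass_sign S j else pass_sign S j)"
proof -
  have "{l \<in> insert i S. l < j} = (if i < j then insert i {l \<in> S. l < j} else {l \<in> S. l < j})"
    by auto
  then show ?thesis using assms by (simp add: pass_sign_def)
qed

lemma pass_sign_remove [simp]:
  fixes j :: "'b::{finite,linorder}"
  assumes "i \<in> S"
  shows "pass_sign (S - {i}) j = (if i < j then - pass_sign S j else pass_sign S j)"
  using pass_sign_insert[of i "S - {i}" j] assms by (auto simp: insert_absorb)

lemma pass_sign_square [simp]: "pass_sign S j * pass_sign S j = 1"
  "pass_sign S j * (c * pass_sign S j) = c"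
  by (simp_all add: pass_sign_def flip: power_mult_distrib)

lemma coord_mult_Inl_single [simp]:
  "coord_mult (Inl i) (Poly_Mapping.single (\<alpha>, S) c) = Poly_Mapping.single (\<alpha>(i := \<alpha> i + 1), S) c"
  by simp

lemma coord_mult_Inr_single [simp]:
  "coord_mult (Inr j) (Poly_Mapping.single (\<alpha>, S) c) = (if j \<in> S then 0
     else Poly_Mapping.single (\<alpha>, insert j S) (c * pass_sign S j))"
  by (simp add: pass_sign_def)

lemma coord_deriv_Inl_single [simp]:
  "coord_deriv (Inl i) (Poly_Mapping.single (\<alpha>, S) c)
     = Poly_Mapping.single (\<alpha>(i := \<alpha> i - 1), S) (c * of_nat (\<alpha> i))"
  by simp

lemma coord_deriv_Inr_single [simp]:
  "coord_deriv (Inr j) (Poly_Mapping.single (\<alpha>, S) c) = (if j \<in> S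
     then Poly_Mapping.single (\<alpha>, S - {j}) (c * pass_sign S j) else 0)"
  by (simp add: pass_sign_def)

declare coord_mult.simps [simp del] coord_deriv.simps [simp del]

lemma coord_mult_zero [simp]: "coord_mult i 0 = 0"
  and coord_deriv_zero [simp]: "coord_deriv i 0 = 0"
  by (simp_all add: linear_op_zero)

text \<open>Only two odd coordinates are delicate: the factor inserted second passes the one
  inserted first in exactly one of the two orders, and this gives the sign.\<close>

lemma coord_mult_commute:
  "coord_mult i (coord_mult j p) = scl (sgn2 i j) (coord_mult j (coord_mult i p))"
  for p :: "('a::finite, 'b::{finite,linorder}) superpoly"
proof -
  have "(\<lambda>p. coord_mult i (coord_mult j p)) = (\<lambda>p :: ('a, 'b) superpoly. scl (sgn2 i j) (coord_mult j (coord_mult i p)))"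
  proof (rule linear_op_ext, goal_cases)
    case (3 u)
    obtain \<alpha> S where u: "u = (\<alpha>, S)" by (cases u)
    show ?case
    proof (cases i; cases j)
      fix a b assume "i = Inr a" "j = Inr b"
      then show ?case
        by (cases "a = b"; cases "a \<in> S"; cases "b \<in> S"; cases "a < b"; cases "b < a")
          (auto simp: u linear_op_simps insert_commute single_uminus mult.commute)
    qed (auto simp: u linear_op_simps fun_upd_twist)
  qed (intro linear_op_intros' linear_op_if)+
  then show ?thesis by (rule fun_cong)
qed

lemma coord_deriv_commute:
  "coord_deriv i (coord_deriv j p) = scl (sgn2 i j) (coord_deriv j (coord_deriv i p))"
  for p :: "('a::finite, 'b::{finite,linorder}) superpoly"
proof -
  have "(\<lambda>p. coord_deriv i (coord_deriv j p)) = (\<lambda>p :: ('a, 'b) superpoly. scl (sgn2 i j) (coord_deriv j (coord_deriv i p)))"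
  proof (rule linear_op_ext, goal_cases)
    case (3 u)
    obtain \<alpha> S where u: "u = (\<alpha>, S)" by (cases u)
    show ?case
    proof (cases i; cases j)
      fix a b assume ij: "i = Inr a" "j = Inr b"
      have "S - {a} - {b} = S - {b} - {a}" by auto
      then show ?case using ij
        by (cases "a = b"; cases "a \<in> S"; cases "b \<in> S"; cases "a < b"; cases "b < a")
          (auto simp: u linear_op_simps single_uminus mult.commute)
    next
      fix a b assume ij: "i = Inl a" "j = Inl b"
      then show ?case
        by (cases "a = b") (auto simp: u linear_op_simps fun_upd_twist mult.commute)
    qed (auto simp: u linear_op_simps mult.commute)
  qed (intro linear_op_intros' linear_op_if)+
  then show ?thesis by (rule fun_cong)
qed

text \<open>The contraction term comes from the factor j itself. For i = j odd exactly one of the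
  two products survives, according to whether the monomial contains that coordinate.\<close>

lemma coord_deriv_mult:
  "coord_deriv i (coord_mult j p)
     = (if i = j then p else 0) + scl (sgn2 i j) (coord_mult j (coord_deriv i p))"
  for p :: "('a::finite, 'b::{finite,linorder}) superpoly"
proof -
  have "(\<lambda>p. coord_deriv i (coord_mult j p)) = (\<lambda>p :: ('a, 'b) superpoly. (if i = j then p else 0) + scl (sgn2 i j) (coord_mult j (coord_deriv i p)))"
  proof (rule linear_op_ext, goal_cases)
    case (3 u)
    obtain \<alpha> S where u: "u = (\<alpha>, S)" by (cases u)
    show ?case
    proof (cases i; cases j)
      fix a b assume ij: "i = Inr a" "j = Inr b"
      have "a \<noteq> b \<Longrightarrow> insert b S - {a} = insert b (S - {a})" by auto
      then show ?case using ij
        by (cases "a = b"; cases "a \<in> S"; cases "b \<in> S"; cases "a < b"; cases "b < a")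
          (auto simp: u linear_op_simps single_uminus insert_absorb mult.commute)
    next
      fix a b assume ij: "i = Inl a" "j = Inl b"
      show ?case
      proof (cases "a = b")
        case True
        have "\<alpha> a > 0 \<Longrightarrow> \<alpha>(a := Suc (\<alpha> a - Suc 0)) = \<alpha>"
          "\<alpha> a = 0 \<Longrightarrow> \<alpha>(a := 0) = \<alpha>" by auto
        then show ?thesis using True ij
          by (cases "\<alpha> a = 0") (auto simp: u linear_op_simps simp flip: single_add)
      qed (use ij in \<open>auto simp: u linear_op_simps fun_upd_twist\<close>)
    qed (auto simp: u linear_op_simps mult.commute)
  qed (intro linear_op_intros' linear_op_if)+
  then show ?thesis by (rule fun_cong)
qed


section \<open>The quadratic form, the Laplacian and the Euler operator\<close>

lemmas coord_simps = linear_op_simps[OF linear_op_coord_mult] linear_op_simps[OF linear_op_coord_deriv]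

lemma parity_index_cases: "parity_index i = 0 \<or> parity_index i = 1"
  by (cases i) auto

abbreviation sgn1 :: "'a + 'b \<Rightarrow> complex" where
  "sgn1 i \<equiv> (-1) ^ parity_index i"

lemma sum_delta_scl [simp]:
  "finite A \<Longrightarrow> (\<Sum>i\<in>A. scl (if i = j then c i else 0) (f i)) = (if j \<in> A then scl (c j) (f j) else 0)"
  "finite A \<Longrightarrow> (\<Sum>i\<in>A. scl (if j = i then c i else 0) (f i)) = (if j \<in> A then scl (c j) (f j) else 0)"
  by (simp_all add: if_distrib[of "\<lambda>c. scl c _"] cong: if_cong)

lemma scl_two: "scl 2 p = p + p"
  by (rule poly_mapping_eqI) (simp add: lookup_add)

definition euler :: "('a::finite, 'b::{finite,linorder}) superpoly \<Rightarrow> ('a, 'b) superpoly" where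
  "euler p = (\<Sum>i\<in>UNIV. coord_mult i (coord_deriv i p))"

text \<open>\<open>g\<close> is the Gram matrix of the form on the standard basis and
  \<open>G\<close> its inverse. As \<open>g\<close> is even, the supersymmetry sign
  \<open>sgn2 i j\<close> may be written as \<open>sgn1 i\<close>.\<close>

locale super_form =
  fixes g G :: "'a::finite + 'b::{finite,linorder} \<Rightarrow> 'a + 'b \<Rightarrow> complex"
  assumes g_even: "parity_index i \<noteq> parity_index j \<Longrightarrow> g i j = 0"
    and g_sym: "g i j = sgn1 i * g j i"
    and gG: "(\<Sum>j\<in>UNIV. g i j * G j l) = (if i = l then 1 else 0)"
    and Gg: "(\<Sum>j\<in>UNIV. G i j * g j l) = (if i = l then 1 else 0)"
begin

text \<open>Symmetries of the Gram matrix pass to its inverse in this way: a transformed copy of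
  \<open>G\<close> that is again a left inverse must be \<open>G\<close>.\<close>

lemma left_inverse_unique:
  assumes "\<And>i l. (\<Sum>j\<in>UNIV. H i j * g j l) = (if i = l then 1 else 0)"
  shows "H i l = G i l"
proof -
  have "H i l = (\<Sum>j\<in>UNIV. H i j * (\<Sum>m\<in>UNIV. g j m * G m l))"
    by (simp add: gG if_distrib[of "(*) _"] cong: if_cong)
  also have "\<dots> = (\<Sum>m\<in>UNIV. (\<Sum>j\<in>UNIV. H i j * g j m) * G m l)"
    unfolding sum_distrib_left sum_distrib_right by (subst sum.swap) (simp add: mult.assoc)
  also have "\<dots> = G i l"
    by (simp add: assms if_distrib[of "\<lambda>c. c * _"] cong: if_cong)
  finally show ?thesis .
qed

lemma G_even: assumes "parity_index i \<noteq> parity_index j" shows "G i j = 0"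
proof -
  have "sgn1 i * G i j * sgn1 j = G i j" for i j
  proof (rule left_inverse_unique)
    fix i l
    have "sgn1 i * G i j * sgn1 j * g j l = sgn1 i * sgn1 l * (G i j * g j l)" for j
      using g_even[of j l] by (cases "parity_index j = parity_index l") auto
    then have "(\<Sum>j\<in>UNIV. sgn1 i * G i j * sgn1 j * g j l)
        = sgn1 i * sgn1 l * (\<Sum>j\<in>UNIV. G i j * g j l)"
      by (simp only: sum_distrib_left)
    then show "(\<Sum>j\<in>UNIV. sgn1 i * G i j * sgn1 j * g j l) = (if i = l then 1 else 0)"
      by (simp add: Gg flip: power_mult_distrib)
  qed
  from this[of i j] show ?thesis
    using assms parity_index_cases[of i] parity_index_cases[of j] by auto
qed

lemma G_sym: "G i j = sgn1 i * G j i"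
proof (rule left_inverse_unique[symmetric])
  fix i l
  have "sgn1 i * G j i * g j l = g l j * G j i" for j
    using G_even[of j i] g_sym[of l j] g_sym[of j l]
    by (cases "parity_index j = parity_index i") auto
  then have "(\<Sum>j\<in>UNIV. sgn1 i * G j i * g j l) = (\<Sum>j\<in>UNIV. g l j * G j i)"
    by (simp only:)
  then show "(\<Sum>j\<in>UNIV. sgn1 i * G j i * g j l) = (if i = l then 1 else 0)"
    by (auto simp: gG)
qed

text \<open>For odd coordinates the index order in \<open>g j i\<close> is a choice of sign. This
  one matches the order in \<open>Lap\<close>, so that the cross terms in \<open>Lap_R2\<close> add
  up to the Euler operator in both parities.\<close>

definition R2 :: "('a, 'b) superpoly \<Rightarrow> ('a, 'b) superpoly" where
  "R2 p = (\<Sum>i\<in>UNIV. \<Sum>j\<in>UNIV. scl (g j i) (coord_mult i (coord_mult j p)))"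

definition Lap :: "('a, 'b) superpoly \<Rightarrow> ('a, 'b) superpoly" where
  "Lap p = (\<Sum>i\<in>UNIV. \<Sum>j\<in>UNIV. scl (G i j) (coord_deriv i (coord_deriv j p)))"

lemma linear_op_R2: "linear_op R2"
  unfolding R2_def[abs_def] by (intro linear_op_intros')

lemma linear_op_Lap: "linear_op Lap"
  unfolding Lap_def[abs_def] by (intro linear_op_intros')

text \<open>Next to a factor \<open>g i j\<close> the parity of i may be traded for that of j, and
  the pair i, j passes any l without a sign. All sign bookkeeping for \<open>R2\<close> comes down
  to these rules, as does that for \<open>Lap\<close> with \<open>G\<close>.\<close>

lemma g_sgn2: "g i j * sgn2 i l = g i j * sgn2 j l" "g i j * sgn2 l i = g i j * sgn2 l j"
  "g i j * sgn2 j i = g j i" "g i j * sgn2 i j = g j i"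
  "g i j * (sgn2 i l * sgn2 j l) = g i j" "g i j * (sgn2 l i * sgn2 l j) = g i j"
  "g i j * (sgn2 j l * sgn2 i l) = g i j" "g i j * (sgn2 l j * sgn2 l i) = g i j"
proof -
  have "g i j = 0 \<and> g j i = 0 \<or> parity_index i = 0 \<and> parity_index j = 0 \<and> g j i = g i j
      \<or> parity_index i = 1 \<and> parity_index j = 1 \<and> g j i = - g i j"
    using g_even[of i j] g_even[of j i] g_sym[of j i] parity_index_cases[of i] parity_index_cases[of j]
    by auto
  moreover have "sgn1 l * sgn1 l = 1" by (simp flip: power_mult_distrib)
  ultimately show "g i j * sgn2 i l = g i j * sgn2 j l" "g i j * sgn2 l i = g i j * sgn2 l j"
    "g i j * sgn2 j i = g j i" "g i j * sgn2 i j = g j i"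
    "g i j * (sgn2 i l * sgn2 j l) = g i j" "g i j * (sgn2 l i * sgn2 l j) = g i j"
    "g i j * (sgn2 j l * sgn2 i l) = g i j" "g i j * (sgn2 l j * sgn2 l i) = g i j"
    by (elim disjE conjE; simp)+
qed

lemma G_sgn2: "G i j * sgn2 i l = G i j * sgn2 j l" "G i j * sgn2 l i = G i j * sgn2 l j"
  "G i j * sgn2 j i = G j i" "G i j * sgn2 i j = G j i"
  "G i j * (sgn2 i l * sgn2 j l) = G i j" "G i j * (sgn2 l i * sgn2 l j) = G i j"
  "G i j * (sgn2 j l * sgn2 i l) = G i j" "G i j * (sgn2 l j * sgn2 l i) = G i j"
proof -
  have "G i j = 0 \<and> G j i = 0 \<or> parity_index i = 0 \<and> parity_index j = 0 \<and> G j i = G i j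
      \<or> parity_index i = 1 \<and> parity_index j = 1 \<and> G j i = - G i j"
    using G_even[of i j] G_even[of j i] G_sym[of j i] parity_index_cases[of i] parity_index_cases[of j]
    by auto
  moreover have "sgn1 l * sgn1 l = 1" by (simp flip: power_mult_distrib)
  ultimately show "G i j * sgn2 i l = G i j * sgn2 j l" "G i j * sgn2 l i = G i j * sgn2 l j"
    "G i j * sgn2 j i = G j i" "G i j * sgn2 i j = G j i"
    "G i j * (sgn2 i l * sgn2 j l) = G i j" "G i j * (sgn2 l i * sgn2 l j) = G i j"
    "G i j * (sgn2 j l * sgn2 i l) = G i j" "G i j * (sgn2 l j * sgn2 l i) = G i j"
    by (elim disjE conjE; simp)+
qed

lemma sgn2_sq [simp]: "sgn2 i j * sgn2 i j = 1" "sgn2 i j * (sgn2 i j * c) = c"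
  by (simp_all flip: power_mult_distrib mult.assoc)

lemma R2_mult: "R2 (coord_mult l p) = coord_mult l (R2 p)"
proof -
  have "scl (g j i) (coord_mult i (coord_mult j (coord_mult l p)))
      = coord_mult l (scl (g j i) (coord_mult i (coord_mult j p)))" for i j
  proof -
    have "coord_mult i (coord_mult j (coord_mult l p))
        = scl (sgn2 j l * sgn2 i l) (coord_mult l (coord_mult i (coord_mult j p)))"
      by (subst coord_mult_commute[of j l], simp only: coord_simps, subst coord_mult_commute[of i l])
        simp
    moreover have "g j i * (sgn2 j l * sgn2 i l) = g j i"
      by (rule g_sgn2)
    ultimately show ?thesis by (simp add: coord_simps)
  qed
  then show ?thesis
    unfolding R2_def linear_op_sum[OF linear_op_coord_mult] by (simp only:)
qed

lemma Lap_deriv: "Lap (coord_deriv l p) = coord_deriv l (Lap p)"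
proof -
  have "scl (G i j) (coord_deriv i (coord_deriv j (coord_deriv l p)))
      = coord_deriv l (scl (G i j) (coord_deriv i (coord_deriv j p)))" for i j
  proof -
    have "coord_deriv i (coord_deriv j (coord_deriv l p))
        = scl (sgn2 j l * sgn2 i l) (coord_deriv l (coord_deriv i (coord_deriv j p)))"
      by (subst coord_deriv_commute[of j l], simp only: coord_simps, subst coord_deriv_commute[of i l])
        simp
    moreover have "G i j * (sgn2 j l * sgn2 i l) = G i j"
      by (rule G_sgn2)
    ultimately show ?thesis by (simp add: coord_simps)
  qed
  then show ?thesis
    unfolding Lap_def linear_op_sum[OF linear_op_coord_deriv] by (simp only:)
qed

text \<open>The derivation meets either factor of the quadratic form. In the second case the sign
  for passing the first factor is exactly the one that exchanges the indices of \<open>g\<close>, so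
  the two contractions agree.\<close>

lemma deriv_R2:
  "coord_deriv l (R2 p) = scl 2 (\<Sum>j\<in>UNIV. scl (g j l) (coord_mult j p)) + R2 (coord_deriv l p)"
proof -
  have "scl (g j i) (coord_deriv l (coord_mult i (coord_mult j p)))
      = scl (if i = l then g j l else 0) (coord_mult j p) + scl (if j = l then g i l else 0) (coord_mult i p)
        + scl (g j i) (coord_mult i (coord_mult j (coord_deriv l p)))" for i j
  proof -
    have *: "coord_deriv l (coord_mult i (coord_mult j p))
      = scl (if i = l then 1 else 0) (coord_mult j p)
        + scl (if j = l then sgn2 l i else 0) (coord_mult i p)
        + scl (sgn2 l i * sgn2 l j) (coord_mult i (coord_mult j (coord_deriv l p)))"
      by (auto simp: coord_deriv_mult coord_simps superpoly.scale_right_distrib)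
    show ?thesis
      unfolding * superpoly.scale_right_distrib superpoly.scale_scale g_sgn2(8)
      by (auto simp: g_sgn2(4))
  qed
  then have "coord_deriv l (R2 p) = (\<Sum>j\<in>UNIV. scl (g j l) (coord_mult j p))
      + (\<Sum>j\<in>UNIV. scl (g j l) (coord_mult j p)) + R2 (coord_deriv l p)"
    by (simp add: R2_def coord_simps sum.distrib)
      (subst sum.swap, simp)
  then show ?thesis by (simp add: scl_two)
qed

lemma Lap_mult:
  "Lap (coord_mult l p) = coord_mult l (Lap p) + scl 2 (\<Sum>i\<in>UNIV. scl (G i l) (coord_deriv i p))"
proof -
  have "scl (G i j) (coord_deriv i (coord_deriv j (coord_mult l p)))
      = scl (if j = l then G i l else 0) (coord_deriv i p) + scl (if i = l then G j l else 0) (coord_deriv j p)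
        + scl (G i j) (coord_mult l (coord_deriv i (coord_deriv j p)))" for i j
  proof -
    have *: "coord_deriv i (coord_deriv j (coord_mult l p))
      = scl (if j = l then 1 else 0) (coord_deriv i p)
        + scl (if i = l then sgn2 j l else 0) (coord_deriv j p)
        + scl (sgn2 j l * sgn2 i l) (coord_mult l (coord_deriv i (coord_deriv j p)))"
      by (auto simp: coord_deriv_mult coord_simps superpoly.scale_right_distrib)
    show ?thesis
      unfolding * superpoly.scale_right_distrib superpoly.scale_scale G_sgn2(7)
      by (auto simp: G_sgn2(3))
  qed
  then have "Lap (coord_mult l p) = (\<Sum>j\<in>UNIV. scl (G j l) (coord_deriv j p))
      + (\<Sum>j\<in>UNIV. scl (G j l) (coord_deriv j p)) + coord_mult l (Lap p)"
    by (simp add: Lap_def coord_simps sum.distrib)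
      (subst sum.swap, simp)
  then show ?thesis by (simp add: scl_two)
qed

text \<open>The contraction of the form with its inverse is the superdimension; this is how k gets
  into the relation between \<open>Lap\<close> and \<open>R2\<close>.\<close>

lemma sum_g_G_sgn: "(\<Sum>i\<in>UNIV. \<Sum>j\<in>UNIV. G i j * g i j) = (\<Sum>i\<in>UNIV. sgn1 (i :: 'a + 'b))"
proof -
  have "G i j * g i j = sgn1 i * (G i j * g j i)" for i j
    using g_sym[of i j] by simp
  then have "(\<Sum>j\<in>UNIV. G i j * g i j) = sgn1 i * (\<Sum>j\<in>UNIV. G i j * g j i)" for i
    by (simp only: sum_distrib_left)
  then show ?thesis by (simp add: Gg)
qed

text \<open>The sl_2 relation. Both derivations hitting the quadratic form give the superdimension;
  exactly one of them hitting it gives \<open>scl 2 (euler p)\<close> for each of the two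
  choices.\<close>

lemma Lap_R2:
  "Lap (R2 p) = R2 (Lap p) + scl 4 (euler p) + scl (2 * (\<Sum>i\<in>UNIV. sgn1 (i :: 'a + 'b))) p"
proof -
  have *: "coord_deriv i (coord_deriv j (R2 p)) =
     scl (2 * g i j) p + (\<Sum>l\<in>UNIV. scl (2 * g l j * sgn2 i l) (coord_mult l (coord_deriv i p)))
      + (\<Sum>l\<in>UNIV. scl (2 * g l i) (coord_mult l (coord_deriv j p)))
      + R2 (coord_deriv i (coord_deriv j p))" for i j
  proof -
    have A: "coord_deriv i (\<Sum>l\<in>UNIV. scl (g l j) (coord_mult l p)) = scl (g i j) p
        + (\<Sum>l\<in>UNIV. scl (g l j * sgn2 i l) (coord_mult l (coord_deriv i p)))"
    proof -
      have "scl (g l j) (coord_deriv i (coord_mult l p)) = scl (if i = l then g i j else 0) p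
         + scl (g l j * sgn2 i l) (coord_mult l (coord_deriv i p))" for l
        by (simp add: coord_deriv_mult superpoly.scale_right_distrib)
      then show ?thesis by (simp add: coord_simps sum.distrib)
    qed
    show ?thesis
      unfolding deriv_R2 linear_op_add[OF linear_op_coord_deriv] linear_op_scl[OF linear_op_coord_deriv] A
      by (simp add: superpoly.scale_right_distrib superpoly.scale_sum_right mult.assoc add.assoc)
  qed
  have 1: "(\<Sum>i\<in>UNIV. \<Sum>j\<in>UNIV. scl (G i j) (scl (2 * g i j) p))
      = scl (2 * (\<Sum>i\<in>UNIV. sgn1 (i :: 'a + 'b))) p"
    by (simp add: sum_distrib_left superpoly.scale_sum_left mult_ac flip: sum_g_G_sgn)
  have 2: "(\<Sum>i\<in>UNIV. \<Sum>j\<in>UNIV. scl (G i j)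
      (\<Sum>l\<in>UNIV. scl (2 * g l j * sgn2 i l) (coord_mult l (coord_deriv i p)))) = scl 2 (euler p)"
  proof -
    have "G i j * (2 * g l j * sgn2 i l) = 2 * (g l j * G j i)" for i j l
    proof -
      have "G i j * (2 * g l j * sgn2 i l) = 2 * G i j * (g l j * sgn2 i l)" by simp
      also have "\<dots> = 2 * g l j * (G i j * sgn2 i j)" unfolding g_sgn2(2)[of l j i] by simp
      finally show ?thesis unfolding G_sgn2(4) by simp
    qed
    then have "(\<Sum>j\<in>UNIV. scl (G i j)
        (\<Sum>l\<in>UNIV. scl (2 * g l j * sgn2 i l) (coord_mult l (coord_deriv i p))))
        = (\<Sum>j\<in>UNIV. \<Sum>l\<in>UNIV. scl (2 * (g l j * G j i)) (coord_mult l (coord_deriv i p)))" for i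
      unfolding superpoly.scale_sum_right superpoly.scale_scale by (simp only:)
    also have "\<dots> i = (\<Sum>l\<in>UNIV. scl (2 * (\<Sum>j\<in>UNIV. g l j * G j i)) (coord_mult l (coord_deriv i p)))" for i
      by (subst sum.swap) (simp add: superpoly.scale_sum_left sum_distrib_left)
    also have "\<dots> i = scl 2 (coord_mult i (coord_deriv i p))" for i
      by (simp add: gG if_distrib[of "\<lambda>c. scl (_ * c) _"] cong: if_cong)
    finally show ?thesis by (simp add: euler_def superpoly.scale_sum_right)
  qed
  have 3: "(\<Sum>i\<in>UNIV. \<Sum>j\<in>UNIV. scl (G i j)
      (\<Sum>l\<in>UNIV. scl (2 * g l i) (coord_mult l (coord_deriv j p)))) = scl 2 (euler p)"
  proof -
    have "(\<Sum>i\<in>UNIV. scl (G i j) (\<Sum>l\<in>UNIV. scl (2 * g l i) (coord_mult l (coord_deriv j p))))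
        = (\<Sum>l\<in>UNIV. scl (2 * (\<Sum>i\<in>UNIV. g l i * G i j)) (coord_mult l (coord_deriv j p)))" for j
      unfolding superpoly.scale_sum_right
      by (subst sum.swap) (simp add: superpoly.scale_sum_left sum_distrib_left mult_ac)
    also have "\<dots> j = scl 2 (coord_mult j (coord_deriv j p))" for j
      by (simp add: gG if_distrib[of "\<lambda>c. scl (_ * c) _"] cong: if_cong)
    finally show ?thesis by (subst sum.swap) (simp add: euler_def superpoly.scale_sum_right)
  qed
  have 4: "(\<Sum>i\<in>UNIV. \<Sum>j\<in>UNIV. scl (G i j) (R2 (coord_deriv i (coord_deriv j p)))) = R2 (Lap p)"
    by (simp add: Lap_def linear_op_simps[OF linear_op_R2])
  have "Lap (R2 p) = scl (2 * (\<Sum>i\<in>UNIV. sgn1 (i :: 'a + 'b))) p + scl 2 (euler p)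
      + scl 2 (euler p) + R2 (Lap p)"
    unfolding Lap_def[of "R2 p"] * superpoly.scale_right_distrib sum.distrib 1 2 3 4 ..
  then show ?thesis
    by (simp add: algebra_simps flip: superpoly.scale_left_distrib)
qed

end

lemma sum_sgn1: "(\<Sum>i\<in>UNIV. sgn1 (i :: 'a::finite + 'b::finite)) = of_nat CARD('a) - of_nat CARD('b)"
  by (simp add: UNIV_Plus_UNIV[symmetric] sum.Plus del: UNIV_Plus_UNIV)

section \<open>The grading and the Euler operator\<close>

lemma euler_single: "euler (Poly_Mapping.single u c)
   = scl (of_nat (mono_degree u)) (Poly_Mapping.single u c)"
   for u :: "('a::finite \<Rightarrow> nat) \<times> 'b::{finite,linorder} set"
proof -
  obtain \<alpha> S where u: "u = (\<alpha>, S)" by (cases u)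
  have 1: "coord_mult (Inl a) (coord_deriv (Inl a) (Poly_Mapping.single u c))
      = Poly_Mapping.single u (c * of_nat (\<alpha> a))" for a
  proof -
    have "\<alpha> a > 0 \<Longrightarrow> \<alpha>(a := Suc (\<alpha> a - Suc 0)) = \<alpha>" by auto
    then show ?thesis by (cases "\<alpha> a = 0") (auto simp: u)
  qed
  have 2: "coord_mult (Inr b) (coord_deriv (Inr b) (Poly_Mapping.single u c))
      = Poly_Mapping.single u (if b \<in> S then c else 0)" for b
    by (auto simp: u insert_absorb mult.assoc)
  have 3: "(\<Sum>i\<in>I. Poly_Mapping.single u (f i)) = Poly_Mapping.single u (\<Sum>i\<in>I. f i)"
    for I :: "'i set" and f :: "'i \<Rightarrow> complex"
    by (induction I rule: infinite_finite_induct) (simp_all add: single_add)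
  show ?thesis
    by (simp add: euler_def UNIV_Plus_UNIV[symmetric] sum.Plus 1 2 3 del: UNIV_Plus_UNIV flip: single_add)
      (simp add: u mono_degree_def sum_distrib_left algebra_simps sum.If_cases)
qed

lemma linear_op_euler: "linear_op euler"
  unfolding euler_def[abs_def] by (intro linear_op_intros')

lemma lookup_euler:
  "Poly_Mapping.lookup (euler p) u = of_nat (mono_degree u) * Poly_Mapping.lookup p u"
proof -
  have "euler p = (\<Sum>v\<in>Poly_Mapping.keys p. scl (Poly_Mapping.lookup p v) (euler (Poly_Mapping.single v 1)))"
    by (subst superpoly_eq_sum_single[of p]) (simp only: linear_op_simps[OF linear_op_euler])
  then have "Poly_Mapping.lookup (euler p) u = (\<Sum>v\<in>Poly_Mapping.keys p. if v = u
      then Poly_Mapping.lookup p u * of_nat (mono_degree u) else 0)"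
    by (simp add: euler_single lookup_sum lookup_single when_def mult.commute cong: if_cong)
  then show ?thesis by (simp add: in_keys_iff)
qed

text \<open>Turns degree counting into an eigenvalue equation, so that the behaviour of degrees
  under operators follows from commutation relations with \<open>euler\<close>.\<close>

lemma homog_poly_iff_euler: "p \<in> homog_poly d \<longleftrightarrow> euler p = scl (of_nat d) p"
proof
  assume "p \<in> homog_poly d"
  then show "euler p = scl (of_nat d) p"
    by (intro poly_mapping_eqI) (auto simp: lookup_euler homog_poly_def in_keys_iff)
next
  assume *: "euler p = scl (of_nat d) p"
  have "mono_degree u = d" if "Poly_Mapping.lookup p u \<noteq> 0" for u
  proof -
    have "of_nat (mono_degree u) * Poly_Mapping.lookup p u = of_nat d * Poly_Mapping.lookup p u"
      using arg_cong[OF *, of "\<lambda>q. Poly_Mapping.lookup q u"] by (simp add: lookup_euler)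
    then show ?thesis using that by simp
  qed
  then show "p \<in> homog_poly d" by (auto simp: homog_poly_def in_keys_iff)
qed

lemma homog_poly_zero [simp]: "0 \<in> homog_poly d"
  by (simp add: homog_poly_def)

lemma homog_poly_add: "p \<in> homog_poly d \<Longrightarrow> q \<in> homog_poly d \<Longrightarrow> p + q \<in> homog_poly d"
  for p q :: "('a::finite, 'b::{finite,linorder}) superpoly"
  by (simp add: homog_poly_iff_euler linear_op_simps[OF linear_op_euler] superpoly.scale_right_distrib)

lemma homog_poly_scl: "p \<in> homog_poly d \<Longrightarrow> scl c p \<in> homog_poly d"
  for p :: "('a::finite, 'b::{finite,linorder}) superpoly"
  by (simp add: homog_poly_iff_euler linear_op_simps[OF linear_op_euler] mult.commute)

lemma homog_poly_uminus: "p \<in> homog_poly d \<Longrightarrow> - p \<in> homog_poly d"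
  for p :: "('a::finite, 'b::{finite,linorder}) superpoly"
  using homog_poly_scl[of p d "-1"] by simp

lemma homog_poly_diff: "p \<in> homog_poly d \<Longrightarrow> q \<in> homog_poly d \<Longrightarrow> p - q \<in> homog_poly d"
  for p q :: "('a::finite, 'b::{finite,linorder}) superpoly"
  using homog_poly_add[of p d "- q"] by (simp add: homog_poly_uminus)

lemma homog_poly_sum: "(\<And>i. i \<in> I \<Longrightarrow> f i \<in> homog_poly d) \<Longrightarrow> (\<Sum>i\<in>I. f i) \<in> homog_poly d"
  for f :: "'i \<Rightarrow> ('a::finite, 'b::{finite,linorder}) superpoly"
  by (induction I rule: infinite_finite_induct) (simp_all add: homog_poly_add)

lemma homog_poly_single: "Poly_Mapping.single u c \<in> homog_poly (mono_degree u)"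
  for u :: "('a::finite \<Rightarrow> nat) \<times> 'b::{finite,linorder} set"
  by (simp add: homog_poly_iff_euler euler_single)

lemma euler_mult: "euler (coord_mult j p) = coord_mult j (euler p) + coord_mult j p"
proof -
  have "coord_mult i (coord_deriv i (coord_mult j p))
      = (if i = j then coord_mult j p else 0) + coord_mult j (coord_mult i (coord_deriv i p))" for i
  proof -
    have "coord_mult i (coord_mult j q) = scl (sgn2 i j) (coord_mult j (coord_mult i q))"
      for q :: "('a, 'b) superpoly"
      by (rule coord_mult_commute)
    then show ?thesis
      by (simp add: coord_deriv_mult coord_simps flip: power_mult_distrib)
  qed
  then show ?thesis
    by (simp add: euler_def coord_simps sum.distrib add.commute)
qed

lemma euler_deriv: "euler (coord_deriv j p) = coord_deriv j (euler p) - coord_deriv j p"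
proof -
  have "coord_deriv j (coord_mult i (coord_deriv i p))
      = (if i = j then coord_deriv j p else 0) + coord_mult i (coord_deriv i (coord_deriv j p))" for i
  proof -
    have "coord_deriv j (coord_deriv i q) = scl (sgn2 i j) (coord_deriv i (coord_deriv j q))"
      for q :: "('a, 'b) superpoly"
      by (subst coord_deriv_commute) (simp add: mult.commute)
    then show ?thesis
      by (simp add: coord_deriv_mult coord_simps mult.commute flip: power_mult_distrib)
  qed
  then show ?thesis
    by (simp add: euler_def coord_simps sum.distrib add.commute)
qed

lemma homog_poly_mult: "p \<in> homog_poly d \<Longrightarrow> coord_mult j p \<in> homog_poly (Suc d)"
  by (simp add: homog_poly_iff_euler euler_mult coord_simps algebra_simps superpoly.scale_left_distrib)

lemma homog_poly_deriv: "p \<in> homog_poly (Suc d) \<Longrightarrow> coord_deriv j p \<in> homog_poly d"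
  by (simp add: homog_poly_iff_euler euler_deriv coord_simps algebra_simps superpoly.scale_left_distrib)

text \<open>A nonzero derivative of a constant would be an Euler eigenvector for -1, but Euler
  eigenvalues are degrees of monomials.\<close>

lemma homog_poly_deriv_0: assumes "p \<in> homog_poly 0" shows "coord_deriv j p = 0"
proof (rule poly_mapping_eqI)
  fix u
  have "euler (coord_deriv j p) = - coord_deriv j p"
    using assms by (simp add: homog_poly_iff_euler euler_deriv coord_simps)
  from arg_cong[OF this, of "\<lambda>q. Poly_Mapping.lookup q u"]
  have "of_nat (mono_degree u) * Poly_Mapping.lookup (coord_deriv j p) u
      = - Poly_Mapping.lookup (coord_deriv j p) u"
    by (simp add: lookup_euler)
  then have "of_nat (Suc (mono_degree u)) * Poly_Mapping.lookup (coord_deriv j p) u = 0"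
    by (simp add: algebra_simps)
  then show "Poly_Mapping.lookup (coord_deriv j p) u = Poly_Mapping.lookup 0 u"
    by (simp del: of_nat_Suc)
qed

lemma linear_op_eq_homog:
  fixes A B :: "('a::finite, 'b::{finite,linorder}) superpoly \<Rightarrow> ('u \<Rightarrow>\<^sub>0 complex)"
  assumes "linear_op A" "linear_op B" "\<And>d q. q \<in> homog_poly d \<Longrightarrow> A q = B q"
  shows "A = B"
  by (rule linear_op_ext[OF assms(1,2)]) (rule assms(3)[OF homog_poly_single])

context super_form
begin

lemma homog_poly_R2: "p \<in> homog_poly d \<Longrightarrow> R2 p \<in> homog_poly (d + 2)"
  unfolding R2_def by (intro homog_poly_sum homog_poly_scl) (simp add: homog_poly_mult)

lemma homog_poly_Lap: "p \<in> homog_poly (d + 2) \<Longrightarrow> Lap p \<in> homog_poly d"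
  unfolding Lap_def by (intro homog_poly_sum homog_poly_scl) (simp add: homog_poly_deriv)

lemma Lap_low_degree: assumes "p \<in> homog_poly d" "d < 2" shows "Lap p = 0"
proof -
  have "coord_deriv i (coord_deriv j p) = 0" for i j
    using assms homog_poly_deriv[of p 0 j] homog_poly_deriv_0[of p j] homog_poly_deriv_0[of "coord_deriv j p" i]
    by (cases "d = 0") (auto simp: less_2_cases_iff)
  then show ?thesis by (simp add: Lap_def)
qed

lemma homog_poly_R2_pow: "p \<in> homog_poly d \<Longrightarrow> (R2 ^^ a) p \<in> homog_poly (d + 2 * a)"
proof (induction a)
  case (Suc a)
  then show ?case using homog_poly_R2[of "(R2 ^^ a) p" "d + 2 * a"] by (simp add: add_ac)
qed simp

lemma homog_poly_Lap_pow: "p \<in> homog_poly (d + 2 * a) \<Longrightarrow> (Lap ^^ a) p \<in> homog_poly d"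
proof (induction a arbitrary: d)
  case (Suc a)
  have "(Lap ^^ a) p \<in> homog_poly (d + 2)" by (rule Suc.IH) (use Suc.prems in \<open>simp add: add_ac\<close>)
  then show ?case by (simp add: homog_poly_Lap)
qed simp

lemma Lap_pow_low_degree: "p \<in> homog_poly d \<Longrightarrow> d < 2 * a \<Longrightarrow> (Lap ^^ a) p = 0"
proof (induction a)
  case (Suc a)
  show ?case
  proof (cases "d < 2 * a")
    case True
    then show ?thesis using Suc by (simp add: linear_op_simps[OF linear_op_Lap])
  next
    case False
    then have "(Lap ^^ a) p \<in> homog_poly (d - 2 * a)"
      using Suc.prems homog_poly_Lap_pow[of p "d - 2 * a" a] by simp
    then show ?thesis using Lap_low_degree[of _ "d - 2 * a"] Suc.prems False by simp
  qed
qed simp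

end

section \<open>The recursion for powers of the quadratic form and the Laplacian\<close>

locale super_form_dim = super_form g G
  for g G :: "'a::finite + 'b::{finite,linorder} \<Rightarrow> 'a + 'b \<Rightarrow> complex" +
  fixes k :: nat
  assumes card_diff: "of_nat CARD('a) - of_nat CARD('b) = (- 2 * of_nat k :: complex)"
begin

lemma Lap_R2_homog:
  assumes "p \<in> homog_poly d"
  shows "Lap (R2 p) = R2 (Lap p) + scl (4 * (of_nat d - of_nat k)) p"
  using assms unfolding Lap_R2 sum_sgn1 card_diff homog_poly_iff_euler
  by (simp add: algebra_simps flip: superpoly.scale_left_distrib)

text \<open>Each passage of \<Delta> through a factor R in degree d + 2b contributes 4(d + 2b - k),
  and these numbers are summed over b < a. For a = 0 the truncated exponent a - 1 is harmless
  because its coefficient is 0.\<close>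

lemma Lap_R2_pow:
  assumes "p \<in> homog_poly d"
  shows "Lap ((R2 ^^ a) p) = (R2 ^^ a) (Lap p)
     + scl (4 * of_nat a * (of_nat d - of_nat k + of_nat a - 1)) ((R2 ^^ (a - 1)) p)"
proof (induction a)
  case (Suc a)
  have "Lap ((R2 ^^ Suc a) p) = R2 (Lap ((R2 ^^ a) p))
      + scl (4 * (of_nat (d + 2 * a) - of_nat k)) ((R2 ^^ a) p)"
    using Lap_R2_homog[OF homog_poly_R2_pow[OF assms]] by simp
  also have "R2 (Lap ((R2 ^^ a) p)) = (R2 ^^ Suc a) (Lap p)
     + scl (4 * of_nat a * (of_nat d - of_nat k + of_nat a - 1)) ((R2 ^^ a) p)"
    unfolding Suc.IH by (cases a) (simp_all add: linear_op_simps[OF linear_op_R2])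
  also have "(R2 ^^ Suc a) (Lap p)
      + scl (4 * of_nat a * (of_nat d - of_nat k + of_nat a - 1)) ((R2 ^^ a) p)
      + scl (4 * (of_nat (d + 2 * a) - of_nat k)) ((R2 ^^ a) p)
    = (R2 ^^ Suc a) (Lap p) + scl (4 * of_nat a * (of_nat d - of_nat k + of_nat a - 1)
      + 4 * (of_nat (d + 2 * a) - of_nat k)) ((R2 ^^ a) p)"
    by (simp only: add.assoc superpoly.scale_left_distrib)
  also have "4 * of_nat a * (of_nat d - of_nat k + of_nat a - 1) + 4 * (of_nat (d + 2 * a) - of_nat k)
      = (4 * of_nat (Suc a) * (of_nat d - of_nat k + of_nat (Suc a) - 1) :: complex)"
    by (simp add: algebra_simps)
  finally show ?case by simp
qed simp

definition Q :: "('a, 'b) superpoly \<Rightarrow> ('a, 'b) superpoly" where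
  "Q p = scl (1/4) (R2 (Lap p))"

lemma linear_op_Q: "linear_op Q"
  unfolding Q_def[abs_def] by (intro linear_op_intros linear_op_comp[OF linear_op_R2 linear_op_Lap])

lemma homog_poly_Q: assumes "p \<in> homog_poly d" shows "Q p \<in> homog_poly d"
proof (cases "d < 2")
  case True
  then show ?thesis using assms
    by (simp add: Q_def Lap_low_degree linear_op_simps[OF linear_op_R2] linear_op_zero)
next
  case False
  then have "d - 2 + 2 = d" by simp
  then show ?thesis using assms homog_poly_Lap[of p "d - 2"] homog_poly_R2[of "Lap p" "d - 2"]
    unfolding Q_def by (intro homog_poly_scl) metis
qed

text \<open>Applied to \<Delta>^a p, of degree d - 2a, \<open>Lap_R2_pow\<close> gives R\<Delta>R^a
  = R^(a+1)\<Delta> + 4a(d - k - 1 - a)R^a; solved for R^(a+1)\<Delta> this is the factor 4(Q -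
  \<tau>_a). If 2a > d, both sides are 0.\<close>

lemma R2_pow_Lap_pow_Suc:
  assumes "p \<in> homog_poly d"
  shows "(R2 ^^ Suc a) ((Lap ^^ Suc a) p)
     = scl 4 (Q ((R2 ^^ a) ((Lap ^^ a) p)) - scl (of_nat a * (of_nat d - of_nat k - 1 - of_nat a))
         ((R2 ^^ a) ((Lap ^^ a) p)))"
proof (cases "2 * a \<le> d")
  case True
  define q where "q = (Lap ^^ a) p"
  have q: "q \<in> homog_poly (d - 2 * a)"
    unfolding q_def using True assms by (intro homog_poly_Lap_pow) simp
  have "R2 (Lap ((R2 ^^ a) q)) = (R2 ^^ Suc a) (Lap q)
     + scl (4 * of_nat a * (of_nat (d - 2 * a) - of_nat k + of_nat a - 1)) ((R2 ^^ a) q)"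
    unfolding Lap_R2_pow[OF q] by (cases a) (simp_all add: linear_op_simps[OF linear_op_R2])
  then show ?thesis using True
    by (simp add: Q_def superpoly.scale_right_diff_distrib of_nat_diff algebra_simps flip: q_def)
next
  case False
  then have "(Lap ^^ a) p = 0" "(Lap ^^ Suc a) p = 0"
    using Lap_pow_low_degree[OF assms, of a] Lap_pow_low_degree[OF assms, of "Suc a"] by simp_all
  then show ?thesis
    by (simp add: linear_op_zero linear_op_funpow linear_op_R2 linear_op_Q)
qed

end


section \<open>Invariance under the orthosymplectic Lie superalgebra\<close>

lemma linear_op_act: "linear_op (act X)"
  unfolding act_def[abs_def] by (intro linear_op_intros')

lemma euler_act: "euler (act X p) = act X (euler p)"
  by (simp add: act_def linear_op_simps[OF linear_op_euler] euler_mult euler_deriv coord_simps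
      superpoly.scale_right_diff_distrib)

lemma homog_poly_act: "p \<in> homog_poly d \<Longrightarrow> act X p \<in> homog_poly d"
  by (simp add: homog_poly_iff_euler euler_act linear_op_simps[OF linear_op_act])

lemma eq_uminus_superpoly: "p = - p \<Longrightarrow> p = 0" for p :: "'u \<Rightarrow>\<^sub>0 complex"
  by (metis neg_eq_iff_add_eq_0 scl_two superpoly.scale_eq_0_iff zero_neq_numeral)

lemma sgn2_square: "sgn2 i j * sgn2 i j = 1"
  by (simp flip: power_mult_distrib)

text \<open>Super-antisymmetric coefficients against a supersymmetric family: exchanging the indices
  shows that the sum is its own negative.\<close>

lemma sum_antisym_zero:
  fixes B :: "'i::finite \<Rightarrow> 'i \<Rightarrow> ('u \<Rightarrow>\<^sub>0 complex)"
  assumes K: "\<And>j l. K j l = - \<sigma> j l * K l j" and B: "\<And>j l. B j l = scl (\<sigma> j l) (B l j)"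
    and \<sigma>: "\<And>j l. \<sigma> j l * \<sigma> j l = 1"
  shows "(\<Sum>j\<in>UNIV. \<Sum>l\<in>UNIV. scl (K j l) (B j l)) = 0" (is "?S = 0")
proof -
  have "scl (K j l) (B j l) = - scl (K l j) (B l j)" for j l
  proof -
    have "scl (K j l) (B j l) = scl (- \<sigma> j l * K l j * \<sigma> j l) (B l j)"
      by (simp only: K[of j l] B[of j l] superpoly.scale_scale)
    also have "- \<sigma> j l * K l j * \<sigma> j l = - (\<sigma> j l * \<sigma> j l) * K l j"
      by (simp only: mult_minus_left mult.assoc mult.commute[of "K l j"])
    finally show ?thesis by (simp add: \<sigma>)
  qed
  then have "?S = (\<Sum>j\<in>UNIV. \<Sum>l\<in>UNIV. - scl (K l j) (B l j))"
    by (intro sum.cong refl)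
  also have "\<dots> = - (\<Sum>j\<in>UNIV. \<Sum>l\<in>UNIV. scl (K l j) (B l j))"
    by (simp only: sum_negf)
  also have "\<dots> = - ?S" by (rule arg_cong[where f = uminus], rule sum.swap)
  finally show ?thesis by (rule eq_uminus_superpoly)
qed

context super_form
begin

text \<open>Super-antisymmetry of X with its upper index lowered by \<open>g\<close>. The parity of
  X no longer appears, so even and odd matrices are treated alike; see
  \<open>osp_part_eq\<close>.\<close>

definition osp_matrix :: "complex^('a + 'b)^('a + 'b) \<Rightarrow> bool" where
  "osp_matrix X \<longleftrightarrow> (\<forall>j l. (\<Sum>i\<in>UNIV. X $ i $ j * g i l) = - sgn2 j l * (\<Sum>i\<in>UNIV. X $ i $ l * g i j))"

text \<open>The antisymmetry carried over to X with its second index raised: write X through its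
  lowered form and \<open>G\<close>, use the antisymmetry there, and contract with \<open>G\<close>
  again.\<close>

lemma osp_matrix_raised:
  assumes "osp_matrix X"
  shows "(\<Sum>j\<in>UNIV. X $ p $ j * G j r) = - sgn2 p r * (\<Sum>j\<in>UNIV. X $ r $ j * G j p)"
proof -
  have 1: "X $ p $ j = - sgn2 j p * (\<Sum>i\<in>UNIV. (\<Sum>l\<in>UNIV. X $ i $ l * G l p) * g i j)" for p j
  proof -
    have "X $ p $ j = (\<Sum>i\<in>UNIV. X $ i $ j * (\<Sum>l\<in>UNIV. g i l * G l p))"
      by (simp add: gG if_distrib[of "(*) _"] cong: if_cong)
    also have "\<dots> = (\<Sum>l\<in>UNIV. (\<Sum>i\<in>UNIV. X $ i $ j * g i l) * G l p)"
      unfolding sum_distrib_left sum_distrib_right by (subst sum.swap) (simp add: mult.assoc)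
    also have "\<dots> = (\<Sum>l\<in>UNIV. (- sgn2 j l * (\<Sum>i\<in>UNIV. X $ i $ l * g i j)) * G l p)"
      using assms unfolding osp_matrix_def by (intro sum.cong refl arg_cong2[where f = "(*)"]) blast
    also have "\<dots> = (\<Sum>l\<in>UNIV. - sgn2 j p * (\<Sum>i\<in>UNIV. X $ i $ l * G l p * g i j))"
    proof (rule sum.cong)
      fix l
      have "(- sgn2 j l * (\<Sum>i\<in>UNIV. X $ i $ l * g i j)) * G l p
          = - (G l p * sgn2 j l) * (\<Sum>i\<in>UNIV. X $ i $ l * g i j)" by simp
      also have "\<dots> = - (G l p * sgn2 j p) * (\<Sum>i\<in>UNIV. X $ i $ l * g i j)"
        unfolding G_sgn2(2)[of l p j] ..
      finally show "(- sgn2 j l * (\<Sum>i\<in>UNIV. X $ i $ l * g i j)) * G l p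
          = - sgn2 j p * (\<Sum>i\<in>UNIV. X $ i $ l * G l p * g i j)"
        by (simp add: sum_distrib_left sum_negf mult_ac)
    qed simp
    also have "\<dots> = - sgn2 j p * (\<Sum>l\<in>UNIV. \<Sum>i\<in>UNIV. X $ i $ l * G l p * g i j)"
      by (simp only: sum_distrib_left)
    also have "\<dots> = - sgn2 j p * (\<Sum>i\<in>UNIV. (\<Sum>l\<in>UNIV. X $ i $ l * G l p) * g i j)"
      by (subst sum.swap) (simp only: sum_distrib_right)
    finally show ?thesis .
  qed
  let ?W = "\<lambda>i p. \<Sum>l\<in>UNIV. X $ i $ l * G l p"
  have "?W p r = (\<Sum>j\<in>UNIV. - (G j r * sgn2 j p) * (\<Sum>i\<in>UNIV. ?W i p * g i j))"
    by (rule sum.cong, simp, subst 1) simp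
  also have "\<dots> = (\<Sum>j\<in>UNIV. - sgn2 p r * (\<Sum>i\<in>UNIV. ?W i p * (g i j * G j r)))"
  proof (rule sum.cong)
    fix j
    have "- (G j r * sgn2 j p) * (\<Sum>i\<in>UNIV. ?W i p * g i j)
        = - (G j r * sgn2 p r) * (\<Sum>i\<in>UNIV. ?W i p * g i j)"
      unfolding G_sgn2(1)[of j r p] by (simp add: mult.commute)
    then show "- (G j r * sgn2 j p) * (\<Sum>i\<in>UNIV. ?W i p * g i j)
        = - sgn2 p r * (\<Sum>i\<in>UNIV. ?W i p * (g i j * G j r))"
      by (simp add: sum_distrib_left sum_negf mult_ac)
  qed simp
  also have "\<dots> = - sgn2 p r * (\<Sum>j\<in>UNIV. \<Sum>i\<in>UNIV. ?W i p * (g i j * G j r))"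
    by (simp only: sum_distrib_left)
  also have "\<dots> = - sgn2 p r * (\<Sum>i\<in>UNIV. ?W i p * (\<Sum>j\<in>UNIV. g i j * G j r))"
    by (subst sum.swap) (simp only: sum_distrib_left)
  also have "\<dots> = - sgn2 p r * ?W r p"
    by (simp add: gG if_distrib[of "(*) _"] cong: if_cong)
  finally show ?thesis .
qed

text \<open>X acts by a superderivation, so its commutator with R is multiplication by a quadratic
  polynomial. The coefficients \<open>K\<close> of that polynomial are those of the lowered matrix
  up to signs, hence super-antisymmetric, and it vanishes.\<close>

lemma act_R2:
  assumes "osp_matrix X"
  shows "act X (R2 p) = R2 (act X p)"
proof -
  let ?c = "\<lambda>i j. (-1) ^ (parity_index i * (parity_index i + parity_index j)) * X $ i $ j"
  define K where "K j l = (\<Sum>i\<in>UNIV. ?c i j * g l i)" for j l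
  have K: "K j l = sgn2 j l * (\<Sum>i\<in>UNIV. X $ i $ j * g i l)" for j l
  proof -
    \<comment> \<open>Where \<open>g l i\<close> is nonzero, i and l have the same parity, and the
      sign of the action combines with \<open>g_sym\<close> to one that does not depend on
      i.\<close>
    have "?c i j * g l i = sgn2 j l * (X $ i $ j * g i l)" for i
      using g_even[of l i] g_even[of i l] g_sym[of i l] parity_index_cases[of i] parity_index_cases[of j]
      by (cases "parity_index i = parity_index l") auto
    then show ?thesis unfolding K_def sum_distrib_left by (intro sum.cong refl)
  qed
  have "K j l = - sgn2 j l * K l j" for j l
  proof -
    have "(\<Sum>i\<in>UNIV. X $ i $ j * g i l) = - sgn2 j l * (\<Sum>i\<in>UNIV. X $ i $ l * g i j)"
      using assms unfolding osp_matrix_def by blast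
    moreover have "sgn2 l j = sgn2 j l" by (simp only: mult.commute)
    ultimately show ?thesis unfolding K by (simp only: mult_minus_left mult_minus_right)
  qed
  then have 0: "(\<Sum>j\<in>UNIV. \<Sum>l\<in>UNIV. scl (K j l) (coord_mult j (coord_mult l p))) = 0"
    by (rule sum_antisym_zero[OF _ coord_mult_commute sgn2_square])
  have "act X (R2 p) = - (\<Sum>i\<in>UNIV. \<Sum>j\<in>UNIV. scl (?c i j) (coord_mult j
      (scl 2 (\<Sum>l\<in>UNIV. scl (g l i) (coord_mult l p)) + R2 (coord_deriv i p))))"
    unfolding act_def deriv_R2 ..
  also have "\<dots> = - (\<Sum>i\<in>UNIV. \<Sum>j\<in>UNIV. \<Sum>l\<in>UNIV. scl (?c i j * (2 * g l i)) (coord_mult j (coord_mult l p)))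
       + R2 (act X p)"
    by (simp add: act_def coord_simps linear_op_simps[OF linear_op_R2] R2_mult superpoly.scale_right_distrib
        superpoly.scale_sum_right sum.distrib)
  also have "(\<Sum>i\<in>UNIV. \<Sum>j\<in>UNIV. \<Sum>l\<in>UNIV. scl (?c i j * (2 * g l i)) (coord_mult j (coord_mult l p)))
     = (\<Sum>j\<in>UNIV. \<Sum>l\<in>UNIV. \<Sum>i\<in>UNIV. scl (?c i j * (2 * g l i)) (coord_mult j (coord_mult l p)))"
    by (rule trans[OF sum.swap sum.cong[OF refl sum.swap]])
  also have "\<dots> = scl 2 (\<Sum>j\<in>UNIV. \<Sum>l\<in>UNIV. scl (K j l) (coord_mult j (coord_mult l p)))"
    unfolding K_def superpoly.scale_sum_left superpoly.scale_sum_right by (simp add: mult_ac)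
  finally show ?thesis by (simp add: 0)
qed

text \<open>The same argument for derivations; here the coefficients are those of the raised
  matrix.\<close>

lemma act_Lap:
  assumes "osp_matrix X"
  shows "act X (Lap p) = Lap (act X p)"
proof -
  let ?c = "\<lambda>i j. (-1) ^ (parity_index i * (parity_index i + parity_index j)) * X $ i $ j"
  define K where "K l i = (\<Sum>j\<in>UNIV. ?c i j * G l j)" for l i
  have K: "K l i = sgn1 i * sgn1 l * sgn2 i l * (\<Sum>j\<in>UNIV. X $ i $ j * G j l)" for i l
  proof -
    have "?c i j * G l j = sgn1 i * sgn1 l * sgn2 i l * (X $ i $ j * G j l)" for j
      using G_even[of l j] G_even[of j l] G_sym[of l j] parity_index_cases[of i] parity_index_cases[of j]
      by (cases "parity_index j = parity_index l") auto
    then show ?thesis unfolding K_def sum_distrib_left by (intro sum.cong refl)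
  qed
  have "K l i = - sgn2 l i * K i l" for i l
  proof -
    have "sgn2 l i = sgn2 i l" by (simp only: mult.commute)
    then show ?thesis
      unfolding K osp_matrix_raised[OF assms, of i l] by (simp only: mult_minus_left mult_minus_right mult_ac)
  qed
  then have 0: "(\<Sum>j\<in>UNIV. \<Sum>l\<in>UNIV. scl (K j l) (coord_deriv j (coord_deriv l p))) = 0"
    by (rule sum_antisym_zero[OF _ coord_deriv_commute sgn2_square])
  have "Lap (act X p) = - (\<Sum>i\<in>UNIV. \<Sum>j\<in>UNIV. scl (?c i j) (coord_mult j (Lap (coord_deriv i p))
      + scl 2 (\<Sum>l\<in>UNIV. scl (G l j) (coord_deriv l (coord_deriv i p)))))"
    unfolding act_def linear_op_simps[OF linear_op_Lap] Lap_mult ..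
  also have "\<dots> = act X (Lap p)
       - (\<Sum>i\<in>UNIV. \<Sum>j\<in>UNIV. \<Sum>l\<in>UNIV. scl (?c i j * (2 * G l j)) (coord_deriv l (coord_deriv i p)))"
    by (simp add: act_def Lap_deriv superpoly.scale_right_distrib
        superpoly.scale_sum_right sum.distrib)
  also have "(\<Sum>i\<in>UNIV. \<Sum>j\<in>UNIV. \<Sum>l\<in>UNIV. scl (?c i j * (2 * G l j)) (coord_deriv l (coord_deriv i p)))
     = (\<Sum>l\<in>UNIV. \<Sum>i\<in>UNIV. \<Sum>j\<in>UNIV. scl (?c i j * (2 * G l j)) (coord_deriv l (coord_deriv i p)))"
    by (rule trans[OF sum.cong[OF refl sum.swap] sum.swap])
  also have "\<dots> = scl 2 (\<Sum>l\<in>UNIV. \<Sum>i\<in>UNIV. scl (K l i) (coord_deriv l (coord_deriv i p)))"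
    unfolding K_def superpoly.scale_sum_left superpoly.scale_sum_right by (simp add: mult_ac)
  finally show ?thesis by (simp add: 0)
qed

end

section \<open>The parity involution\<close>

lemma linear_op_parity: "linear_op parity_involution"
  by (simp add: parity_involution_def)

lemma linear_op_parity_comp: "linear_op A \<Longrightarrow> linear_op (\<lambda>p. parity_involution (A p))"
  by (auto intro: linear_op_comp linear_op_parity)

lemma parity_single [simp]:
  "parity_involution (Poly_Mapping.single (\<alpha>, S) c) = Poly_Mapping.single (\<alpha>, S) (c * (-1) ^ card S)"
  by (simp add: parity_involution_def)

lemma parity_parity [simp]: "parity_involution (parity_involution p) = p"
proof -
  have "(\<lambda>p. parity_involution (parity_involution p)) = (\<lambda>p. p)"
  proof (rule linear_op_ext, goal_cases)
    case (3 u)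
    then show ?case by (cases u) (simp flip: power_mult_distrib)
  qed (intro linear_op_intros linear_op_parity_comp)+
  then show ?thesis by (rule fun_cong)
qed

lemma parity_mult: "parity_involution (coord_mult i p) = scl (sgn1 i) (coord_mult i (parity_involution p))"
  for p :: "('a::finite, 'b::{finite,linorder}) superpoly"
proof -
  have "(\<lambda>p. parity_involution (coord_mult i p))
      = (\<lambda>p :: ('a, 'b) superpoly. scl (sgn1 i) (coord_mult i (parity_involution p)))"
  proof (rule linear_op_ext, goal_cases)
    case (3 u)
    then show ?case
      by (cases u; cases i) (auto simp: linear_op_simps[OF linear_op_parity] single_uminus mult_ac)
  qed (intro linear_op_intros' linear_op_parity_comp)+
  then show ?thesis by (rule fun_cong)
qed

lemma parity_deriv: "parity_involution (coord_deriv i p) = scl (sgn1 i) (coord_deriv i (parity_involution p))"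
  for p :: "('a::finite, 'b::{finite,linorder}) superpoly"
proof -
  have "(\<lambda>p. parity_involution (coord_deriv i p))
      = (\<lambda>p :: ('a, 'b) superpoly. scl (sgn1 i) (coord_deriv i (parity_involution p)))"
  proof (rule linear_op_ext, goal_cases)
    case (3 u)
    obtain \<alpha> S where u: "u = (\<alpha>, S)" by (cases u)
    have "(-1) ^ card (S - {b}) = (- ((-1) ^ card S) :: complex)" if "b \<in> S" for b
      using card_Suc_Diff1[OF _ that] by (metis finite_code minus_minus mult_minus1 power_Suc)
    then show ?case
      by (cases i) (auto simp: u linear_op_simps[OF linear_op_parity] single_uminus mult_ac)
  qed (intro linear_op_intros' linear_op_parity_comp)+
  then show ?thesis by (rule fun_cong)
qed

context super_form
begin

lemma parity_R2: "parity_involution (R2 p) = R2 (parity_involution p)"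
proof -
  have *: "g j i * (sgn1 i * sgn1 j) = g j i" for i j
    using g_even[of j i] by (cases "parity_index i = parity_index j") (auto simp flip: power_mult_distrib)
  show ?thesis
    unfolding R2_def linear_op_simps[OF linear_op_parity] parity_mult coord_simps superpoly.scale_scale
    by (simp only: mult.assoc *)
qed

lemma parity_Lap: "parity_involution (Lap p) = Lap (parity_involution p)"
proof -
  have *: "G i j * (sgn1 i * sgn1 j) = G i j" for i j
    using G_even[of i j] by (cases "parity_index i = parity_index j") (auto simp flip: power_mult_distrib)
  show ?thesis
    unfolding Lap_def linear_op_simps[OF linear_op_parity] parity_deriv coord_simps superpoly.scale_scale
    by (simp only: mult.assoc *)
qed

end

lemma homog_poly_parity:
  fixes p :: "('a::finite, 'b::{finite,linorder}) superpoly"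
  assumes "p \<in> homog_poly d"
  shows "parity_involution p \<in> homog_poly d"
proof -
  have "parity_involution (euler p) = euler (parity_involution p)"
  proof -
    have *: "sgn1 i * sgn1 i = 1" for i :: "'a + 'b" by simp
    show ?thesis
      unfolding euler_def linear_op_simps[OF linear_op_parity] parity_mult parity_deriv coord_simps
        superpoly.scale_scale by (simp only: * superpoly.scale_one)
  qed
  then show ?thesis
    using assms by (simp add: homog_poly_iff_euler linear_op_simps[OF linear_op_parity])
qed


section \<open>The Casimir operator\<close>

lemma sum_delta_mult [simp]:
  fixes f :: "'i::finite \<Rightarrow> complex"
  shows "(\<Sum>i\<in>UNIV. (if i = j then 1 else 0) * f i) = f j"
    "(\<Sum>i\<in>UNIV. (if j = i then 1 else 0) * f i) = f j"
    "(\<Sum>i\<in>UNIV. f i * (if i = j then 1 else 0)) = f j"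
    "(\<Sum>i\<in>UNIV. f i * (if j = i then 1 else 0)) = f j"
  by (simp_all add: if_distrib[of "\<lambda>c. c * _"] if_distrib[of "\<lambda>c. _ * c"] cong: if_cong)

context super_form
begin

lemma G_g_left: "(\<Sum>i\<in>UNIV. G i q * g i l) = sgn1 q * (if l = q then 1 else 0)"
proof -
  have "G i q * g i l = sgn1 q * (G q i * g i l)" for i
    using G_sym[of q i] G_sym[of i q] G_even[of q i] G_even[of i q]
    by (cases "parity_index i = parity_index q") auto
  then have "(\<Sum>i\<in>UNIV. G i q * g i l) = sgn1 q * (\<Sum>i\<in>UNIV. G q i * g i l)"
    unfolding sum_distrib_left by (intro sum.cong refl)
  then show ?thesis by (simp only: Gg eq_commute)
qed

text \<open>Twice the projection to \<open>osp\<close> of the matrix unit with index \<open>(p, q)\<close>.\<close>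

definition skew_unit :: "'a + 'b \<Rightarrow> 'a + 'b \<Rightarrow> complex^('a + 'b)^('a + 'b)" where
  "skew_unit p q = (\<chi> i j. (if i = p then 1 else 0) * (if j = q then 1 else 0)
     - (-1) ^ ((parity_index p + parity_index q) * parity_index q) * G i q * g p j)"

lemma osp_matrix_skew_unit: "osp_matrix (skew_unit p q)"
  unfolding osp_matrix_def
proof (intro allI)
  fix j l
  let ?d = "\<lambda>i j. if i = j then 1 else (0 :: complex)"
  let ?s = "(-1) ^ ((parity_index p + parity_index q) * parity_index q) :: complex"
  have s: "?s * sgn1 q = sgn2 p q"
    using parity_index_cases[of p] parity_index_cases[of q] by auto
  have *: "(\<Sum>i\<in>UNIV. skew_unit p q $ i $ j * g i l)
      = ?d j q * g p l - sgn2 p q * g p j * ?d l q" for j l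
  proof -
    have "(\<Sum>i\<in>UNIV. skew_unit p q $ i $ j * g i l)
        = (\<Sum>i\<in>UNIV. ?d i p * (?d j q * g i l)) - ?s * g p j * (\<Sum>i\<in>UNIV. G i q * g i l)"
      unfolding sum_distrib_left sum_subtractf[symmetric] by (simp add: skew_unit_def algebra_simps)
    also have "\<dots> = ?d j q * g p l - (?s * sgn1 q) * g p j * ?d l q"
      unfolding sum_delta_mult G_g_left by (simp only: mult_ac)
    finally show ?thesis unfolding s .
  qed
  have 1: "sgn2 p q * g p l = sgn2 q l * g p l" and 2: "sgn2 p q * g p j = sgn2 j q * g p j"
    using g_sgn2(1)[of p l q] g_sgn2(1)[of p j q] by (simp_all only: mult_ac)
  show "(\<Sum>i\<in>UNIV. skew_unit p q $ i $ j * g i l)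
      = - sgn2 j l * (\<Sum>i\<in>UNIV. skew_unit p q $ i $ l * g i j)"
    unfolding * 1 2 by (cases "j = q"; cases "l = q")
      (simp_all only: if_True if_False mult_1 mult_1_right mult_zero_left mult_zero_right
        add_0_left add_0_right minus_zero refl simp_thms mult_minus_left mult_minus_right minus_minus minus_add_distrib
        ring_distribs(1) sgn2_sq diff_conv_add_uminus
        add.commute)
qed

lemma supertrace_mult: "supertrace (Y ** X) = (\<Sum>i\<in>UNIV. \<Sum>j\<in>UNIV. sgn1 i * (Y $ i $ j * X $ j $ i))"
  by (simp add: supertrace_def matrix_matrix_mult_def sum_distrib_left)

text \<open>By \<open>osp_matrix_raised\<close> both terms of \<open>skew_unit\<close> contribute
  the same. Pairing with these elements therefore reads off the entries of Y, which makes dual bases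
  computable.\<close>

lemma supertrace_skew_unit:
  assumes "osp_matrix Y"
  shows "supertrace (Y ** skew_unit p q) = 2 * sgn1 q * Y $ q $ p"
proof -
  let ?d = "\<lambda>i j. if i = j then 1 else (0 :: complex)"
  let ?s = "(-1) ^ ((parity_index p + parity_index q) * parity_index q) :: complex"
  let ?W = "\<lambda>i p. \<Sum>j\<in>UNIV. Y $ i $ j * G j p"
  have "supertrace (Y ** skew_unit p q)
      = (\<Sum>i\<in>UNIV. (\<Sum>j\<in>UNIV. sgn1 i * Y $ i $ j * ?d i q * ?d j p)
          - (\<Sum>j\<in>UNIV. sgn1 i * ?s * g p i * (Y $ i $ j * G j q)))"
    unfolding supertrace_mult by (simp add: skew_unit_def sum_subtractf[symmetric] algebra_simps cong: if_cong)
  also have "\<dots> = sgn1 q * Y $ q $ p - (\<Sum>i\<in>UNIV. sgn1 i * ?s * g p i * ?W i q)"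
    by (simp add: sum_subtractf sum_distrib_left)
  also have "(\<Sum>i\<in>UNIV. sgn1 i * ?s * g p i * ?W i q) = (\<Sum>i\<in>UNIV. - sgn1 q * (?W q i * g i p))"
  proof (rule sum.cong)
    fix i
    have 1: "sgn1 i * ?s * g p i * - sgn2 i q = - sgn1 q * g i p"
      using g_even[of p i] g_even[of i p] g_sym[of i p] parity_index_cases[of p] parity_index_cases[of q]
      by (cases "parity_index p = parity_index i") auto
    have "sgn1 i * ?s * g p i * (- sgn2 i q * ?W q i) = (sgn1 i * ?s * g p i * - sgn2 i q) * ?W q i"
      by (simp only: mult.assoc)
    also have "\<dots> = - sgn1 q * (g i p * ?W q i)" unfolding 1 by (simp only: mult.assoc)
    also have "g i p * ?W q i = ?W q i * g i p" by (rule mult.commute)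
    finally show "sgn1 i * ?s * g p i * ?W i q = - sgn1 q * (?W q i * g i p)"
      unfolding osp_matrix_raised[OF assms, of i q] .
  qed simp
  also have "\<dots> = - sgn1 q * (\<Sum>i\<in>UNIV. ?W q i * g i p)"
    by (simp only: sum_distrib_left)
  also have "(\<Sum>i\<in>UNIV. ?W q i * g i p) = (\<Sum>j\<in>UNIV. Y $ q $ j * (\<Sum>i\<in>UNIV. G j i * g i p))"
    unfolding sum_distrib_left sum_distrib_right by (subst sum.swap) (simp only: mult.assoc)
  also have "\<dots> = Y $ q $ p" unfolding Gg sum_delta_mult ..
  finally show ?thesis by simp
qed

lemma gl_part_skew_unit:
  "skew_unit p q \<in> gl_part ((parity_index p + parity_index q) mod 2)"
  using g_even[of p] G_even[of _ q] unfolding gl_part_def skew_unit_def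
  by (force simp: add.commute split: if_splits)

end

section \<open>The tensor of a pair of dual bases\<close>

locale osp_form = super_form_dim g G k
  for g G :: "'a::finite + 'b::{finite,linorder} \<Rightarrow> 'a + 'b \<Rightarrow> complex" and k +
  fixes \<omega> :: "complex^('a + 'b) \<Rightarrow> complex^('a + 'b) \<Rightarrow> complex"
  assumes form_eq: "\<omega> v w = (\<Sum>i\<in>UNIV. \<Sum>j\<in>UNIV. v $ i * w $ j * g i j)"
begin

text \<open>On basis vectors the invariance condition carries the sign (-1)^(b|j|). An entry X_rl
  that meets a nonzero \<open>g j r\<close> has |r| = |j| and |r| + |l| = b mod 2, so this sign and
  the one for exchanging the indices of \<open>g\<close> combine to \<open>sgn2 j l\<close>,
  whatever b is.\<close>

lemma osp_part_eq: assumes "b \<in> {0, 1}" shows "osp_part \<omega> b = {X \<in> gl_part b. osp_matrix X}"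
proof -
  have "X \<in> osp_part \<omega> b \<longleftrightarrow> osp_matrix X" if X: "X \<in> gl_part b" for X
  proof -
    have left: "\<omega> (X *v v) w = (\<Sum>j\<in>UNIV. \<Sum>l\<in>UNIV. v $ j * w $ l * (\<Sum>i\<in>UNIV. X $ i $ j * g i l))" for v w
    proof -
      have "\<omega> (X *v v) w = (\<Sum>i\<in>UNIV. \<Sum>l\<in>UNIV. \<Sum>j\<in>UNIV. v $ j * w $ l * (X $ i $ j * g i l))"
        by (simp add: form_eq matrix_vector_mult_def sum_distrib_right sum_distrib_left mult_ac)
      also have "\<dots> = (\<Sum>i\<in>UNIV. \<Sum>j\<in>UNIV. \<Sum>l\<in>UNIV. v $ j * w $ l * (X $ i $ j * g i l))"
        by (rule sum.cong[OF refl sum.swap])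
      also have "\<dots> = (\<Sum>j\<in>UNIV. \<Sum>l\<in>UNIV. \<Sum>i\<in>UNIV. v $ j * w $ l * (X $ i $ j * g i l))"
        by (rule trans[OF sum.swap sum.cong[OF refl sum.swap]])
      finally show ?thesis by (simp only: sum_distrib_left)
    qed
    have right: "\<omega> v (X *v w) = (\<Sum>j\<in>UNIV. \<Sum>l\<in>UNIV. v $ j * w $ l * (\<Sum>r\<in>UNIV. g j r * X $ r $ l))" for v w
    proof -
      have "\<omega> v (X *v w) = (\<Sum>j\<in>UNIV. \<Sum>r\<in>UNIV. \<Sum>l\<in>UNIV. v $ j * w $ l * (g j r * X $ r $ l))"
        by (simp add: form_eq matrix_vector_mult_def sum_distrib_right sum_distrib_left mult_ac)
      also have "\<dots> = (\<Sum>j\<in>UNIV. \<Sum>l\<in>UNIV. \<Sum>r\<in>UNIV. v $ j * w $ l * (g j r * X $ r $ l))"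
        by (rule sum.cong[OF refl sum.swap])
      finally show ?thesis by (simp only: sum_distrib_left)
    qed
    have sign: "(-1) ^ (b * parity_index j) * (\<Sum>r\<in>UNIV. g j r * X $ r $ l)
        = sgn2 j l * (\<Sum>r\<in>UNIV. X $ r $ l * g r j)" for j l
    proof -
      have "(-1) ^ (b * parity_index j) * (g j r * X $ r $ l) = sgn2 j l * (X $ r $ l * g r j)" for r
      proof (cases "X $ r $ l = 0 \<or> parity_index r \<noteq> parity_index j")
        case True
        then show ?thesis using g_even[of j r] g_even[of r j] by auto
      next
        case False
        then have "(parity_index r + parity_index l) mod 2 = b" using X False unfolding gl_part_def by blast
        then show ?thesis using False g_sym[of r j] parity_index_cases[of j] parity_index_cases[of l]
          by auto
      qed
      then show ?thesis unfolding sum_distrib_left by (intro sum.cong refl)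
    qed
    show ?thesis
    proof
      assume *: "X \<in> osp_part \<omega> b"
      show "osp_matrix X"
        unfolding osp_matrix_def
      proof (intro allI)
        fix j l :: "'a + 'b"
        have "axis j 1 \<in> homog_vec (parity_index j)"
          by (auto simp: homog_vec_def axis_def)
        then have "\<omega> (X *v axis j 1) (axis l 1)
            + (-1) ^ (b * parity_index j) * \<omega> (axis j 1) (X *v axis l 1) = 0"
          using * parity_index_cases[of j] unfolding osp_part_def by blast
        moreover have "(\<Sum>j'\<in>UNIV. \<Sum>l'\<in>UNIV. axis j 1 $ j' * axis l 1 $ l' * f j' l') = (f j l :: complex)" for f
        proof -
          have "axis j 1 $ j' * axis l 1 $ l' * f j' l'
              = (if j' = j then 1 else 0) * ((if l' = l then 1 else 0) * f j' l')" for j' l'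
            by (simp add: axis_def)
          then show ?thesis by (simp only: sum_distrib_left[symmetric] sum_delta_mult)
        qed
        ultimately show "(\<Sum>i\<in>UNIV. X $ i $ j * g i l) = - sgn2 j l * (\<Sum>i\<in>UNIV. X $ i $ l * g i j)"
          unfolding left right sign by (simp only: sign eq_neg_iff_add_eq_0 mult_minus_left)
      qed
    next
      assume *: "osp_matrix X"
      have "\<omega> (X *v v) w + (-1) ^ (b * s) * \<omega> v (X *v w) = 0" if "v \<in> homog_vec s" for s v w
      proof -
        have "v $ j * w $ l * (\<Sum>i\<in>UNIV. X $ i $ j * g i l)
           = - ((-1) ^ (b * s) * (v $ j * w $ l * (\<Sum>r\<in>UNIV. g j r * X $ r $ l)))" for j l
        proof (cases "v $ j = 0")
          case False
          then have "s = parity_index j" using that by (simp add: homog_vec_def)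
          then have "(-1) ^ (b * s) * (v $ j * w $ l * (\<Sum>r\<in>UNIV. g j r * X $ r $ l))
              = v $ j * w $ l * (sgn2 j l * (\<Sum>r\<in>UNIV. X $ r $ l * g r j))"
            using sign[of j l] by (simp only: mult_ac)
          moreover have "(\<Sum>i\<in>UNIV. X $ i $ j * g i l) = - sgn2 j l * (\<Sum>i\<in>UNIV. X $ i $ l * g i j)"
            using * unfolding osp_matrix_def by blast
          ultimately show ?thesis by (simp only: mult_minus_left mult_minus_right)
        qed simp
        then have "(\<Sum>j\<in>UNIV. \<Sum>l\<in>UNIV. v $ j * w $ l * (\<Sum>i\<in>UNIV. X $ i $ j * g i l))
          = (\<Sum>j\<in>UNIV. \<Sum>l\<in>UNIV. - ((-1) ^ (b * s) * (v $ j * w $ l * (\<Sum>r\<in>UNIV. g j r * X $ r $ l))))"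
          by (intro sum.cong refl)
        then show ?thesis unfolding left right
          by (simp only: sum_negf sum_distrib_left[symmetric]) simp
      qed
      then show "X \<in> osp_part \<omega> b" using X unfolding osp_part_def by blast
    qed
  qed
  moreover have "osp_part \<omega> b \<subseteq> gl_part b" unfolding osp_part_def by blast
  ultimately show ?thesis by blast
qed

text \<open>Expand \<open>skew_unit p q\<close> in the basis X. Duality gives the coefficients as
  supertraces against Y, and by \<open>supertrace_skew_unit\<close> these are entries of Y. So the
  tensor depends on c only, not on the bases.\<close>

lemma dual_osp_bases_tensor:
  assumes "dual_osp_bases \<omega> c N X Y"
  shows "c * (\<Sum>t<N. Y t $ q $ p * X t $ i $ j) = sgn1 q / 2 *
    ((if i = p then 1 else 0) * (if j = q then 1 else 0)
      - (-1) ^ ((parity_index p + parity_index q) * parity_index q) * G i q * g p j)"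
proof -
  define b where "b = (parity_index p + parity_index q) mod 2"
  have b: "b \<in> {0, 1}" by (auto simp: b_def)
  have "skew_unit p q \<in> osp_part \<omega> b"
    using osp_part_eq[OF b] osp_matrix_skew_unit gl_part_skew_unit unfolding b_def by blast
  then obtain a where a: "\<And>r s. skew_unit p q $ r $ s = (\<Sum>t<N. a t * X t $ r $ s)"
    using assms b unfolding dual_osp_bases_def by blast
  have "a s = 2 * c * sgn1 q * Y s $ q $ p" if "s < N" for s
  proof -
    have "osp_matrix (Y s)"
      using assms that osp_part_eq unfolding dual_osp_bases_def by blast
    then have "2 * sgn1 q * Y s $ q $ p = supertrace (Y s ** skew_unit p q)"
      by (rule supertrace_skew_unit[symmetric])
    also have "\<dots> = (\<Sum>i\<in>UNIV. \<Sum>j\<in>UNIV. \<Sum>t<N. a t * (sgn1 i * (Y s $ i $ j * X t $ j $ i)))"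
      unfolding supertrace_mult a by (simp add: sum_distrib_left mult_ac)
    also have "\<dots> = (\<Sum>t<N. a t * supertrace (Y s ** X t))"
      unfolding supertrace_mult sum_distrib_left
      by (rule trans[OF sum.cong[OF refl sum.swap] sum.swap])
    finally have "c * (2 * sgn1 q * Y s $ q $ p) = (\<Sum>t<N. a t * (c * supertrace (Y s ** X t)))"
      by (simp add: sum_distrib_left mult_ac)
    also have "\<dots> = (\<Sum>t<N. a t * (if s = t then 1 else 0))"
      using assms that unfolding dual_osp_bases_def by (intro sum.cong refl) auto
    also have "\<dots> = a s" using that by (simp add: if_distrib[of "(*) _"] cong: if_cong)
    finally have "a s = c * (2 * sgn1 q * Y s $ q $ p)" ..
    then show ?thesis by (simp only: mult_ac)
  qed
  then have "skew_unit p q $ i $ j = (\<Sum>t<N. 2 * c * sgn1 q * Y t $ q $ p * X t $ i $ j)"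
    unfolding a by (intro sum.cong refl) simp
  then have "skew_unit p q $ i $ j = 2 * sgn1 q * (c * (\<Sum>t<N. Y t $ q $ p * X t $ i $ j))"
    by (simp only: sum_distrib_left mult_ac)
  then have "sgn1 q / 2 * skew_unit p q $ i $ j = (sgn1 q * sgn1 q) * (c * (\<Sum>t<N. Y t $ q $ p * X t $ i $ j))"
    by simp
  then show ?thesis by (simp add: skew_unit_def)
qed

text \<open>In the contracted tensor the matrix-unit part contributes half the superdimension, which
  is -k, and the form part contributes -1/2.\<close>

lemma dual_osp_bases_normalization:
  assumes "dual_osp_bases \<omega> c N X Y"
  shows "c * (\<Sum>t<N. X t ** Y t) $ i $ p = (if i = p then - (2 * of_nat k + 1) / 2 else 0)"
proof -
  have "c * (\<Sum>t<N. X t ** Y t) $ i $ p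
      = (\<Sum>j\<in>UNIV. c * (\<Sum>t<N. Y t $ j $ p * X t $ i $ j))"
    by (simp add: matrix_matrix_mult_def sum_distrib_left mult_ac) (rule sum.swap)
  also have "\<dots> = (\<Sum>j\<in>UNIV. (if i = p then 1 else 0) * sgn1 j / 2 - G i j * g j p / 2)"
  proof (rule sum.cong)
    fix j :: "'a + 'b"
    let ?s = "(-1) ^ ((parity_index p + parity_index j) * parity_index j) :: complex"
    let ?d = "if i = p then 1 else 0 :: complex"
    have 1: "sgn1 j * ?s * (G i j * g p j) = G i j * g j p"
      using g_even[of p j] g_even[of j p] g_sym[of j p] parity_index_cases[of j]
      by (cases "parity_index p = parity_index j") auto
    have "c * (\<Sum>t<N. Y t $ j $ p * X t $ i $ j) = sgn1 j / 2 * (?d - ?s * G i j * g p j)"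
      using dual_osp_bases_tensor[OF assms, of j p i j] by (simp only: refl if_True mult_1_right)
    also have "\<dots> = ?d * sgn1 j / 2 - sgn1 j * ?s * (G i j * g p j) / 2"
      by (simp add: right_diff_distrib mult_ac)
    finally show "c * (\<Sum>t<N. Y t $ j $ p * X t $ i $ j) = ?d * sgn1 j / 2 - G i j * g j p / 2"
      unfolding 1 .
  qed simp
  also have "\<dots> = (if i = p then 1 else 0) * (\<Sum>j\<in>UNIV. sgn1 (j :: 'a + 'b)) / 2
      - (\<Sum>j\<in>UNIV. G i j * g j p) / 2"
    by (simp only: sum_subtractf sum_divide_distrib sum_distrib_left)
  also have "\<dots> = (if i = p then - (2 * of_nat k + 1) / 2 else 0)"
    unfolding Gg sum_sgn1 card_diff by (simp add: field_simps)
  finally show ?thesis .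
qed

lemma is_casimir_scale:
  assumes "dual_osp_bases \<omega> c N X Y"
    and "(\<Sum>i<N. X i ** Y i) = mat (1 * (1 - 2 * of_nat k - 2))"
  shows "c = 1 / 2"
proof -
  obtain i :: "'a + 'b" where True by simp
  have "c * (1 - 2 * of_nat k - 2) = - (2 * of_nat k + 1) / 2"
    using dual_osp_bases_normalization[OF assms(1), of i i] unfolding assms(2) by (simp add: mat_def)
  moreover have "1 - 2 * of_nat k - 2 = - (of_nat (Suc (2 * k)) :: complex)"
    "2 * of_nat k + 1 = (of_nat (Suc (2 * k)) :: complex)" by simp_all
  ultimately have "c * - of_nat (Suc (2 * k)) = - of_nat (Suc (2 * k)) / 2" by (simp only:)
  then have "(c - 1 / 2) * of_nat (Suc (2 * k)) = 0"
    by (simp del: of_nat_Suc add: left_diff_distrib)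
  then show ?thesis by (simp del: of_nat_Suc)
qed

section \<open>The Casimir operator in terms of E, R and \<Delta>\<close>

abbreviation act_sign :: "'a + 'b \<Rightarrow> 'a + 'b \<Rightarrow> complex" where
  "act_sign i j \<equiv> (-1) ^ (parity_index i * (parity_index i + parity_index j))"

definition casimir_normal_form :: "('a, 'b) superpoly \<Rightarrow> ('a, 'b) superpoly" where
  "casimir_normal_form r
     = euler (euler r) - scl (2 * of_nat k + 2) (euler r) - R2 (Lap r)"

text \<open>The matrix-unit part of the tensor leads to x_j \<partial>_i x_i \<partial>_j with
  signs. Moving \<partial>_i past x_i yields the superdimension times E, and the remaining double
  sum is E(E - 1).\<close>

lemma casimir_first_part:
  "(\<Sum>i\<in>UNIV. \<Sum>j\<in>UNIV. \<Sum>q\<in>UNIV. \<Sum>p\<in>UNIV.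
      scl (act_sign i j * act_sign q p * (sgn1 q * ((if i = p then 1 else 0) * (if j = q then 1 else 0))))
        (coord_mult j (coord_deriv i (coord_mult p (coord_deriv q r)))))
    = euler (euler r) - scl (2 * of_nat k + 1) (euler r)" (is "?L = _")
proof -
  have "(\<Sum>q\<in>UNIV. \<Sum>p\<in>UNIV.
      scl (act_sign i j * act_sign q p * (sgn1 q * ((if i = p then 1 else 0) * (if j = q then 1 else 0))))
        (coord_mult j (coord_deriv i (coord_mult p (coord_deriv q r)))))
    = coord_mult j (scl (sgn1 i) (coord_deriv j r) + coord_mult i (coord_deriv i (coord_deriv j r)))" for i j
  proof -
    have "(\<Sum>q\<in>UNIV. \<Sum>p\<in>UNIV.
      scl (act_sign i j * act_sign q p * (sgn1 q * ((if i = p then 1 else 0) * (if j = q then 1 else 0))))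
        (coord_mult j (coord_deriv i (coord_mult p (coord_deriv q r)))))
      = (\<Sum>q\<in>UNIV. \<Sum>p\<in>UNIV. scl (if i = p then (if j = q then act_sign i j * act_sign q p * sgn1 q else 0) else 0)
        (coord_mult j (coord_deriv i (coord_mult p (coord_deriv q r)))))"
      by (intro sum.cong refl) auto
    also have "\<dots> = scl (act_sign i j * act_sign j i * sgn1 j)
        (coord_mult j (coord_deriv i (coord_mult i (coord_deriv j r))))"
      by simp
    also have "act_sign i j * act_sign j i * sgn1 j = sgn1 i"
      using parity_index_cases[of i] parity_index_cases[of j] by auto
    also have "coord_deriv i (coord_mult i (coord_deriv j r))
        = coord_deriv j r + scl (sgn2 i i) (coord_mult i (coord_deriv i (coord_deriv j r)))"
      by (simp add: coord_deriv_mult)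
    also have "sgn2 i i = sgn1 i" using parity_index_cases[of i] by auto
    finally show ?thesis by (simp add: coord_simps superpoly.scale_right_distrib)
  qed
  then have "?L = (\<Sum>i\<in>UNIV. \<Sum>j\<in>UNIV.
      coord_mult j (scl (sgn1 i) (coord_deriv j r) + coord_mult i (coord_deriv i (coord_deriv j r))))"
    by (intro sum.cong refl)
  also have "\<dots> = (\<Sum>j\<in>UNIV. \<Sum>i\<in>UNIV.
      coord_mult j (scl (sgn1 i) (coord_deriv j r) + coord_mult i (coord_deriv i (coord_deriv j r))))"
    by (rule sum.swap)
  also have "\<dots> = (\<Sum>j\<in>UNIV. coord_mult j (scl (\<Sum>i\<in>UNIV. sgn1 (i :: 'a + 'b)) (coord_deriv j r)
      + euler (coord_deriv j r)))"
    by (simp only: linear_op_sum[OF linear_op_coord_mult, symmetric] sum.distrib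
        superpoly.scale_sum_left[symmetric] euler_def)
  also have "\<dots> = (\<Sum>j\<in>UNIV. scl (- 2 * of_nat k) (coord_mult j (coord_deriv j r))
      + coord_mult j (coord_deriv j (euler r)) - coord_mult j (coord_deriv j r))"
    unfolding sum_sgn1 card_diff euler_deriv by (simp add: coord_simps algebra_simps)
  also have "\<dots> = scl (- 2 * of_nat k) (euler r) + euler (euler r) - euler r"
    by (simp only: sum.distrib sum_subtractf superpoly.scale_sum_right[symmetric] euler_def[symmetric])
  finally show ?thesis
    by (simp add: superpoly.scale_left_distrib)
qed

text \<open>The form part of the tensor. Contracting \<partial>_i with x_p joins \<open>g\<close>
  and \<open>G\<close> to a delta and leaves E; the uncontracted terms separate into R applied to
  \<Delta>.\<close>

lemma casimir_second_part:
  "(\<Sum>i\<in>UNIV. \<Sum>j\<in>UNIV. \<Sum>q\<in>UNIV. \<Sum>p\<in>UNIV.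
      scl (act_sign i j * act_sign q p * (sgn1 q *
          ((-1) ^ ((parity_index p + parity_index q) * parity_index q) * G i q * g p j)))
        (coord_mult j (coord_deriv i (coord_mult p (coord_deriv q r)))))
    = euler r + R2 (Lap r)" (is "?L = _")
proof -
  have 1: "scl (act_sign i j * act_sign q p * (sgn1 q *
          ((-1) ^ ((parity_index p + parity_index q) * parity_index q) * G i q * g p j)))
        (coord_mult j (coord_deriv i (coord_mult p (coord_deriv q r))))
    = scl (if i = p then G i q * g j i else 0) (coord_mult j (coord_deriv q r))
      + scl (g p j) (coord_mult j (coord_mult p (scl (G i q) (coord_deriv i (coord_deriv q r)))))"
    for i j q p
  proof -
    have "act_sign i j * act_sign q p * (sgn1 q *
          ((-1) ^ ((parity_index p + parity_index q) * parity_index q) * G i q * g p j))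
        = sgn2 i j * (G i q * g p j)"
      using g_even[of p j] G_even[of i q] parity_index_cases[of i] parity_index_cases[of j]
      by (cases "parity_index p = parity_index j"; cases "parity_index i = parity_index q") auto
    moreover have "sgn2 i j * (G i q * g p j) * sgn2 i p = g p j * G i q"
    proof -
      have "sgn2 i j * (G i q * g p j) * sgn2 i p = G i q * (g p j * (sgn2 i p * sgn2 i j))"
        by (simp only: mult_ac)
      then show ?thesis unfolding g_sgn2(6) by (simp only: mult_ac)
    qed
    moreover have "sgn2 i j * (G i q * g p j) * (if i = p then 1 else 0) = (if i = p then G i q * g j i else 0)"
      using g_sgn2(4)[of i j] by (cases "i = p") (simp_all add: mult_ac)
    moreover have "coord_mult j (coord_deriv i (coord_mult p (coord_deriv q r)))
        = scl (if i = p then 1 else 0) (coord_mult j (coord_deriv q r))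
          + scl (sgn2 i p) (coord_mult j (coord_mult p (coord_deriv i (coord_deriv q r))))"
      by (simp add: coord_deriv_mult coord_simps)
    ultimately show ?thesis
      by (simp only: superpoly.scale_right_distrib superpoly.scale_scale coord_simps)
  qed
  have "?L = (\<Sum>i\<in>UNIV. \<Sum>j\<in>UNIV. \<Sum>q\<in>UNIV. scl (g j i * G i q) (coord_mult j (coord_deriv q r)))
    + (\<Sum>i\<in>UNIV. \<Sum>j\<in>UNIV. \<Sum>q\<in>UNIV. \<Sum>p\<in>UNIV.
        scl (g p j) (coord_mult j (coord_mult p (scl (G i q) (coord_deriv i (coord_deriv q r))))))"
    unfolding 1 sum.distrib by (simp add: mult.commute)
  also have "(\<Sum>i\<in>UNIV. \<Sum>j\<in>UNIV. \<Sum>q\<in>UNIV. scl (g j i * G i q) (coord_mult j (coord_deriv q r)))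
     = (\<Sum>j\<in>UNIV. \<Sum>q\<in>UNIV. \<Sum>i\<in>UNIV. scl (g j i * G i q) (coord_mult j (coord_deriv q r)))"
    by (rule trans[OF sum.swap sum.cong[OF refl sum.swap]])
  also have "\<dots> = euler r"
    unfolding superpoly.scale_sum_left[symmetric] gG euler_def by simp
  also have "(\<Sum>i\<in>UNIV. \<Sum>j\<in>UNIV. \<Sum>q\<in>UNIV. \<Sum>p\<in>UNIV.
        scl (g p j) (coord_mult j (coord_mult p (scl (G i q) (coord_deriv i (coord_deriv q r))))))
     = (\<Sum>j\<in>UNIV. \<Sum>p\<in>UNIV. \<Sum>i\<in>UNIV. \<Sum>q\<in>UNIV.
        scl (g p j) (coord_mult j (coord_mult p (scl (G i q) (coord_deriv i (coord_deriv q r))))))"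
    (is "?A = ?B")
  proof -
    let ?f = "\<lambda>i j q p. scl (g p j) (coord_mult j (coord_mult p (scl (G i q) (coord_deriv i (coord_deriv q r)))))"
    have "?A = (\<Sum>j\<in>UNIV. \<Sum>i\<in>UNIV. \<Sum>q\<in>UNIV. \<Sum>p\<in>UNIV. ?f i j q p)" by (rule sum.swap)
    also have "\<dots> = (\<Sum>j\<in>UNIV. \<Sum>i\<in>UNIV. \<Sum>p\<in>UNIV. \<Sum>q\<in>UNIV. ?f i j q p)"
      by (rule sum.cong[OF refl sum.cong[OF refl sum.swap]])
    also have "\<dots> = ?B" by (rule sum.cong[OF refl sum.swap])
    finally show ?thesis .
  qed
  also have "\<dots> = R2 (Lap r)"
    by (simp only: R2_def Lap_def linear_op_sum[OF linear_op_coord_mult] superpoly.scale_sum_right)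
  finally show ?thesis .
qed

end

context osp_form
begin

lemma act_act:
  "act X (act Y r) = (\<Sum>i\<in>UNIV. \<Sum>j\<in>UNIV. \<Sum>q\<in>UNIV. \<Sum>p\<in>UNIV.
     scl (act_sign i j * act_sign q p * (Y $ q $ p * X $ i $ j))
       (coord_mult j (coord_deriv i (coord_mult p (coord_deriv q r)))))"
  unfolding act_def linear_op_uminus[OF linear_op_coord_deriv] linear_op_sum[OF linear_op_coord_deriv]
    linear_op_scl[OF linear_op_coord_deriv] linear_op_uminus[OF linear_op_coord_mult]
    linear_op_sum[OF linear_op_coord_mult] linear_op_scl[OF linear_op_coord_mult]
    superpoly.scale_minus_right superpoly.scale_sum_right superpoly.scale_scale sum_negf minus_minus
  by (intro sum.cong refl arg_cong2[where f = scl]) (simp only: mult_ac)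

text \<open>The two bases enter the sum of the \<open>act (X i) (act (Y i) p)\<close> through their
  tensor only, and that is known once c = 1/2.\<close>

lemma is_casimir_unique:
  assumes "is_casimir k \<omega> C"
  shows "C = casimir_normal_form"
proof
  fix r :: "('a, 'b) superpoly"
  obtain c N X Y where d: "dual_osp_bases \<omega> c N X Y"
    and n: "(\<Sum>i<N. X i ** Y i) = mat (1 * (1 - 2 * of_nat k - 2))"
    and C: "C = (\<lambda>p. \<Sum>i<N. act (X i) (act (Y i) p))"
    using assms unfolding is_casimir_def by blast
  have c: "c = 1 / 2" by (rule is_casimir_scale[OF d n])
  have half: "S = x * B" if "1 / 2 * S = x / 2 * B" for S x B :: complex
    using that by simp
  have T: "(\<Sum>t<N. Y t $ q $ p * X t $ i $ j) = sgn1 q *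
    ((if i = p then 1 else 0) * (if j = q then 1 else 0)
      - (-1) ^ ((parity_index p + parity_index q) * parity_index q) * G i q * g p j)" for i j p q
    by (rule half[OF dual_osp_bases_tensor[OF d, of q p i j, unfolded c]])
  let ?x = "\<lambda>i j q p. coord_mult j (coord_deriv i (coord_mult p (coord_deriv q r)))"
  have "C r = (\<Sum>t<N. \<Sum>i\<in>UNIV. \<Sum>j\<in>UNIV. \<Sum>q\<in>UNIV. \<Sum>p\<in>UNIV.
     scl (act_sign i j * act_sign q p * (Y t $ q $ p * X t $ i $ j)) (?x i j q p))"
    unfolding C act_act ..
  also have "\<dots> = (\<Sum>i\<in>UNIV. \<Sum>j\<in>UNIV. \<Sum>q\<in>UNIV. \<Sum>p\<in>UNIV. \<Sum>t<N.
     scl (act_sign i j * act_sign q p * (Y t $ q $ p * X t $ i $ j)) (?x i j q p))"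
    by (subst sum.swap, rule sum.cong[OF refl], subst sum.swap, rule sum.cong[OF refl],
        subst sum.swap, rule sum.cong[OF refl], rule sum.swap)
  also have "\<dots> = (\<Sum>i\<in>UNIV. \<Sum>j\<in>UNIV. \<Sum>q\<in>UNIV. \<Sum>p\<in>UNIV.
     scl (act_sign i j * act_sign q p * (\<Sum>t<N. Y t $ q $ p * X t $ i $ j)) (?x i j q p))"
    by (simp only: superpoly.scale_sum_left sum_distrib_left)
  also have "\<dots> = (euler (euler r) - scl (2 * of_nat k + 1) (euler r)) - (euler r + R2 (Lap r))"
    unfolding T casimir_first_part[symmetric] casimir_second_part[symmetric]
      right_diff_distrib superpoly.scale_left_diff_distrib sum_subtractf ..
  also have "\<dots> = casimir_normal_form r"
    by (simp add: casimir_normal_form_def superpoly.scale_left_distrib algebra_simps scl_two)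
  finally show "C r = casimir_normal_form r" .
qed

section \<open>Existence of dual bases\<close>

definition dual_coef :: "'a + 'b \<Rightarrow> 'a + 'b \<Rightarrow> complex" where
  "dual_coef p r = sgn1 p * sgn1 r * (if p = r then 1 / 2 else 1)"

text \<open>The endomorphism sending v to e_p \<omega>(e_r, v) minus, up to sign, e_r \<omega>(e_p,
  v): the image of the super-wedge of e_p and e_r under the identification of the super exterior
  square of V with \<open>osp\<close>.\<close>

definition basis_elt :: "'a + 'b \<Rightarrow> 'a + 'b \<Rightarrow> complex^('a + 'b)^('a + 'b)" where
  "basis_elt p r = (\<chi> i j. (if i = p then 1 else 0) * g r j - sgn2 p r * ((if i = r then 1 else 0) * g p j))"

text \<open>The same construction with the vectors sum_i G_ir e_i of the dual basis. The factor 1/2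
  of \<open>dual_coef\<close> at p = r accounts for the two terms being equal there when p is
  odd.\<close>

definition dual_elt :: "'a + 'b \<Rightarrow> 'a + 'b \<Rightarrow> complex^('a + 'b)^('a + 'b)" where
  "dual_elt p r = (\<chi> i j. dual_coef p r * (sgn1 p * (G i r * (if j = p then 1 else 0))
     - sgn2 p r * sgn1 r * (G i p * (if j = r then 1 else 0))))"

lemma osp_matrix_basis_elt: "osp_matrix (basis_elt p r)"
  unfolding osp_matrix_def
proof (intro allI)
  fix j l
  have *: "(\<Sum>i\<in>UNIV. basis_elt p r $ i $ j * g i l) = g r j * g p l - sgn2 p r * (g p j * g r l)" for j l
  proof -
    have "(\<Sum>i\<in>UNIV. basis_elt p r $ i $ j * g i l)
       = g r j * (\<Sum>i\<in>UNIV. (if i = p then 1 else 0) * g i l)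
         - sgn2 p r * g p j * (\<Sum>i\<in>UNIV. (if i = r then 1 else 0) * g i l)"
      unfolding sum_distrib_left sum_subtractf[symmetric] by (simp add: basis_elt_def algebra_simps)
    then show ?thesis by (simp only: sum_delta_mult mult.assoc)
  qed
  have 1: "sgn2 j l * (g p j * g r l) = sgn2 p r * (g p j * g r l)"
    using g_even[of p j] g_even[of r l]
    by (cases "parity_index p = parity_index j"; cases "parity_index r = parity_index l") auto
  have 2: "sgn2 p r * (g p l * g r j) = sgn2 j l * (g p l * g r j)"
    using g_even[of p l] g_even[of r j]
    by (cases "parity_index p = parity_index l"; cases "parity_index r = parity_index j")
      (auto simp: mult.commute)
  have 3: "- sgn2 j l * (g r l * g p j - sgn2 p r * (g p l * g r j))
      = - (sgn2 j l * (g p j * g r l)) + sgn2 j l * (sgn2 p r * (g p l * g r j))"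
    by (simp add: algebra_simps)
  show "(\<Sum>i\<in>UNIV. basis_elt p r $ i $ j * g i l)
      = - sgn2 j l * (\<Sum>i\<in>UNIV. basis_elt p r $ i $ l * g i j)"
    unfolding * unfolding 3 unfolding 1 unfolding 2 unfolding sgn2_sq by (simp add: mult.commute)
qed

lemma osp_matrix_dual_elt: "osp_matrix (dual_elt p r)"
  unfolding osp_matrix_def
proof (intro allI)
  fix j l
  let ?d = "\<lambda>i j. if i = j then 1 else (0 :: complex)"
  have *: "(\<Sum>i\<in>UNIV. dual_elt p r $ i $ j * g i l)
      = dual_coef p r * sgn1 p * sgn1 r * (?d j p * ?d l r - sgn2 p r * (?d j r * ?d l p))" for j l
  proof -
    have "(\<Sum>i\<in>UNIV. dual_elt p r $ i $ j * g i l)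
       = dual_coef p r * (sgn1 p * ?d j p * (\<Sum>i\<in>UNIV. G i r * g i l)
         - sgn2 p r * sgn1 r * ?d j r * (\<Sum>i\<in>UNIV. G i p * g i l))"
      unfolding sum_distrib_left sum_subtractf[symmetric] by (simp add: dual_elt_def algebra_simps)
    then show ?thesis unfolding G_g_left by (simp add: algebra_simps)
  qed
  show "(\<Sum>i\<in>UNIV. dual_elt p r $ i $ j * g i l)
      = - sgn2 j l * (\<Sum>i\<in>UNIV. dual_elt p r $ i $ l * g i j)"
  proof -
    have "sgn2 r p = sgn2 p r" by (simp only: mult.commute)
    then have "?d j p * ?d l r - sgn2 p r * (?d j r * ?d l p)
      = - sgn2 j l * (?d l p * ?d j r - sgn2 p r * (?d l r * ?d j p))"
      by (cases "j = p"; cases "j = r"; cases "l = p"; cases "l = r")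
        (simp_all add: right_diff_distrib)
    then show ?thesis unfolding * by (simp only: mult_minus_left mult_minus_right mult.left_commute mult.assoc)
  qed
qed

lemma gl_part_basis_elt: "basis_elt p r \<in> gl_part ((parity_index p + parity_index r) mod 2)"
  using g_even[of p] g_even[of r] unfolding gl_part_def basis_elt_def
  by (force simp: add.commute split: if_splits)

lemma gl_part_dual_elt: "dual_elt p r \<in> gl_part ((parity_index p + parity_index r) mod 2)"
  using G_even[of _ p] G_even[of _ r] unfolding gl_part_def dual_elt_def
  by (force simp: add.commute split: if_splits)

lemma supertrace_dual_basis:
  "supertrace (dual_elt p r ** basis_elt p' r') = dual_coef p r * sgn1 p * sgn1 r *
     ((1 + sgn2 p r * sgn2 p' r') * ((if p = p' then 1 else 0) * (if r = r' then 1 else 0))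
      - (sgn2 p r + sgn2 p' r') * ((if p = r' then 1 else 0) * (if r = p' then 1 else 0)))"
proof -
  let ?d = "\<lambda>i j. if i = j then 1 else (0 :: complex)"
  have 1: "(\<Sum>i\<in>UNIV. sgn1 i * (G i r * basis_elt p' r' $ q $ i))
      = sgn1 r * (?d q p' * ?d r r' - sgn2 p' r' * (?d q r' * ?d r p'))" for q r
  proof -
    have "sgn1 i * (G i r * basis_elt p' r' $ q $ i)
       = sgn1 r * (?d q p' * (g r' i * G i r) - sgn2 p' r' * (?d q r' * (g p' i * G i r)))" for i
      using G_even[of i r] by (cases "parity_index i = parity_index r") (auto simp: basis_elt_def algebra_simps)
    then have "(\<Sum>i\<in>UNIV. sgn1 i * (G i r * basis_elt p' r' $ q $ i))
       = (\<Sum>i\<in>UNIV. sgn1 r * (?d q p' * (g r' i * G i r) - sgn2 p' r' * (?d q r' * (g p' i * G i r))))"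
      by (intro sum.cong refl)
    also have "\<dots> = sgn1 r * (?d q p' * (\<Sum>i\<in>UNIV. g r' i * G i r)
        - sgn2 p' r' * (?d q r' * (\<Sum>i\<in>UNIV. g p' i * G i r)))"
      by (simp only: sum_subtractf sum_distrib_left[symmetric])
    finally show ?thesis unfolding gG by (simp add: eq_commute)
  qed
  have "supertrace (dual_elt p r ** basis_elt p' r')
      = (\<Sum>i\<in>UNIV. dual_coef p r * (sgn1 p * (sgn1 i * (G i r * basis_elt p' r' $ p $ i))
         - sgn2 p r * sgn1 r * (sgn1 i * (G i p * basis_elt p' r' $ r $ i))))"
    unfolding supertrace_mult
  proof (rule sum.cong[OF refl])
    fix i
    have "(\<Sum>j\<in>UNIV. sgn1 i * (dual_elt p r $ i $ j * basis_elt p' r' $ j $ i))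
      = (\<Sum>j\<in>UNIV. ?d j p * (dual_coef p r * (sgn1 p * (sgn1 i * (G i r * basis_elt p' r' $ j $ i)))))
      - (\<Sum>j\<in>UNIV. ?d j r * (dual_coef p r * (sgn2 p r * sgn1 r * (sgn1 i * (G i p * basis_elt p' r' $ j $ i)))))"
      unfolding sum_subtractf[symmetric] by (rule sum.cong[OF refl]) (simp add: dual_elt_def algebra_simps)
    then show "(\<Sum>j\<in>UNIV. sgn1 i * (dual_elt p r $ i $ j * basis_elt p' r' $ j $ i))
      = dual_coef p r * (sgn1 p * (sgn1 i * (G i r * basis_elt p' r' $ p $ i))
         - sgn2 p r * sgn1 r * (sgn1 i * (G i p * basis_elt p' r' $ r $ i)))"
      unfolding sum_delta_mult by (simp only: right_diff_distrib)
  qed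
  also have "\<dots> = dual_coef p r * (sgn1 p * (\<Sum>i\<in>UNIV. sgn1 i * (G i r * basis_elt p' r' $ p $ i))
         - sgn2 p r * sgn1 r * (\<Sum>i\<in>UNIV. sgn1 i * (G i p * basis_elt p' r' $ r $ i)))"
    by (simp only: sum_subtractf sum_distrib_left[symmetric])
  also have "\<dots> = dual_coef p r * sgn1 p * sgn1 r *
     ((1 + sgn2 p r * sgn2 p' r') * (?d p p' * ?d r r')
      - (sgn2 p r + sgn2 p' r') * (?d p r' * ?d r p'))"
    unfolding 1 by (simp only: ring_distribs mult_1_left mult_ac) simp
  finally show ?thesis .
qed

lemma basis_elt_swap: "basis_elt r p $ i $ j = - sgn2 p r * basis_elt p r $ i $ j"
proof -
  have "sgn2 r p = sgn2 p r" by (simp only: mult.commute)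
  then show ?thesis by (simp add: basis_elt_def right_diff_distrib sgn2_sq)
qed

text \<open>The sum runs over ordered pairs, and the two terms of \<open>basis_elt\<close>
  contribute equally by \<open>osp_matrix_raised\<close>; hence the division by 2.\<close>

lemma osp_matrix_expansion:
  assumes "osp_matrix Z"
  shows "Z $ i $ j = (\<Sum>p\<in>UNIV. \<Sum>r\<in>UNIV. (\<Sum>l\<in>UNIV. Z $ p $ l * G l r) / 2 * basis_elt p r $ i $ j)"
proof -
  let ?d = "\<lambda>i j. if i = j then 1 else (0 :: complex)"
  let ?W = "\<lambda>p r. \<Sum>l\<in>UNIV. Z $ p $ l * G l r"
  have Z: "(\<Sum>r\<in>UNIV. ?W i r * g r j) = Z $ i $ j"
  proof -
    have "(\<Sum>r\<in>UNIV. ?W i r * g r j) = (\<Sum>l\<in>UNIV. Z $ i $ l * (\<Sum>r\<in>UNIV. G l r * g r j))"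
      unfolding sum_distrib_left sum_distrib_right by (subst sum.swap) (simp only: mult.assoc)
    then show ?thesis unfolding Gg sum_delta_mult .
  qed
  have "(\<Sum>p\<in>UNIV. \<Sum>r\<in>UNIV. ?W p r / 2 * basis_elt p r $ i $ j)
     = (\<Sum>p\<in>UNIV. \<Sum>r\<in>UNIV. ?d i p * (?W p r * g r j / 2))
       - (\<Sum>p\<in>UNIV. \<Sum>r\<in>UNIV. ?d i r * (?W p r * (sgn2 p r * g p j) / 2))"
    unfolding sum_subtractf[symmetric] by (intro sum.cong refl) (simp add: basis_elt_def algebra_simps)
  also have "(\<Sum>p\<in>UNIV. \<Sum>r\<in>UNIV. ?d i p * (?W p r * g r j / 2)) = (\<Sum>r\<in>UNIV. ?W i r * g r j) / 2"
    by (simp only: sum_distrib_left[symmetric] sum_delta_mult sum_divide_distrib)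
  also have "(\<Sum>p\<in>UNIV. \<Sum>r\<in>UNIV. ?d i r * (?W p r * (sgn2 p r * g p j) / 2))
      = (\<Sum>p\<in>UNIV. - (?W i p * g p j / 2))"
  proof (rule sum.cong[OF refl])
    fix p
    have "?W p i * (sgn2 p i * g p j) / 2 = - (sgn2 p i * sgn2 p i) * (?W i p * g p j / 2)"
      unfolding osp_matrix_raised[OF assms, of p i] by (simp only: mult_ac mult_minus_left mult_minus_right
          times_divide_eq_right times_divide_eq_left)
    then show "(\<Sum>r\<in>UNIV. ?d i r * (?W p r * (sgn2 p r * g p j) / 2)) = - (?W i p * g p j / 2)"
      unfolding sum_delta_mult sgn2_sq by simp
  qed
  also have "\<dots> = - (\<Sum>p\<in>UNIV. ?W i p * g p j) / 2"
    by (simp only: sum_negf sum_divide_distrib[symmetric] minus_divide_left)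
  finally show ?thesis unfolding Z by simp
qed

text \<open>The basis consists of the wedges of pairs p < r and of the wedges of odd basis vectors
  with themselves; for even p the wedge of e_p with itself is 0.\<close>

lemma ex_dual_osp_bases: "\<exists>N X Y. dual_osp_bases \<omega> (1 / 2) N X Y"
proof -
  \<comment> \<open>The even index type carries no order, so the pairs are ordered through an
    injection into the natural numbers.\<close>
  obtain f :: "'a + 'b \<Rightarrow> nat" where f: "inj f"
    using finite_imp_inj_to_nat_seg[of "UNIV :: ('a + 'b) set"] by auto
  define J where "J = {(p, r). f p < f r \<or> p = r \<and> parity_index p = 1}"
  obtain h where h: "bij_betw h {0..<card J} J"
    using ex_bij_betw_nat_finite[of J] by auto
  define X where "X t = basis_elt (fst (h t)) (snd (h t))" for t
  define Y where "Y t = dual_elt (fst (h t)) (snd (h t))" for t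
  have part: "\<exists>b\<in>{0, 1}. X t \<in> osp_part \<omega> b \<and> Y t \<in> osp_part \<omega> b" for t
  proof -
    define b where "b = (parity_index (fst (h t)) + parity_index (snd (h t))) mod 2"
    have b: "b \<in> {0, 1}" by (auto simp: b_def)
    have "X t \<in> osp_part \<omega> b \<and> Y t \<in> osp_part \<omega> b"
      using gl_part_basis_elt[of "fst (h t)" "snd (h t)"] gl_part_dual_elt[of "fst (h t)" "snd (h t)"]
      unfolding osp_part_eq[OF b] X_def Y_def b_def[symmetric]
      by (simp add: osp_matrix_basis_elt osp_matrix_dual_elt)
    then show ?thesis using b by blast
  qed
  have dual: "1 / 2 * supertrace (Y s ** X t) = (if s = t then 1 else 0)"
    if "s < card J" "t < card J" for s t
  proof -
    obtain p r where pr: "h s = (p, r)" by (cases "h s")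
    obtain p' r' where pr': "h t = (p', r')" by (cases "h t")
    have J: "(p, r) \<in> J" "(p', r') \<in> J"
      using bij_betwE[OF h] that pr pr' by (metis atLeastLessThan_iff zero_le)+
    have st: "s = t \<longleftrightarrow> p = p' \<and> r = r'"
      using bij_betw_imp_inj_on[OF h] that pr pr' by (auto simp: inj_on_def)
    have swap: "p = r" if "p = r'" "r = p'"
      using J that by (auto simp: J_def)
    have "1 / 2 * supertrace (dual_elt p r ** basis_elt p' r') = (if p = p' \<and> r = r' then 1 else 0)"
    proof (cases "p = r")
      case True
      then have odd: "parity_index r = 1" using J by (simp add: J_def)
      show ?thesis
        using swap odd unfolding supertrace_dual_basis True
        by (auto simp: dual_coef_def)
    next
      case False
      then have "\<not> (p = r' \<and> r = p')" using swap by blast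
      then show ?thesis
        using False parity_index_cases[of p] parity_index_cases[of r]
        unfolding supertrace_dual_basis by (auto simp: dual_coef_def)
    qed
    then show ?thesis by (simp add: X_def Y_def pr pr' st)
  qed
  have span: "\<exists>a. \<forall>i j. Z $ i $ j = (\<Sum>t<card J. a t * X t $ i $ j)"
    if "osp_matrix Z" for Z
  proof -
    define W where "W p r = (\<Sum>l\<in>UNIV. Z $ p $ l * G l r)" for p r
    \<comment> \<open>Among ordered pairs an off-diagonal pair occurs in both orders and a diagonal
      one once, so only the latter keeps the factor 1/2.\<close>
    define a where "a = (\<lambda>(p, r). if p = r then W p r / 2 else W p r)"
    have "Z $ i $ j = (\<Sum>t<card J. a (h t) * X t $ i $ j)" for i j
    proof -
      define H where "H = (\<lambda>(p, r). W p r / 2 * basis_elt p r $ i $ j)"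
      define L where "L = {(p, r). f p < f r}"
      define L' where "L' = {(p, r). f r < f p}"
      define D where "D = {(p, r :: 'a + 'b). p = r}"
      define D1 where "D1 = {(p, r :: 'a + 'b). p = r \<and> parity_index p = 1}"
      have H_swap: "H (r, p) = H (p, r)" for p r
      proof -
        have "H (r, p) = (sgn2 r p * sgn2 p r) * H (p, r)"
          unfolding H_def W_def case_prod_conv osp_matrix_raised[OF that, of r p] basis_elt_swap[of r p]
          by (simp only: mult_minus_left mult_minus_right minus_minus mult_ac
              times_divide_eq_left times_divide_eq_right minus_divide_left[symmetric])
        then show ?thesis by (simp add: mult.commute)
      qed
      have H_diag: "H (p, p) = 0" if "parity_index p \<noteq> 1" for p
        using that parity_index_cases[of p] by (auto simp: H_def basis_elt_def)
      have "Z $ i $ j = (\<Sum>p\<in>UNIV. \<Sum>r\<in>UNIV. H (p, r))"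
        unfolding H_def W_def case_prod_conv by (rule osp_matrix_expansion[OF that])
      also have "\<dots> = (\<Sum>x\<in>UNIV. H x)"
        by (simp add: sum.cartesian_product)
      also have "UNIV = L \<union> (L' \<union> D)"
        using injD[OF f] by (auto simp: L_def L'_def D_def) (metis linorder_less_linear)
      also have "sum H (L \<union> (L' \<union> D)) = sum H L + (sum H L' + sum H D)"
        by (subst sum.union_disjoint, simp, simp, force simp: L_def L'_def D_def,
            subst sum.union_disjoint) (auto simp: L_def L'_def D_def)
      also have "sum H L' = sum H L"
        by (rule sum.reindex_bij_witness[of _ prod.swap prod.swap]) (auto simp: L_def L'_def H_swap)
      also have "sum H D = sum H D1"
        by (rule sum.mono_neutral_right) (use H_diag in \<open>auto simp: D_def D1_def\<close>)
      also have "sum H L + (sum H L + sum H D1) = (\<Sum>x\<in>L. 2 * H x) + sum H D1"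
        by (simp add: sum_distrib_left[symmetric])
      also have "\<dots> = (\<Sum>x\<in>L. a x * basis_elt (fst x) (snd x) $ i $ j)
          + (\<Sum>x\<in>D1. a x * basis_elt (fst x) (snd x) $ i $ j)"
        by (intro arg_cong2[where f = "(+)"] sum.cong refl) (auto simp: L_def D1_def a_def H_def)
      also have "\<dots> = (\<Sum>x\<in>L \<union> D1. a x * basis_elt (fst x) (snd x) $ i $ j)"
        by (subst sum.union_disjoint) (auto simp: L_def D1_def)
      also have "L \<union> D1 = J" by (auto simp: L_def D1_def J_def)
      also have "(\<Sum>x\<in>J. a x * basis_elt (fst x) (snd x) $ i $ j)
          = (\<Sum>t\<in>{0..<card J}. a (h t) * X t $ i $ j)"
        unfolding X_def by (rule sum.reindex_bij_betw[OF h, symmetric])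
      finally show ?thesis by (simp only: atLeast0LessThan)
    qed
    then show ?thesis by (intro exI[of _ "\<lambda>t. a (h t)"] allI)
  qed
  show ?thesis
    unfolding dual_osp_bases_def
  proof (rule exI[of _ "card J"], rule exI[of _ X], rule exI[of _ Y], intro conjI allI impI ballI)
    fix b Z assume "b \<in> {0, 1}" "Z \<in> osp_part \<omega> b"
    then have "osp_matrix Z" using osp_part_eq by blast
    then show "\<exists>a. \<forall>r s. Z $ r $ s = (\<Sum>i<card J. a i * X i $ r $ s)" by (rule span)
  next
    fix t show "\<exists>b\<in>{0, 1}. X t \<in> osp_part \<omega> b \<and> Y t \<in> osp_part \<omega> b" by (rule part)
  next
    fix s t assume "s < card J" "t < card J"
    then show "1 / 2 * supertrace (Y s ** X t) = (if s = t then 1 else 0)" by (rule dual)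
  qed
qed

lemma casimir_eq: "casimir k \<omega> = casimir_normal_form"
proof -
  obtain N X Y where d: "dual_osp_bases \<omega> (1 / 2) N X Y" using ex_dual_osp_bases by blast
  have "(\<Sum>t<N. X t ** Y t) = mat (1 * (1 - 2 * of_nat k - 2))"
    using dual_osp_bases_normalization[OF d] by (simp add: vec_eq_iff mat_def)
  then have "is_casimir k \<omega> (\<lambda>p. \<Sum>i<N. act (X i) (act (Y i) p))"
    using d unfolding is_casimir_def by blast
  then have "is_casimir k \<omega> casimir_normal_form" using is_casimir_unique by simp
  then show ?thesis
    unfolding casimir_def using is_casimir_unique by (rule the_equality)
qed

lemma casimir_homog:
  assumes "p \<in> homog_poly d"
  shows "casimir k \<omega> p = scl (of_nat d * (of_nat d - 2 * of_nat k - 2)) p - scl 4 (Q p)"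
proof -
  have e: "euler p = scl (of_nat d) p" using assms by (simp add: homog_poly_iff_euler)
  have "casimir k \<omega> p = scl (of_nat d * of_nat d) p - scl ((2 * of_nat k + 2) * of_nat d) p - scl 4 (Q p)"
    unfolding casimir_eq casimir_normal_form_def e linear_op_scl[OF linear_op_euler] by (simp add: Q_def)
  also have "scl (of_nat d * of_nat d) p - scl ((2 * of_nat k + 2) * of_nat d) p
      = scl (of_nat d * of_nat d - (2 * of_nat k + 2) * of_nat d) p"
    by (simp only: superpoly.scale_left_diff_distrib)
  also have "of_nat d * of_nat d - (2 * of_nat k + 2) * of_nat d
      = (of_nat d * (of_nat d - 2 * of_nat k - 2) :: complex)"
    by (simp add: algebra_simps)
  finally show ?thesis .
qed

end


section \<open>Superdifferential operators of given order\<close>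

lemma linear_form_expansion:
  fixes f :: "complex^'n::finite \<Rightarrow> complex"
  assumes "Vector_Spaces.linear (*s) (*) f"
  shows "f w = (\<Sum>j\<in>UNIV. w $ j * f (axis j 1))"
proof -
  interpret f: Vector_Spaces.linear "(*s)" "(*)" f by fact
  have "f w = f (\<Sum>j\<in>UNIV. w $ j *s axis j 1)" by (simp add: basis_expansion)
  then show ?thesis by (simp add: f.sum f.scale)
qed

text \<open>Nondegeneracy is stated in the left argument, so it says that the transposed Gram matrix
  has trivial kernel; transposing its left inverse gives \<open>G\<close>.\<close>

lemma supersymmetric_form_imp_osp_form:
  fixes \<omega> :: "complex^('a::finite + 'b::{finite,linorder}) \<Rightarrow> complex^('a + 'b) \<Rightarrow> complex"
  assumes \<omega>: "supersymmetric_form \<omega>"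
    and card: "of_nat CARD('a) - of_nat CARD('b) = (- 2 * of_nat k :: complex)"
  obtains G where "osp_form (\<lambda>i j. \<omega> (axis i 1) (axis j 1)) G k \<omega>"
proof -
  let ?g = "\<lambda>i j. \<omega> (axis i 1) (axis j 1)"
  have homog: "axis i 1 \<in> homog_vec (parity_index i)" for i :: "'a + 'b"
    by (auto simp: homog_vec_def axis_def)
  have form: "\<omega> v w = (\<Sum>i\<in>UNIV. \<Sum>j\<in>UNIV. v $ i * w $ j * ?g i j)" for v w
  proof -
    have "\<omega> v w = (\<Sum>i\<in>UNIV. v $ i * \<omega> (axis i 1) w)"
      using \<omega> linear_form_expansion[of "\<lambda>v. \<omega> v w" v] unfolding supersymmetric_form_def by blast
    also have "\<dots> = (\<Sum>i\<in>UNIV. v $ i * (\<Sum>j\<in>UNIV. w $ j * ?g i j))"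
      using \<omega> linear_form_expansion[of "\<lambda>w. \<omega> (axis _ 1) w" w]
      unfolding supersymmetric_form_def by (intro sum.cong refl arg_cong2[where f = "(*)"]) blast
    finally show ?thesis by (simp add: sum_distrib_left mult.assoc)
  qed
  define A :: "complex^('a + 'b)^('a + 'b)" where "A = (\<chi> i j. ?g i j)"
  have "v = 0" if "transpose A *v v = 0" for v
  proof -
    have 0: "(\<Sum>i\<in>UNIV. v $ i * ?g i j) = 0" for j
      using arg_cong[OF that, of "\<lambda>x. x $ j"]
      by (simp add: matrix_vector_mult_def transpose_def A_def mult.commute)
    have "\<omega> v w = 0" for w
    proof -
      have "\<omega> v w = (\<Sum>j\<in>UNIV. \<Sum>i\<in>UNIV. v $ i * w $ j * ?g i j)"
        by (rule trans[OF form sum.swap])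
      also have "\<dots> = (\<Sum>j\<in>UNIV. \<Sum>i\<in>UNIV. w $ j * (v $ i * ?g i j))"
        by (intro sum.cong refl) simp
      also have "\<dots> = 0"
        by (simp only: sum_distrib_left[symmetric] 0 mult_zero_right sum.neutral_const)
      finally show ?thesis .
    qed
    then show "v = 0" using \<omega> unfolding supersymmetric_form_def by blast
  qed
  then obtain B where B: "B ** transpose A = mat 1"
    using matrix_left_invertible_ker by blast
  define C where "C = transpose B"
  have AC: "A ** C = mat 1"
    using arg_cong[OF B, of transpose] by (simp add: matrix_transpose_mul C_def)
  then have CA: "C ** A = mat 1"
    using matrix_left_right_inverse by blast
  have even: "?g i j = 0" if "parity_index i \<noteq> parity_index j" for i j
    using \<omega> homog[of i] homog[of j] parity_index_cases[of i] parity_index_cases[of j] that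
    unfolding supersymmetric_form_def by blast
  show thesis
  proof (rule that[of "\<lambda>i j. C $ i $ j"], unfold_locales)
    fix i j l :: "'a + 'b"
    show "parity_index i \<noteq> parity_index j \<Longrightarrow> ?g i j = 0" by (rule even)
    show "?g i j = sgn1 i * ?g j i"
    proof (cases "parity_index i = parity_index j")
      case True
      have "?g i j = (-1) ^ (parity_index i * parity_index j) * ?g j i"
        using \<omega> homog[of i] homog[of j] parity_index_cases[of i] parity_index_cases[of j]
        unfolding supersymmetric_form_def by blast
      then show ?thesis using True parity_index_cases[of i] by auto
    next
      case False
      then have "?g i j = 0" "?g j i = 0" using even by simp_all
      then show ?thesis by simp
    qed
    show "(\<Sum>j\<in>UNIV. ?g i j * C $ j $ l) = (if i = l then 1 else 0)"
      using arg_cong[OF AC, of "\<lambda>M. M $ i $ l"] by (simp add: matrix_matrix_mult_def A_def mat_def)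
    show "(\<Sum>j\<in>UNIV. C $ i $ j * ?g j l) = (if i = l then 1 else 0)"
      using arg_cong[OF CA, of "\<lambda>M. M $ i $ l"] by (simp add: matrix_matrix_mult_def A_def mat_def)
  next
    show "of_nat CARD('a) - of_nat CARD('b) = (- 2 * of_nat k :: complex)" by (rule card)
  next
    fix v w
    show "\<omega> v w = (\<Sum>i\<in>UNIV. \<Sum>j\<in>UNIV. v $ i * w $ j * ?g i j)" by (rule form)
  qed
qed

text \<open>The supercommutator with a coordinate, in the form in which it lowers the order of \<open>A\<close>.\<close>

definition coord_commutator :: "'a::finite + 'b::{finite,linorder} \<Rightarrow>
    (('a, 'b) superpoly \<Rightarrow> ('a, 'b) superpoly) \<Rightarrow> ('a, 'b) superpoly \<Rightarrow> ('a, 'b) superpoly" where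
  "coord_commutator i A = (\<lambda>p. A (coord_mult i p) -
     coord_mult i ((parity_involution ^^ parity_index i) (A ((parity_involution ^^ parity_index i) p))))"

lemma linear_op_foldr_mult: "linear_op (foldr coord_mult us)"
  by (induction us) (auto simp: id_def[symmetric] comp_def[abs_def] intro: linear_op_id[folded id_def] linear_op_coord_mult_comp)

lemma linear_op_foldr_deriv: "linear_op (foldr coord_deriv vs)"
  by (induction vs) (auto simp: id_def[symmetric] comp_def[abs_def] intro: linear_op_id[folded id_def] linear_op_coord_deriv_comp)

lemma parity_pow: "parity_index i = 0 \<Longrightarrow> parity_involution ^^ parity_index i = (\<lambda>p. p)"
  "parity_index i = 1 \<Longrightarrow> parity_involution ^^ parity_index i = parity_involution"
  by (auto simp: fun_eq_iff)

lemma parity_pow_mult: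
  "(parity_involution ^^ parity_index i) (coord_mult j p)
     = scl (sgn2 i j) (coord_mult j ((parity_involution ^^ parity_index i) p))"
  for p :: "('a::finite, 'b::{finite,linorder}) superpoly"
  using parity_index_cases[of i] by (auto simp: parity_pow parity_mult)

lemma parity_pow_deriv:
  "(parity_involution ^^ parity_index i) (coord_deriv j p)
     = scl (sgn2 i j) (coord_deriv j ((parity_involution ^^ parity_index i) p))"
  for p :: "('a::finite, 'b::{finite,linorder}) superpoly"
  using parity_index_cases[of i] by (auto simp: parity_pow parity_deriv)

lemma parity_pow_parity_pow [simp]:
  "(parity_involution ^^ parity_index i) ((parity_involution ^^ parity_index i) p) = p"
  using parity_index_cases[of i] by (auto simp: parity_pow)

lemma linear_op_parity_pow: "linear_op (parity_involution ^^ n)"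
  by (intro linear_op_funpow linear_op_parity)

section \<open>Normally ordered operators of fixed bidegree\<close>

lemma superop_plus: "A + B = (\<lambda>p. A p + B p)"
  by (simp add: plus_fun_def)

lemma linear_op_diff_ops_part:
  fixes A :: "('a::finite, 'b::{finite,linorder}) superpoly \<Rightarrow> ('a, 'b) superpoly"
  assumes "A \<in> diff_ops_part d e"
  shows "linear_op A"
  using assms unfolding diff_ops_part_def
proof (rule superop.span_induct)
  show "superop.subspace {A :: ('a, 'b) superpoly \<Rightarrow> ('a, 'b) superpoly. linear_op A}"
    by (rule superop.subspaceI)
      (auto simp: superop_plus op_scl_def zero_fun_def intro: linear_op_plus linear_op_scaled linear_op_const0)
qed (auto intro: linear_op_comp[OF linear_op_foldr_mult linear_op_foldr_deriv] simp: comp_def)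

lemma diff_ops_part_zero: "0 \<in> diff_ops_part d e"
  unfolding diff_ops_part_def by (rule superop.span_zero)

lemma diff_ops_part_add:
  "A \<in> diff_ops_part d e \<Longrightarrow> B \<in> diff_ops_part d e \<Longrightarrow> (\<lambda>p. A p + B p) \<in> diff_ops_part d e"
  using superop.span_add[of A _ B] unfolding diff_ops_part_def by (simp add: superop_plus)

lemma diff_ops_part_scl:
  "A \<in> diff_ops_part d e \<Longrightarrow> (\<lambda>p. scl c (A p)) \<in> diff_ops_part d e"
  using superop.span_scale[of A _ c] unfolding diff_ops_part_def by (simp add: op_scl_def)

lemma diff_ops_part_diff:
  "A \<in> diff_ops_part d e \<Longrightarrow> B \<in> diff_ops_part d e \<Longrightarrow> (\<lambda>p. A p - B p) \<in> diff_ops_part d e"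
  using diff_ops_part_add[of A d e "\<lambda>p. scl (-1) (B p)"] diff_ops_part_scl[of B d e "-1"] by simp

lemma diff_ops_part_sum:
  "(\<And>i. i \<in> I \<Longrightarrow> A i \<in> diff_ops_part d e) \<Longrightarrow> (\<lambda>p. \<Sum>i\<in>I. A i p) \<in> diff_ops_part d e"
  by (induction I rule: infinite_finite_induct)
    (use diff_ops_part_zero in \<open>auto simp: zero_fun_def intro: diff_ops_part_add\<close>)

lemma diff_ops_part_id: "(\<lambda>p. p) \<in> diff_ops_part 0 0"
  unfolding diff_ops_part_def by (rule superop.span_base) (auto intro!: exI[of _ "[]"] simp: fun_eq_iff)

lemma diff_ops_part_induct [consumes 1, case_names base add scl]:
  assumes "A \<in> diff_ops_part d e"
    and "\<And>us vs. length us = d \<Longrightarrow> length vs = e \<Longrightarrow> P (\<lambda>p. foldr coord_mult us (foldr coord_deriv vs p))"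
    and "\<And>A B. P A \<Longrightarrow> P B \<Longrightarrow> P (\<lambda>p. A p + B p)"
    and "\<And>c A. P A \<Longrightarrow> P (\<lambda>p. scl c (A p))"
  shows "P A"
  using assms(1) unfolding diff_ops_part_def
proof (rule superop.span_induct)
  have "P 0"
  proof -
    have "P (\<lambda>p. scl 0 (foldr coord_mult (replicate d undefined) (foldr coord_deriv (replicate e undefined) p)))"
      by (intro assms(2,4)) simp_all
    then show ?thesis by (simp add: zero_fun_def)
  qed
  then show "superop.subspace {A. P A}"
    by (intro superop.subspaceI) (auto simp: superop_plus op_scl_def intro: assms(3,4))
qed (use assms(2) in \<open>auto simp: comp_def\<close>)

lemma diff_ops_part_mult:
  fixes A :: "('a::finite, 'b::{finite,linorder}) superpoly \<Rightarrow> ('a, 'b) superpoly"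
  assumes "A \<in> diff_ops_part d e"
  shows "(\<lambda>p. coord_mult i (A p)) \<in> diff_ops_part (Suc d) e"
  using assms
proof (induction A rule: diff_ops_part_induct)
  case (base us vs)
  then show ?case unfolding diff_ops_part_def
    by (intro superop.span_base CollectI exI[of _ "i # us"] exI[of _ vs]) (simp add: fun_eq_iff)
qed (simp_all add: coord_simps diff_ops_part_add diff_ops_part_scl)

lemma diff_ops_part_deriv_right:
  fixes A :: "('a::finite, 'b::{finite,linorder}) superpoly \<Rightarrow> ('a, 'b) superpoly"
  assumes "A \<in> diff_ops_part d e"
  shows "(\<lambda>p. A (coord_deriv i p)) \<in> diff_ops_part d (Suc e)"
  using assms
proof (induction A rule: diff_ops_part_induct)
  case (base us vs)
  then show ?case unfolding diff_ops_part_def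
    by (intro superop.span_base CollectI exI[of _ us] exI[of _ "vs @ [i]"]) (simp add: fun_eq_iff)
qed (simp_all add: coord_simps diff_ops_part_add diff_ops_part_scl)

lemma diff_ops_part_deriv_left:
  fixes A :: "('a::finite, 'b::{finite,linorder}) superpoly \<Rightarrow> ('a, 'b) superpoly"
  assumes "A \<in> diff_ops_part 0 e"
  shows "(\<lambda>p. coord_deriv i (A p)) \<in> diff_ops_part 0 (Suc e)"
  using assms
proof (induction A rule: diff_ops_part_induct)
  case (base us vs)
  then show ?case unfolding diff_ops_part_def
    by (intro superop.span_base CollectI exI[of _ us] exI[of _ "i # vs"]) (simp add: fun_eq_iff)
qed (simp_all add: coord_simps diff_ops_part_add diff_ops_part_scl)

lemma foldr_deriv_in_diff_ops_part: "foldr coord_deriv vs \<in> diff_ops_part 0 (length vs)"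
  unfolding diff_ops_part_def by (rule superop.span_base) (auto intro!: exI[of _ "[]"] exI[of _ vs] simp: fun_eq_iff)

lemma diff_ops_part_subset_diff_ops: "diff_ops_part d e \<subseteq> diff_ops"
  unfolding diff_ops_part_def diff_ops_def by (rule superop.span_mono) auto

text \<open>Moving x_i through the derivations leaves one contraction for each factor \<partial>_i,
  hence products with one derivation fewer. For the empty list the truncated length does not express
  that the commutator vanishes; the second claim does.\<close>

lemma coord_commutator_foldr_deriv:
  fixes i :: "'a::finite + 'b::{finite,linorder}"
  shows "coord_commutator i (foldr coord_deriv vs) \<in> diff_ops_part 0 (length vs - 1)"
    and "vs = [] \<Longrightarrow> coord_commutator i (foldr coord_deriv vs) = (\<lambda>p. 0)"
proof (induction vs)
  case Nil
  have "coord_commutator i (foldr coord_deriv []) = (\<lambda>p. 0)"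
    by (simp add: coord_commutator_def fun_eq_iff)
  then show "coord_commutator i (foldr coord_deriv []) \<in> diff_ops_part 0 (length [] - 1)"
    "coord_commutator i (foldr coord_deriv []) = (\<lambda>p. 0)"
    using diff_ops_part_zero by (simp_all add: zero_fun_def)
next
  case (Cons v vs)
  let ?Pi = "parity_involution ^^ parity_index i :: ('a, 'b) superpoly \<Rightarrow> _"
  let ?D = "foldr coord_deriv vs :: ('a, 'b) superpoly \<Rightarrow> _"
  have "coord_mult i (?Pi (coord_deriv v q)) = coord_deriv v (coord_mult i (?Pi q)) - (if v = i then ?Pi q else 0)" for q
  proof -
    have "coord_mult i (?Pi (coord_deriv v q)) = scl (sgn2 v i) (coord_mult i (coord_deriv v (?Pi q)))"
      by (simp add: parity_pow_deriv coord_simps mult.commute)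
    then show ?thesis by (simp add: coord_deriv_mult)
  qed
  then have "coord_commutator i (foldr coord_deriv (v # vs))
      = (\<lambda>p. coord_deriv v (coord_commutator i ?D p) + (if v = i then ?Pi (?D (?Pi p)) else 0))"
    by (auto simp: coord_commutator_def fun_eq_iff coord_simps)
  \<comment> \<open>Conjugation with the parity involution only multiplies a product of derivations
    by a sign.\<close>
  moreover have "\<exists>c. \<forall>p. ?Pi (?D (?Pi p)) = scl c (?D p)"
  proof -
    have "\<exists>c. \<forall>p. ?Pi (foldr coord_deriv ws p) = scl c (foldr coord_deriv ws (?Pi p))" for ws
    proof (induction ws)
      case Nil
      show ?case by (rule exI[of _ 1]) simp
    next
      case (Cons w ws)
      then obtain c where "?Pi (foldr coord_deriv ws p) = scl c (foldr coord_deriv ws (?Pi p))" for p by blast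
      then show ?case
        by (intro exI[of _ "sgn2 i w * c"]) (simp add: parity_pow_deriv coord_simps)
    qed
    then obtain c where "?Pi (?D p) = scl c (?D (?Pi p))" for p by blast
    then show ?thesis by (intro exI[of _ c]) simp
  qed
  then obtain c where "\<And>p. ?Pi (?D (?Pi p)) = scl c (?D p)" by blast
  ultimately have eq: "coord_commutator i (foldr coord_deriv (v # vs))
      = (\<lambda>p. coord_deriv v (coord_commutator i ?D p) + scl (if v = i then c else 0) (?D p))"
    by auto
  have "(\<lambda>p. coord_deriv v (coord_commutator i ?D p)) \<in> diff_ops_part 0 (length vs)"
  proof (cases "vs = []")
    case True
    have "coord_commutator i ?D p = 0" for p by (simp only: Cons(2)[OF True])
    then show ?thesis
      using diff_ops_part_zero[of 0 "length vs"] by (simp only: coord_deriv_zero zero_fun_def)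
  next
    case False
    then show ?thesis using diff_ops_part_deriv_left[OF Cons(1), of v] by simp
  qed
  then show "coord_commutator i (foldr coord_deriv (v # vs)) \<in> diff_ops_part 0 (length (v # vs) - 1)"
    unfolding eq list.size add_Suc_right add_0_right diff_Suc_1
    by (intro diff_ops_part_add diff_ops_part_scl foldr_deriv_in_diff_ops_part)
qed simp

text \<open>Coordinates supercommute with each other, so only the derivations contribute to the
  commutator.\<close>

lemma coord_commutator_base:
  "coord_commutator i (\<lambda>p. foldr coord_mult us (foldr coord_deriv vs p))
     = (\<lambda>p. foldr coord_mult us (coord_commutator i (foldr coord_deriv vs) p))"
proof -
  have "coord_mult i ((parity_involution ^^ parity_index i) (foldr coord_mult us q))
      = foldr coord_mult us (coord_mult i ((parity_involution ^^ parity_index i) q))" for q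
  proof (induction us)
    case (Cons u us)
    have "coord_mult i ((parity_involution ^^ parity_index i) (foldr coord_mult (u # us) q))
        = scl (sgn2 i u) (coord_mult i (coord_mult u ((parity_involution ^^ parity_index i) (foldr coord_mult us q))))"
      by (simp add: parity_pow_mult coord_simps)
    also have "\<dots> = coord_mult u (coord_mult i ((parity_involution ^^ parity_index i) (foldr coord_mult us q)))"
      by (subst coord_mult_commute) simp
    finally show ?case by (simp add: Cons)
  qed simp
  then show ?thesis
    by (simp add: coord_commutator_def fun_eq_iff linear_op_diff[OF linear_op_foldr_mult])
qed

lemma coord_commutator_add: "coord_commutator i (\<lambda>p. A p + B p) = (\<lambda>p. coord_commutator i A p + coord_commutator i B p)"
  and coord_commutator_scl: "coord_commutator i (\<lambda>p. scl c (A p)) = (\<lambda>p. scl c (coord_commutator i A p))"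
  by (simp_all add: coord_commutator_def fun_eq_iff linear_op_simps[OF linear_op_parity_pow] coord_simps
      superpoly.scale_right_diff_distrib)

lemma coord_commutator_diff_ops_part:
  assumes "A \<in> diff_ops_part d e"
  shows "coord_commutator i A \<in> diff_ops_part d (e - 1)" "e = 0 \<Longrightarrow> coord_commutator i A = (\<lambda>p. 0)"
proof -
  have "coord_commutator i A \<in> diff_ops_part d (e - 1) \<and> (e = 0 \<longrightarrow> coord_commutator i A = (\<lambda>p. 0))"
    using assms
  proof (induction A rule: diff_ops_part_induct)
    case (base us vs)
    have "(\<lambda>p. foldr coord_mult us (B p)) \<in> diff_ops_part (length us) e'"
      if "B \<in> diff_ops_part 0 e'" for B :: "('a, 'b) superpoly \<Rightarrow> _" and e'
      using that by (induction us) (auto intro: diff_ops_part_mult)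
    then show ?case
      using base coord_commutator_foldr_deriv[where i = i and vs = vs]
      by (auto simp: coord_commutator_base linear_op_zero[OF linear_op_foldr_mult])
  qed (auto simp: coord_commutator_add coord_commutator_scl diff_ops_part_add diff_ops_part_scl)
  then show "coord_commutator i A \<in> diff_ops_part d (e - 1)" "e = 0 \<Longrightarrow> coord_commutator i A = (\<lambda>p. 0)"
    by auto
qed

lemma diff_ops_part_low_degree:
  fixes A :: "('a::finite, 'b::{finite,linorder}) superpoly \<Rightarrow> ('a, 'b) superpoly"
  assumes "A \<in> diff_ops_part d e" "p \<in> homog_poly n" "n < e"
  shows "A p = 0"
  using assms(1)
proof (induction A rule: diff_ops_part_induct)
  case (base us vs)
  have "foldr coord_deriv ws q = 0" if "q \<in> homog_poly n" "n < length ws" for ws n and q :: "('a, 'b) superpoly"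
  proof -
    have "(length ws \<le> n \<longrightarrow> foldr coord_deriv ws q \<in> homog_poly (n - length ws))
        \<and> (n < length ws \<longrightarrow> foldr coord_deriv ws q = 0)"
    proof (induction ws)
      case (Cons w ws)
      consider "length (w # ws) \<le> n" | "n = length ws" | "n < length ws" by fastforce
      then show ?case
      proof cases
        case 1
        then have "foldr coord_deriv ws q \<in> homog_poly (Suc (n - length (w # ws)))"
          using Cons by (simp add: Suc_diff_Suc)
        then show ?thesis using 1 homog_poly_deriv by auto
      next
        case 2
        then show ?thesis using Cons homog_poly_deriv_0 by auto
      qed (use Cons in auto)
    qed (use that in simp)
    then show ?thesis using that by blast
  qed
  then show ?case using base assms by (simp add: linear_op_zero[OF linear_op_foldr_mult])
qed (simp_all)

text \<open>Such an A moves past coordinates up to parity. In degree n > 0, n q = E q is the sum of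
  the x_i \<partial>_i q, and A sends each of these to x_i times a value of A in degree n - 1, again
  up to parity.\<close>

lemma coord_commutators_zero_imp_zero:
  fixes A :: "('a::finite, 'b::{finite,linorder}) superpoly \<Rightarrow> ('a, 'b) superpoly"
  assumes A: "linear_op A" and comm: "\<And>i. coord_commutator i A = (\<lambda>p. 0)"
    and const: "\<And>q. q \<in> homog_poly 0 \<Longrightarrow> A q = 0"
  shows "A = (\<lambda>p. 0)"
proof (rule linear_op_eq_homog[OF A linear_op_const0])
  fix n and q :: "('a, 'b) superpoly"
  assume "q \<in> homog_poly n"
  then show "A q = 0"
  proof (induction n arbitrary: q)
    case (Suc n)
    have "A (coord_mult i (coord_deriv i q)) = 0" for i
    proof -
      let ?Pi = "parity_involution ^^ parity_index i :: ('a, 'b) superpoly \<Rightarrow> _"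
      have "coord_deriv i q \<in> homog_poly n" using Suc.prems by (rule homog_poly_deriv)
      then have "?Pi (coord_deriv i q) \<in> homog_poly n"
        using parity_index_cases[of i] by (auto simp: parity_pow homog_poly_parity)
      then have "A (?Pi (coord_deriv i q)) = 0" by (rule Suc.IH)
      then show ?thesis
        using fun_cong[OF comm[of i], of "coord_deriv i q"]
        by (simp add: coord_commutator_def linear_op_zero[OF linear_op_parity_pow])
    qed
    then have "A (euler q) = 0" by (simp add: euler_def linear_op_sum[OF A])
    then have "scl (of_nat (Suc n)) (A q) = 0"
      using Suc.prems unfolding homog_poly_iff_euler by (simp add: linear_op_scl[OF A])
    then show ?case by (simp del: of_nat_Suc)
  qed (rule const)
qed

text \<open>Supercommutators with coordinates lower the order, and induction applies to them: on
  degree e - 1 the term A(x_i p) is 0 by assumption and the other one because the order of A exceeds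
  the degree. This makes the normally ordered extension of an endomorphism of P^d(V) unique.\<close>

lemma diff_ops_part_eq_zero:
  fixes A :: "('a::finite, 'b::{finite,linorder}) superpoly \<Rightarrow> ('a, 'b) superpoly"
  assumes "A \<in> diff_ops_part d e" "\<And>p. p \<in> homog_poly e \<Longrightarrow> A p = 0"
  shows "A = (\<lambda>p. 0)"
  using assms
proof (induction e arbitrary: A)
  case (0 A)
  show ?case
    by (rule coord_commutators_zero_imp_zero[OF linear_op_diff_ops_part[OF 0(1)]
          coord_commutator_diff_ops_part(2)[OF 0(1)] 0(2)]) simp
next
  case (Suc e A)
  have comm: "coord_commutator i A = (\<lambda>p. 0)" for i
  proof (rule Suc.IH)
    show "coord_commutator i A \<in> diff_ops_part d e"
      using coord_commutator_diff_ops_part(1)[OF Suc.prems(1), of i] by simp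
    fix p :: "('a, 'b) superpoly" assume p: "p \<in> homog_poly e"
    let ?Pi = "parity_involution ^^ parity_index i :: ('a, 'b) superpoly \<Rightarrow> _"
    have "?Pi p \<in> homog_poly e"
      using p parity_index_cases[of i] by (auto simp: parity_pow homog_poly_parity)
    then have "A (?Pi p) = 0" using diff_ops_part_low_degree[OF Suc.prems(1)] by simp
    moreover have "A (coord_mult i p) = 0" using p by (intro Suc.prems(2) homog_poly_mult)
    ultimately show "coord_commutator i A p = 0"
      by (simp add: coord_commutator_def linear_op_zero[OF linear_op_parity_pow])
  qed
  have const: "A q = 0" if "q \<in> homog_poly 0" for q
    using diff_ops_part_low_degree[OF Suc.prems(1) that] by simp
  show ?case
    by (rule coord_commutators_zero_imp_zero[OF linear_op_diff_ops_part[OF Suc.prems(1)] comm const])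
qed


section \<open>Polynomials in an operator\<close>

definition poly_op :: "(('u \<Rightarrow>\<^sub>0 complex) \<Rightarrow> ('u \<Rightarrow>\<^sub>0 complex)) \<Rightarrow> complex poly \<Rightarrow> ('u \<Rightarrow>\<^sub>0 complex) \<Rightarrow> ('u \<Rightarrow>\<^sub>0 complex)" where
  "poly_op A f p = (\<Sum>i\<le>degree f. scl (coeff f i) ((A ^^ i) p))"

lemma poly_op_eq_sum: "degree f \<le> n \<Longrightarrow> poly_op A f p = (\<Sum>i\<le>n. scl (coeff f i) ((A ^^ i) p))"
  unfolding poly_op_def by (rule sum.mono_neutral_left) (auto simp: coeff_eq_0)

lemma poly_op_0 [simp]: "poly_op A 0 p = 0"
  by (simp add: poly_op_def)

lemma poly_op_add: "poly_op A (f + g) p = poly_op A f p + poly_op A g p"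
  using poly_op_eq_sum[of "f + g" "max (degree f) (degree g)" A p]
    poly_op_eq_sum[of f "max (degree f) (degree g)" A p]
    poly_op_eq_sum[of g "max (degree f) (degree g)" A p]
  by (simp add: degree_add_le superpoly.scale_left_distrib sum.distrib)

lemma poly_op_smult: "poly_op A (smult c f) p = scl c (poly_op A f p)"
  using poly_op_eq_sum[of "smult c f" "degree f" A p]
  by (simp add: degree_smult_le poly_op_def superpoly.scale_sum_right)

lemma poly_op_sum: "poly_op A (\<Sum>i\<in>I. f i) p = (\<Sum>i\<in>I. poly_op A (f i) p)"
  by (induction I rule: infinite_finite_induct) (simp_all add: poly_op_add)

lemma linear_op_poly_op: "linear_op A \<Longrightarrow> linear_op (poly_op A f)"
  unfolding poly_op_def[abs_def] by (intro linear_op_intros)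

lemma poly_op_commute:
  assumes "linear_op B" "\<And>p. p \<in> U \<Longrightarrow> A p \<in> U" "\<And>p. p \<in> U \<Longrightarrow> B (A p) = A (B p)" "p \<in> U"
  shows "B (poly_op A f p) = poly_op A f (B p)"
proof -
  have "(A ^^ i) p \<in> U \<and> B ((A ^^ i) p) = (A ^^ i) (B p)" for i
    by (induction i) (use assms in auto)
  then show ?thesis by (simp add: poly_op_def linear_op_simps[OF assms(1)])
qed

text \<open>The basic identity is division with remainder, f = (x - t)q + f(t); each further power
  is obtained by multiplying with it.\<close>

lemma bezout_linear_factor_power:
  fixes f :: "complex poly"
  assumes "poly f t \<noteq> 0"
  shows "\<exists>a b. a * [:- t, 1:] ^ n + b * f = 1"
proof (induction n)
  case 0
  show ?case by (rule exI[of _ 1], rule exI[of _ 0]) simp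
next
  case (Suc n)
  then obtain a b where ab: "a * [:- t, 1:] ^ n + b * f = 1" by blast
  define a' where "a' = smult (- 1 / poly f t) (synthetic_div f t)"
  define b' where "b' = [:1 / poly f t:]"
  have "[:- t, 1:] * synthetic_div f t + [:poly f t:] = f"
    by (rule synthetic_div_correct')
  then have "f - [:- t, 1:] * synthetic_div f t = [:poly f t:]" by (metis add_diff_cancel_left')
  then have "smult (1 / poly f t) (f - [:- t, 1:] * synthetic_div f t) = 1"
    using assms by (simp add: one_pCons)
  then have "a' * [:- t, 1:] + b' * f = 1"
    by (simp add: a'_def b'_def smult_diff_right mult.commute del: mult_pCons_left mult_pCons_right)
      (simp add: algebra_simps)
  then have "(a * [:- t, 1:] ^ n + b * f) * (a' * [:- t, 1:] + b' * f) = 1" by (simp only: ab mult_1)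
  then have "(a * a') * [:- t, 1:] ^ Suc n + (b * a' * [:- t, 1:] + b * f * b' + a * [:- t, 1:] ^ n * b') * f = 1"
    by (simp only: power_Suc ring_distribs mult_ac add_ac)
  then show ?case by blast
qed

context
  fixes A :: "('u \<Rightarrow>\<^sub>0 complex) \<Rightarrow> ('u \<Rightarrow>\<^sub>0 complex)"
  assumes A: "linear_op A"
begin

lemma poly_op_pCons: "poly_op A (pCons c f) p = scl c p + A (poly_op A f p)"
proof -
  have "poly_op A (pCons c f) p = (\<Sum>i\<le>Suc (degree f). scl (coeff (pCons c f) i) ((A ^^ i) p))"
    by (rule poly_op_eq_sum) (rule degree_pCons_le)
  also have "\<dots> = scl c p + (\<Sum>i\<le>degree f. scl (coeff f i) (A ((A ^^ i) p)))"
    by (subst sum.atMost_Suc_shift) simp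
  finally show ?thesis by (simp add: poly_op_def linear_op_simps[OF A])
qed

lemma poly_op_1 [simp]: "poly_op A 1 p = p"
  by (simp add: poly_op_def)

lemma poly_op_mult: "poly_op A (f * g) p = poly_op A f (poly_op A g p)"
  by (induction f) (simp_all add: poly_op_pCons poly_op_add poly_op_smult)

lemma poly_op_linear_factor: "poly_op A [:- t, 1:] p = A p - scl t p"
  by (simp add: poly_op_pCons linear_op_simps[OF A])

lemma poly_op_linear_factor_power: "poly_op A ([:- t, 1:] ^ r) p = ((\<lambda>q. A q - scl t q) ^^ r) p"
  by (induction r) (simp_all add: poly_op_mult poly_op_linear_factor del: mult_pCons_left mult_pCons_right)

lemma poly_op_zero_arg: "poly_op A f 0 = 0"
  by (rule linear_op_zero[OF linear_op_poly_op[OF A]])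

lemma poly_op_dvd: "f dvd g \<Longrightarrow> poly_op A f p = 0 \<Longrightarrow> poly_op A g p = 0"
  by (auto elim!: dvdE simp: poly_op_mult mult.commute[of f] poly_op_zero_arg)

text \<open>Multiplying the Bezout identity by \<open>h\<close> cancels, from an annihilator of p, a
  factor \<open>g\<close> coprime to another annihilator \<open>f\<close>.\<close>

lemma poly_op_bezout:
  assumes "a * f + b * g = 1" "poly_op A f p = 0" "poly_op A (g * h) p = 0"
  shows "poly_op A h p = 0"
proof -
  have "h = (h * a) * f + b * (g * h)"
    using arg_cong[OF assms(1), of "(*) h"] by (simp add: algebra_simps)
  then have "poly_op A h p = poly_op A (h * a) (poly_op A f p) + poly_op A b (poly_op A (g * h) p)"
    by (metis poly_op_add poly_op_mult)
  then show ?thesis by (simp add: assms poly_op_zero_arg)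
qed

text \<open>Primary decomposition, phrased for an operator that has to vanish: the Bezout identity
  splits p into a part killed by the factor at t and a part killed by the others. Both stay in
  \<open>U\<close>, which will be the space of polynomials of one degree.\<close>

lemma poly_op_root_space_induct:
  assumes "finite S" "poly_op A (\<Prod>t\<in>S. [:- t, 1:] ^ n) p = 0" "linear_op B" "p \<in> U"
    and U: "\<And>f q. q \<in> U \<Longrightarrow> poly_op A f q \<in> U"
    and B: "\<And>t q. t \<in> S \<Longrightarrow> q \<in> U \<Longrightarrow> poly_op A ([:- t, 1:] ^ n) q = 0 \<Longrightarrow> B q = 0"
  shows "B p = 0"
  using assms(1,2,4) B
proof (induction S arbitrary: p rule: finite_induct)
  case empty
  then show ?case using linear_op_zero[OF assms(3)] by simp
next
  case (insert t S)
  let ?f = "[:- t, 1:] ^ n" and ?g = "\<Prod>t\<in>S. [:- t, 1:] ^ n"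
  have "poly ?g t \<noteq> 0" using insert.hyps by (auto simp: poly_prod)
  then obtain a b where ab: "a * ?f + b * ?g = 1"
    using bezout_linear_factor_power by blast
  have fg: "poly_op A (?f * ?g) p = 0" using insert by simp
  have 1: "B (poly_op A (a * ?f) p) = 0"
  proof (rule insert.IH)
    have "poly_op A ?g (poly_op A (a * ?f) p) = poly_op A a (poly_op A (?f * ?g) p)"
      by (simp only: poly_op_mult[symmetric] mult_ac)
    then show "poly_op A ?g (poly_op A (a * ?f) p) = 0" by (simp add: fg poly_op_zero_arg)
  qed (use insert U in auto)
  have 2: "B (poly_op A (b * ?g) p) = 0"
  proof (rule insert.prems(3))
    have "poly_op A ?f (poly_op A (b * ?g) p) = poly_op A b (poly_op A (?f * ?g) p)"
      by (simp only: poly_op_mult[symmetric] mult_ac)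
    then show "poly_op A ?f (poly_op A (b * ?g) p) = 0" by (simp add: fg poly_op_zero_arg)
  qed (use insert U in auto)
  have "B (poly_op A (a * ?f + b * ?g) p) = 0"
    by (simp only: poly_op_add linear_op_add[OF assms(3)] 1 2 add_0_left)
  then show ?case by (simp only: ab poly_op_1)
qed

text \<open>If c differed from F(t), then F - c and (x - t)^r would be coprime and both annihilate
  p.\<close>

lemma poly_op_eigenvalue_on_root_space:
  assumes "p \<noteq> 0" "poly_op A ([:- t, 1:] ^ r) p = 0" "poly_op A F p = scl c p"
  shows "c = poly F t"
proof (rule ccontr)
  assume "c \<noteq> poly F t"
  then have "poly (F - [:c:]) t \<noteq> 0" by simp
  then obtain a b where "a * [:- t, 1:] ^ r + b * (F - [:c:]) = 1" using bezout_linear_factor_power by blast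
  moreover have "poly_op A ((F - [:c:]) * 1) p = 0"
  proof -
    have "F - [:c:] = F + smult (- c) 1" by (simp add: one_pCons)
    then show ?thesis using assms(3) by (simp only: poly_op_add poly_op_smult mult_1_right poly_op_1) simp
  qed
  ultimately have "poly_op A 1 p = 0" using assms(2) poly_op_bezout by blast
  then show False using assms(1) by simp
qed

lemma poly_op_eigenvector:
  assumes "A p = scl t p"
  shows "poly_op A F p = scl (poly F t) p"
  by (induction F) (simp_all add: poly_op_pCons linear_op_simps[OF A] assms superpoly.scale_left_distrib mult_ac)

end

lemma falling_0 [simp]: "falling a 0 = 1"
  by (simp add: falling_def)

lemma falling_Suc: "falling a (Suc n) = falling a n * (a - of_nat n)"
  by (simp add: falling_def)

lemma falling_Suc_left: "falling a (Suc n) = a * falling (a - 1) n"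
  unfolding falling_def prod.lessThan_Suc_shift by (simp add: algebra_simps)

lemma falling_self: "falling (of_nat n) n = fact n"
proof (induction n)
  case (Suc n)
  then show ?case by (simp add: falling_Suc_left)
qed simp

section \<open>The Newton basis at the nodes \<tau>_s\<close>

context super_form_dim
begin

definition node :: "nat \<Rightarrow> nat \<Rightarrow> complex" where
  "node d s = of_nat s * (of_nat d - of_nat k - 1 - of_nat s)"

definition node_poly :: "nat \<Rightarrow> nat \<Rightarrow> complex poly" where
  "node_poly d a = (\<Prod>s<a. [:- node d s, 1:])"

lemma R2_pow_Lap_pow:
  assumes "p \<in> homog_poly d"
  shows "(R2 ^^ a) ((Lap ^^ a) p) = scl (4 ^ a) (poly_op Q (node_poly d a) p)"
proof (induction a)
  case 0
  then show ?case by (simp add: node_poly_def linear_op_Q)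
next
  case (Suc a)
  have "poly_op Q (node_poly d (Suc a)) p = poly_op Q ([:- node d a, 1:] * node_poly d a) p"
    by (simp add: node_poly_def mult.commute)
  also have "\<dots> = Q (poly_op Q (node_poly d a) p) - scl (node d a) (poly_op Q (node_poly d a) p)"
    by (simp only: poly_op_mult[OF linear_op_Q] poly_op_linear_factor[OF linear_op_Q])
  finally show ?case
    unfolding R2_pow_Lap_pow_Suc[OF assms] Suc.IH
    by (simp add: node_def linear_op_simps[OF linear_op_Q] superpoly.scale_right_diff_distrib mult_ac)
qed

lemma homog_poly_poly_op_Q: "p \<in> homog_poly d \<Longrightarrow> poly_op Q f p \<in> homog_poly d"
proof -
  assume "p \<in> homog_poly d"
  then have "(Q ^^ i) p \<in> homog_poly d" for i by (induction i) (auto intro: homog_poly_Q)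
  then show ?thesis unfolding poly_op_def by (intro homog_poly_sum homog_poly_scl)
qed

text \<open>Here \<Delta>^a p = 0 for reasons of degree; so Q satisfies a polynomial equation in
  each degree, with the nodes as roots.\<close>

lemma node_poly_annihilates: "p \<in> homog_poly d \<Longrightarrow> d < 2 * a \<Longrightarrow> poly_op Q (node_poly d a) p = 0"
  using R2_pow_Lap_pow[of p d a] Lap_pow_low_degree[of p d a]
  by (simp add: linear_op_zero linear_op_funpow linear_op_R2)

end

context osp_form
begin

text \<open>In degree d = l1 + l2 the Casimir formula gives C - c_\<lambda> = -4(Q - t) with t =
  l2(l1 - k - 1), which is \<open>node d l2\<close>; the r-th powers differ by the unit
  (-4)^r.\<close>

lemma V_module_iff:
  "p \<in> V_module k \<omega> (l1, l2) \<longleftrightarrow> p \<in> homog_poly (l1 + l2) \<and>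
     (\<exists>r. poly_op Q ([:- (of_nat l2 * (of_nat l1 - of_nat k - 1)), 1:] ^ r) p = 0)"
proof -
  define t :: complex where "t = of_nat l2 * (of_nat l1 - of_nat k - 1)"
  have "((\<lambda>q. casimir k \<omega> q - scl (casimir_value k (l1, l2)) q) ^^ r) p
      = scl ((-4) ^ r) (((\<lambda>q. Q q - scl t q) ^^ r) p)" if p: "p \<in> homog_poly (l1 + l2)" for r
  proof (induction r)
    case (Suc r)
    have "((\<lambda>q. Q q - scl t q) ^^ r) p \<in> homog_poly (l1 + l2)"
      using p by (induction r) (auto intro: homog_poly_diff homog_poly_Q homog_poly_scl)
    then have h: "((\<lambda>q. casimir k \<omega> q - scl (casimir_value k (l1, l2)) q) ^^ r) p \<in> homog_poly (l1 + l2)"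
      unfolding Suc.IH by (rule homog_poly_scl)
    have "casimir k \<omega> q - scl (casimir_value k (l1, l2)) q = scl (-4) (Q q - scl t q)"
      if "q \<in> homog_poly (l1 + l2)" for q
    proof -
      have "of_nat (l1 + l2) * (of_nat (l1 + l2) - 2 * of_nat k - 2) - casimir_value k (l1, l2) = 4 * t"
        by (simp add: casimir_value_def t_def algebra_simps)
      then have "scl (of_nat (l1 + l2) * (of_nat (l1 + l2) - 2 * of_nat k - 2)) q
          - scl (casimir_value k (l1, l2)) q = scl (4 * t) q"
        by (simp only: superpoly.scale_left_diff_distrib[symmetric])
      then show ?thesis
        unfolding casimir_homog[OF that]
        by (simp add: superpoly.scale_right_diff_distrib superpoly.scale_minus_left algebra_simps)
    qed
    from this[OF h] have "((\<lambda>q. casimir k \<omega> q - scl (casimir_value k (l1, l2)) q) ^^ Suc r) p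
        = scl (-4) (Q (scl ((-4) ^ r) (((\<lambda>q. Q q - scl t q) ^^ r) p))
          - scl t (scl ((-4) ^ r) (((\<lambda>q. Q q - scl t q) ^^ r) p)))"
      unfolding funpow.simps o_apply Suc.IH .
    then show ?case
      by (simp add: linear_op_simps[OF linear_op_Q] superpoly.scale_right_diff_distrib mult_ac)
  qed simp
  note iterate = this
  have "scl ((-4) ^ r) q = 0 \<longleftrightarrow> q = 0" for r and q :: "('a, 'b) superpoly"
    by simp
  with iterate have "((\<lambda>q. casimir k \<omega> q - scl (casimir_value k (l1, l2)) q) ^^ r) p = 0
      \<longleftrightarrow> ((\<lambda>q. Q q - scl t q) ^^ r) p = 0" if "p \<in> homog_poly (l1 + l2)" for r
    using that by (simp only:)
  then show ?thesis
    unfolding V_module_def psize_def t_def[symmetric] poly_op_linear_factor_power[OF linear_op_Q]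
      mem_Collect_eq case_prod_conv by blast
qed

end


section \<open>Eigenvectors\<close>

text \<open>The one-dimensional target is written as a space of superpolynomials so that linearity is covered
  by \<open>linear_op\<close>.\<close>

definition even_eval :: "('a::finite \<Rightarrow> complex) \<Rightarrow> ('a, 'b) superpoly \<Rightarrow> (unit \<Rightarrow>\<^sub>0 complex)" where
  "even_eval v = lin_ext (\<lambda>(\<alpha>, S). if S = {} then Poly_Mapping.single () (\<Prod>i\<in>UNIV. v i ^ \<alpha> i) else 0)"

lemma linear_op_even_eval: "linear_op (even_eval v)"
  by (simp add: even_eval_def)

lemma linear_op_even_eval_comp: "linear_op A \<Longrightarrow> linear_op (\<lambda>p. even_eval v (A p))"
  by (auto intro: linear_op_comp linear_op_even_eval)

lemma even_eval_single:
  "even_eval v (Poly_Mapping.single (\<alpha>, S) c)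
     = (if S = {} then Poly_Mapping.single () (c * (\<Prod>i\<in>UNIV. v i ^ \<alpha> i)) else 0)"
  by (simp add: even_eval_def)

lemma even_eval_mult:
  fixes p :: "('a::finite, 'b::{finite,linorder}) superpoly"
  shows "even_eval v (coord_mult (Inl i) p) = scl (v i) (even_eval v p)"
    and "even_eval v (coord_mult (Inr j) p) = 0"
proof -
  have "(\<lambda>p. even_eval v (coord_mult (Inl i) p)) = (\<lambda>p :: ('a, 'b) superpoly. scl (v i) (even_eval v p))"
  proof (rule linear_op_ext, goal_cases)
    case (3 u)
    obtain \<alpha> S where u: "u = (\<alpha>, S)" by (cases u)
    have "(\<Prod>j\<in>UNIV. v j ^ (\<alpha>(i := \<alpha> i + 1)) j) = (\<Prod>j\<in>UNIV. (if j = i then v i else 1) * v j ^ \<alpha> j)"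
      by (intro prod.cong refl) auto
    then have "(\<Prod>j\<in>UNIV. v j ^ (\<alpha>(i := \<alpha> i + 1)) j) = v i * (\<Prod>j\<in>UNIV. v j ^ \<alpha> j)"
      by (simp add: prod.distrib)
    then show ?case by (simp add: u even_eval_single)
  qed (intro linear_op_intros' linear_op_even_eval_comp)+
  then show "even_eval v (coord_mult (Inl i) p) = scl (v i) (even_eval v p)" by (rule fun_cong)
  have "(\<lambda>p. even_eval v (coord_mult (Inr j) p)) = (\<lambda>p :: ('a, 'b) superpoly. 0)"
  proof (rule linear_op_ext, goal_cases)
    case (3 u)
    then show ?case by (cases u) (auto simp: even_eval_single linear_op_zero[OF linear_op_even_eval])
  qed (intro linear_op_intros' linear_op_even_eval_comp)+
  then show "even_eval v (coord_mult (Inr j) p) = 0" by (rule fun_cong)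
qed

lemma sum_UNIV_sum_type: "(\<Sum>x\<in>UNIV. f x) = (\<Sum>i\<in>UNIV. f (Inl i)) + (\<Sum>j\<in>UNIV. f (Inr j))"
  for f :: "'a::finite + 'b::finite \<Rightarrow> 'c::comm_monoid_add"
  by (simp add: UNIV_Plus_UNIV[symmetric] sum.Plus del: UNIV_Plus_UNIV)

definition linear_form_mult :: "('a::finite \<Rightarrow> complex) \<Rightarrow> ('a, 'b::{finite,linorder}) superpoly \<Rightarrow> ('a, 'b) superpoly" where
  "linear_form_mult c p = (\<Sum>i\<in>UNIV. scl (c i) (coord_mult (Inl i) p))"

lemma linear_op_linear_form_mult: "linear_op (linear_form_mult c)"
  unfolding linear_form_mult_def[abs_def] by (intro linear_op_intros')

lemma homog_poly_linear_form_mult: "p \<in> homog_poly d \<Longrightarrow> linear_form_mult c p \<in> homog_poly (Suc d)"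
  unfolding linear_form_mult_def by (intro homog_poly_sum homog_poly_scl homog_poly_mult)

lemma even_eval_linear_form_mult:
  "even_eval v (linear_form_mult c p) = scl (\<Sum>i\<in>UNIV. c i * v i) (even_eval v p)"
  by (simp add: linear_form_mult_def linear_op_simps[OF linear_op_even_eval] even_eval_mult
      superpoly.scale_sum_left)

abbreviation one_poly :: "('a::finite, 'b::{finite,linorder}) superpoly" where
  "one_poly \<equiv> Poly_Mapping.single (\<lambda>_. 0, {}) 1"

lemma homog_poly_one: "one_poly \<in> homog_poly 0"
  using homog_poly_single[of "(\<lambda>_. 0, {})" 1] by (simp add: mono_degree_def)

context super_form
begin

text \<open>At an even point v the quadratic form becomes the number \<omega>(v, v); this is how R^s
  h is shown to be nonzero.\<close>

lemma even_eval_R2: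
  "even_eval v (R2 p) = scl (\<Sum>i\<in>UNIV. \<Sum>j\<in>UNIV. g (Inl i) (Inl j) * v i * v j) (even_eval v p)"
proof -
  have "even_eval v (R2 p) = scl (\<Sum>i\<in>UNIV. \<Sum>j\<in>UNIV. g (Inl j) (Inl i) * (v j * v i)) (even_eval v p)"
    unfolding R2_def linear_op_simps[OF linear_op_even_eval] sum_UNIV_sum_type
    by (simp add: even_eval_mult superpoly.scale_sum_left mult_ac)
  then show ?thesis by (subst sum.swap) (simp add: mult_ac)
qed

text \<open>The derivation in the direction dual to the linear form c; up to the factor 2 it is the
  commutator of \<Delta> with multiplication by c.\<close>

definition dual_deriv :: "('a \<Rightarrow> complex) \<Rightarrow> ('a, 'b) superpoly \<Rightarrow> ('a, 'b) superpoly" where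
  "dual_deriv c p = (\<Sum>i\<in>UNIV. scl (c i) (\<Sum>l\<in>UNIV. scl (G l (Inl i)) (coord_deriv l p)))"

lemma Lap_linear_form_mult:
  "Lap (linear_form_mult c p) = linear_form_mult c (Lap p) + scl 2 (dual_deriv c p)"
  by (simp add: linear_form_mult_def dual_deriv_def linear_op_simps[OF linear_op_Lap] Lap_mult
      superpoly.scale_right_distrib superpoly.scale_sum_right sum.distrib mult_ac)

lemma dual_deriv_linear_form_mult:
  "dual_deriv c (linear_form_mult c p) = linear_form_mult c (dual_deriv c p)
     + scl (\<Sum>i\<in>UNIV. \<Sum>j\<in>UNIV. c i * c j * G (Inl j) (Inl i)) p"
proof -
  have d: "coord_deriv l (linear_form_mult c p)
      = linear_form_mult c (coord_deriv l p) + scl (\<Sum>j\<in>UNIV. c j * (if l = Inl j then 1 else 0)) p" for l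
  proof -
    have "scl (c j) (coord_deriv l (coord_mult (Inl j) p))
        = scl (c j * (if l = Inl j then 1 else 0)) p + scl (c j) (coord_mult (Inl j) (coord_deriv l p))" for j
      by (simp add: coord_deriv_mult superpoly.scale_right_distrib)
    then show ?thesis
      unfolding linear_form_mult_def linear_op_simps[OF linear_op_coord_deriv]
      by (simp only: sum.distrib superpoly.scale_sum_left add.commute)
  qed
  have delta: "(\<Sum>l\<in>UNIV. G l (Inl i) * (\<Sum>j\<in>UNIV. c j * (if l = Inl j then 1 else 0)))
      = (\<Sum>j\<in>UNIV. c j * G (Inl j) (Inl i))" for i
    unfolding sum_UNIV_sum_type by (simp add: if_distrib[of "(*) _"] mult.commute cong: if_cong)
  have "dual_deriv c (linear_form_mult c p) = linear_form_mult c (dual_deriv c p)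
     + (\<Sum>i\<in>UNIV. scl (c i) (scl (\<Sum>l\<in>UNIV. G l (Inl i) * (\<Sum>j\<in>UNIV. c j * (if l = Inl j then 1 else 0))) p))"
    unfolding dual_deriv_def d superpoly.scale_right_distrib sum.distrib
      linear_op_simps[OF linear_op_linear_form_mult] superpoly.scale_scale
    by (simp only: superpoly.scale_sum_left superpoly.scale_sum_right superpoly.scale_scale sum_distrib_left)
  then show ?thesis
    unfolding delta
    unfolding superpoly.scale_scale
    unfolding sum_distrib_left superpoly.scale_sum_left mult.assoc .
qed

text \<open>Moving \<Delta> through powers of c produces only the dual derivation of c, and this
  derivation kills powers of c because c is isotropic for the dual form.\<close>

lemma harmonic_power:
  assumes "(\<Sum>i\<in>UNIV. \<Sum>j\<in>UNIV. c i * c j * G (Inl j) (Inl i)) = 0"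
  shows "Lap ((linear_form_mult c ^^ n) one_poly) = 0"
proof -
  have d: "dual_deriv c ((linear_form_mult c ^^ n) one_poly) = 0" for n
  proof (induction n)
    case 0
    have "coord_deriv l one_poly = 0" for l :: "'a + 'b"
      by (rule homog_poly_deriv_0[OF homog_poly_one])
    then show ?case by (simp add: dual_deriv_def)
  next
    case (Suc n)
    then show ?case
      by (simp add: dual_deriv_linear_form_mult assms linear_op_zero[OF linear_op_linear_form_mult])
  qed
  show ?thesis
  proof (induction n)
    case 0
    show ?case using Lap_low_degree[OF homog_poly_one] by simp
  next
    case (Suc n)
    then show ?case
      by (simp add: Lap_linear_form_mult d linear_op_zero[OF linear_op_linear_form_mult])
  qed
qed

lemma even_block_inverse:
  "(\<Sum>j\<in>UNIV. g (Inl i) (Inl j) * G (Inl j) (Inl l)) = (if i = l then 1 else 0)"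
  "(\<Sum>j\<in>UNIV. G (Inl i) (Inl j) * g (Inl j) (Inl l)) = (if i = l then 1 else 0)"
  using gG[of "Inl i" "Inl l"] Gg[of "Inl i" "Inl l"]
  by (simp_all add: sum_UNIV_sum_type g_even G_even)

text \<open>Over the complex numbers a quadratic form in two variables has a nontrivial
  zero.\<close>

lemma ex_isotropic:
  assumes "CARD('a) \<ge> 2"
  obtains e where "e \<noteq> (\<lambda>_. 0)" "(\<Sum>i\<in>UNIV. \<Sum>j\<in>UNIV. g (Inl i) (Inl j) * e i * e j) = 0"
proof -
  have "\<not> CARD('a) \<le> Suc 0" using assms by simp
  then obtain x y :: 'a where xy: "x \<noteq> y"
    using card_le_Suc0_iff_eq[of "UNIV :: 'a set"] by auto
  let ?g = "\<lambda>i j. g (Inl i) (Inl j)"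
  \<comment> \<open>If \<omega>(e_y, e_y) = 0, then e_y itself is taken; otherwise e_x + t e_y with
    t a root of the resulting quadratic equation.\<close>
  define t where "t = (if ?g y y = 0 then 0 else (- ?g x y + csqrt (?g x y ^ 2 - ?g x x * ?g y y)) / ?g y y)"
  define s :: complex where "s = (if ?g y y = 0 then 0 else 1)"
  define u :: complex where "u = (if ?g y y = 0 then 1 else t)"
  define e where "e i = (if i = x then s else 0) + (if i = y then u else 0)" for i
  have "(\<Sum>j\<in>UNIV. ?g i j * e i * e j) = e i * (?g i x * s + ?g i y * u)" for i
    by (simp add: e_def distrib_left sum.distrib sum_distrib_left algebra_simps if_distrib[of "(*) _"] cong: if_cong)
  then have "(\<Sum>i\<in>UNIV. \<Sum>j\<in>UNIV. ?g i j * e i * e j)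
      = s * (?g x x * s + ?g x y * u) + u * (?g y x * s + ?g y y * u)"
    by (simp add: e_def distrib_right sum.distrib if_distrib[of "\<lambda>c. c * _"] cong: if_cong)
  also have "\<dots> = 0"
  proof (cases "?g y y = 0")
    case True
    then show ?thesis by (simp add: s_def u_def)
  next
    case False
    have "?g y x = ?g x y" using g_sym[of "Inl y" "Inl x"] by simp
    moreover have "?g y y * u = - ?g x y + csqrt (?g x y ^ 2 - ?g x x * ?g y y)"
      using False by (simp add: u_def t_def)
    then have "(?g y y * u + ?g x y) ^ 2 = ?g x y ^ 2 - ?g x x * ?g y y" by simp
    then have "?g y y * (?g x x + 2 * ?g x y * u + ?g y y * u ^ 2) = 0"
      by (simp add: power2_eq_square algebra_simps)
    then have "?g x x + 2 * ?g x y * u + ?g y y * u ^ 2 = 0" using False by simp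
    ultimately show ?thesis using False by (simp add: s_def power2_eq_square algebra_simps)
  qed
  finally have "(\<Sum>i\<in>UNIV. \<Sum>j\<in>UNIV. ?g i j * e i * e j) = 0" .
  moreover have "e x = 1 \<or> e y = 1" using xy by (auto simp: e_def s_def u_def)
  then have "e \<noteq> (\<lambda>_. 0)" by auto
  ultimately show thesis using that by blast
qed

end

context super_form_dim
begin

text \<open>The vector is R^s c^n with c an isotropic linear form: c^n is harmonic, so
  \<open>Lap_R2_pow\<close> gives the eigenvalue, and evaluation at a point with c(v) = \<omega>(v,
  v) = 1 shows that it is not 0. It ensures that \<open>eigenvalues_on\<close> is not empty on any
  of the modules.\<close>

lemma ex_Q_eigenvector:
  assumes "CARD('a) \<ge> 2"
  obtains p where "p \<noteq> 0" "p \<in> homog_poly (n + 2 * s)"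
    "Q p = scl (of_nat s * (of_nat (n + s) - of_nat k - 1)) p"
proof -
  let ?g = "\<lambda>i j. g (Inl i) (Inl j)" and ?G = "\<lambda>i j. G (Inl i) (Inl j)"
  obtain e where e: "e \<noteq> (\<lambda>_. 0)" "(\<Sum>i\<in>UNIV. \<Sum>j\<in>UNIV. ?g i j * e i * e j) = 0"
    using ex_isotropic[OF assms] by blast
  \<comment> \<open>The linear form that pairs with e; as e is isotropic for \<open>g\<close>, c is
    isotropic for \<open>G\<close>.\<close>
  define c where "c i = (\<Sum>j\<in>UNIV. ?g i j * e j)" for i
  have Gc: "(\<Sum>j\<in>UNIV. ?G i j * c j) = e i" for i
  proof -
    have "(\<Sum>j\<in>UNIV. ?G i j * c j) = (\<Sum>l\<in>UNIV. (\<Sum>j\<in>UNIV. ?G i j * ?g j l) * e l)"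
      unfolding c_def sum_distrib_left sum_distrib_right by (subst sum.swap) (simp add: mult.assoc)
    then show ?thesis by (simp only: even_block_inverse sum_delta_mult)
  qed
  have ce: "(\<Sum>i\<in>UNIV. c i * e i) = 0"
    using e(2) by (simp add: c_def sum_distrib_left sum_distrib_right mult_ac)
  have iso: "(\<Sum>i\<in>UNIV. \<Sum>j\<in>UNIV. c i * c j * G (Inl j) (Inl i)) = 0"
  proof -
    have "?G j i = ?G i j" for i j using G_sym[of "Inl j" "Inl i"] by simp
    then have "(\<Sum>j\<in>UNIV. c i * c j * G (Inl j) (Inl i)) = c i * (\<Sum>j\<in>UNIV. ?G i j * c j)" for i
      by (simp add: sum_distrib_left mult_ac)
    then show ?thesis by (simp only: Gc ce)
  qed
  obtain x where x: "c x \<noteq> 0"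
  proof (rule ccontr)
    assume "\<not> thesis"
    then have "c j = 0" for j using that by blast
    then have "e i = 0" for i using Gc[of i] by simp
    then show False using e(1) by auto
  qed
  \<comment> \<open>For v = e_x / c_x + t e one has c(v) = 1, since c(e) = 0, and \<omega>(v, v) =
    g_xx / c_x^2 + 2t; this t makes the latter equal to 1.\<close>
  define t where "t = (1 - ?g x x / c x ^ 2) / 2"
  define v where "v i = (if i = x then 1 / c x else 0) + t * e i" for i
  have cv: "(\<Sum>i\<in>UNIV. c i * v i) = 1"
  proof -
    have "(\<Sum>i\<in>UNIV. c i * v i) = (\<Sum>i\<in>UNIV. (if i = x then 1 else 0) * (c i / c x)) + t * (\<Sum>i\<in>UNIV. c i * e i)"
      by (simp add: v_def sum_distrib_left sum.distrib[symmetric] algebra_simps)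
        (intro sum.cong refl, auto)
    then show ?thesis using x by (simp only: ce sum_delta_mult) simp
  qed
  have gv: "(\<Sum>i\<in>UNIV. \<Sum>j\<in>UNIV. ?g i j * v i * v j) = 1"
  proof -
    have 1: "(\<Sum>j\<in>UNIV. ?g i j * v j) = ?g i x / c x + t * c i" for i
    proof -
      have "(\<Sum>j\<in>UNIV. ?g i j * v j) = (\<Sum>j\<in>UNIV. (if j = x then 1 else 0) * (?g i j / c x)) + t * (\<Sum>j\<in>UNIV. ?g i j * e j)"
        by (simp add: v_def sum_distrib_left sum.distrib[symmetric] algebra_simps)
          (intro sum.cong refl, auto)
      then show ?thesis by (simp only: c_def[symmetric] sum_delta_mult)
    qed
    have 2: "(\<Sum>i\<in>UNIV. ?g i x * v i) = ?g x x / c x + t * c x"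
    proof -
      have "?g i x = ?g x i" for i using g_sym[of "Inl i" "Inl x"] by simp
      then have "(\<Sum>i\<in>UNIV. ?g i x * v i) = (\<Sum>i\<in>UNIV. ?g x i * v i)"
        by (intro sum.cong refl arg_cong2[where f = "(*)"])
      then show ?thesis using 1[of x] by (rule trans)
    qed
    have "(\<Sum>i\<in>UNIV. \<Sum>j\<in>UNIV. ?g i j * v i * v j) = (\<Sum>i\<in>UNIV. v i * (\<Sum>j\<in>UNIV. ?g i j * v j))"
      by (simp add: sum_distrib_left mult_ac)
    also have "\<dots> = (\<Sum>i\<in>UNIV. ?g i x * v i / c x + t * (c i * v i))"
      unfolding 1 by (intro sum.cong refl) (simp add: algebra_simps)
    also have "\<dots> = (\<Sum>i\<in>UNIV. ?g i x * v i) / c x + t * (\<Sum>i\<in>UNIV. c i * v i)"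
      by (simp only: sum.distrib sum_divide_distrib sum_distrib_left)
    also have "\<dots> = 1"
      unfolding 2 cv t_def using x by (simp add: field_simps power2_eq_square)
    finally show ?thesis .
  qed
  define h where "h = (linear_form_mult c ^^ n) (one_poly :: ('a, 'b) superpoly)"
  have h: "h \<in> homog_poly n"
    unfolding h_def by (induction n) (simp_all add: homog_poly_one homog_poly_linear_form_mult)
  have Lh: "Lap h = 0" unfolding h_def by (rule harmonic_power[OF iso])
  have "even_eval v h = Poly_Mapping.single () 1"
    unfolding h_def by (induction n) (simp_all add: even_eval_linear_form_mult cv even_eval_single)
  then have "even_eval v ((R2 ^^ s) h) = Poly_Mapping.single () 1"
    by (induction s) (simp_all add: even_eval_R2 gv)
  then have nz: "(R2 ^^ s) h \<noteq> 0"
    using linear_op_zero[OF linear_op_even_eval, of v]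
    by (metis lookup_single_eq lookup_zero zero_neq_one)
  have "Q ((R2 ^^ s) h) = scl (of_nat s * (of_nat n - of_nat k + of_nat s - 1)) ((R2 ^^ s) h)"
    unfolding Q_def Lap_R2_pow[OF h] Lh
    by (cases s) (simp_all add: linear_op_simps[OF linear_op_R2] linear_op_zero[OF linear_op_funpow[OF linear_op_R2]])
  then show thesis
    using that[OF nz homog_poly_R2_pow[OF h]] by (simp add: algebra_simps)
qed

end


section \<open>Capelli operators and their eigenvalue polynomials\<close>

lemma symmetric_poly2_add: "symmetric_poly2 f \<Longrightarrow> symmetric_poly2 g \<Longrightarrow> symmetric_poly2 (f + g)"
  by (simp add: symmetric_poly2_def)

lemma symmetric_poly2_0: "symmetric_poly2 0"
  by (simp add: symmetric_poly2_def)

lemma symmetric_poly2_sum: "(\<And>i. i \<in> I \<Longrightarrow> symmetric_poly2 (f i)) \<Longrightarrow> symmetric_poly2 (\<Sum>i\<in>I. f i)"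
  by (induction I rule: infinite_finite_induct) (simp_all add: symmetric_poly2_add symmetric_poly2_0)

lemma coeff_coeff_mult:
  "coeff (coeff (f * g) i) j = (\<Sum>a\<le>i. \<Sum>b\<le>j. coeff (coeff f a) b * coeff (coeff g (i - a)) (j - b))"
  by (simp add: coeff_mult coeff_sum)

lemma symmetric_poly2_mult:
  assumes "symmetric_poly2 f" "symmetric_poly2 g"
  shows "symmetric_poly2 (f * g)"
  unfolding symmetric_poly2_def
proof (intro allI)
  fix i j
  have "coeff (coeff (f * g) i) j = (\<Sum>a\<le>i. \<Sum>b\<le>j. coeff (coeff f b) a * coeff (coeff g (j - b)) (i - a))"
    unfolding coeff_coeff_mult using assms unfolding symmetric_poly2_def
    by (intro sum.cong refl arg_cong2[where f = "(*)"]) blast+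
  also have "\<dots> = coeff (coeff (f * g) j) i"
    unfolding coeff_coeff_mult by (rule sum.swap)
  finally show "coeff (coeff (f * g) i) j = coeff (coeff (f * g) j) i" .
qed

lemma symmetric_poly2_smult: "symmetric_poly2 f \<Longrightarrow> symmetric_poly2 (smult [:c:] f)"
  by (simp add: symmetric_poly2_def)

lemma symmetric_poly2_prod: "(\<And>i. i \<in> I \<Longrightarrow> symmetric_poly2 (f i)) \<Longrightarrow> symmetric_poly2 (\<Prod>i\<in>I. f i)"
proof (induction I rule: infinite_finite_induct)
  case (insert x F)
  then show ?case by (simp add: symmetric_poly2_mult)
qed (auto simp: symmetric_poly2_def one_pCons coeff_pCons split: nat.splits)

abbreviation PX :: "complex poly poly" where "PX \<equiv> [:[:0, 1:]:]"
abbreviation PY :: "complex poly poly" where "PY \<equiv> [:0, 1:]"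

text \<open>These polynomials span the eigenvalue polynomials of the invariant operators of order \<open>d\<close>:
  they come from \<open>R\<^sup>a E(E-1)\<dots> \<Delta>\<^sup>a\<close>, where \<open>R\<close> is the quadratic form and \<open>E\<close> the Euler operator.\<close>

definition basis_poly :: "complex \<Rightarrow> nat \<Rightarrow> nat \<Rightarrow> complex poly poly" where
  "basis_poly \<kappa> d a = falling (PX + PY + [:[:\<kappa> + 1 - 2 * of_nat a:]:]) (d - 2 * a) * (falling PX a * falling PY a)"

lemma of_nat_poly2: "(of_nat s :: complex poly poly) = [:[:of_nat s:]:]"
  by (simp add: of_nat_poly)

lemma symmetric_poly2_basis_poly: "symmetric_poly2 (basis_poly \<kappa> d a)"
proof -
  have "symmetric_poly2 (PX + PY + [:[:c:]:])" for c
    by (auto simp: symmetric_poly2_def coeff_pCons split: nat.splits)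
  then have 1: "symmetric_poly2 (falling (PX + PY + [:[:c:]:]) n)" for c n
    unfolding falling_def of_nat_poly2 diff_conv_add_uminus
    by (intro symmetric_poly2_prod) (simp add: add.assoc)
  have "symmetric_poly2 ((PX - [:[:c:]:]) * (PY - [:[:c:]:]))" for c
    by (auto simp: symmetric_poly2_def coeff_pCons split: nat.splits)
  then have 2: "symmetric_poly2 (falling PX n * falling PY n)" for n
    unfolding falling_def of_nat_poly2 prod.distrib[symmetric] by (intro symmetric_poly2_prod)
  show ?thesis unfolding basis_poly_def by (intro symmetric_poly2_mult 1 2)
qed

lemma poly2_diff: "poly2 (f - g) x y = poly2 f x y - poly2 g x y"
  and poly2_mult: "poly2 (f * g) x y = poly2 f x y * poly2 g x y"
  and poly2_smult: "poly2 (smult [:c:] f) x y = c * poly2 f x y"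
  by (simp_all add: poly2_def)

lemma poly2_sum: "poly2 (\<Sum>i\<in>I. f i) x y = (\<Sum>i\<in>I. poly2 (f i) x y)"
  by (simp add: poly2_def poly_sum)

lemma poly2_falling: "poly2 (falling f n) x y = falling (poly2 f x y) n"
  by (simp add: falling_def poly2_def poly_prod of_nat_poly2)

lemma poly2_basis_poly:
  "poly2 (basis_poly \<kappa> d a) x y
     = falling (x + y + \<kappa> + 1 - 2 * of_nat a) (d - 2 * a) * (falling x a * falling y a)"
  unfolding basis_poly_def poly2_mult poly2_falling by (simp add: poly2_def algebra_simps)

text \<open>The regular partitions with l1 - l2 \<ge> 2k + 3 provide, for every l2, infinitely many
  values of the first variable; so f has infinitely many constants as roots.\<close>

lemma index_set_Zariski_dense:
  assumes "\<And>u. u \<in> index_set k \<Longrightarrow> poly2 f (of_nat (fst u) - of_nat k - 1) (of_nat (snd u)) = 0"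
  shows "f = 0"
proof (rule ccontr)
  assume "f \<noteq> 0"
  have "poly f [:of_nat y:] = 0" for y
  proof (rule ccontr)
    assume nz: "poly f [:of_nat y:] \<noteq> 0"
    have "(\<lambda>i. of_nat i - of_nat k - 1) ` {y + 2 * k + 3..} \<subseteq> {x. poly (poly f [:of_nat y:]) x = 0}"
    proof safe
      fix i assume "i \<ge> y + 2 * k + 3"
      then have "(i, y) \<in> index_set k" by (auto simp: index_set_def regular_def partitions2_def)
      from assms[OF this] show "poly (poly f [:of_nat y:]) (of_nat i - of_nat k - 1) = 0"
        by (simp add: poly2_def)
    qed
    moreover have "infinite ((\<lambda>i. of_nat i - of_nat k - 1 :: complex) ` {y + 2 * k + 3..})"
      by (subst finite_image_iff) (auto simp: inj_on_def infinite_Ici)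
    ultimately show False using poly_roots_finite[OF nz] finite_subset by blast
  qed
  then have "range (\<lambda>y :: nat. [:of_nat y :: complex:]) \<subseteq> {q. poly f q = 0}" by auto
  moreover have "infinite (range (\<lambda>y :: nat. [:of_nat y :: complex:]))"
    by (rule range_inj_infinite) (auto simp: inj_on_def)
  ultimately show False using poly_roots_finite[OF \<open>f \<noteq> 0\<close>] finite_subset by blast
qed

text \<open>The normally ordered form of the falling factorial of E of length b. It pads R^a
  \<Delta>^a to bidegree (d, d), which an operator of order d must have, at the cost of a factorial
  in degree d.\<close>

primrec normal_euler :: "nat \<Rightarrow> ('a::finite, 'b::{finite,linorder}) superpoly \<Rightarrow> ('a, 'b) superpoly" where
  "normal_euler 0 p = p"
| "normal_euler (Suc b) p = (\<Sum>i\<in>UNIV. coord_mult i (normal_euler b (coord_deriv i p)))"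

lemma normal_euler_diff_ops_part: "normal_euler b \<in> diff_ops_part b b"
proof (induction b)
  case 0
  then show ?case using diff_ops_part_id by (simp add: fun_eq_iff[symmetric])
next
  case (Suc b)
  show ?case unfolding normal_euler.simps[abs_def]
    by (intro diff_ops_part_sum diff_ops_part_mult diff_ops_part_deriv_right Suc)
qed

lemma linear_op_normal_euler: "linear_op (normal_euler b)"
  by (rule linear_op_diff_ops_part[OF normal_euler_diff_ops_part])

lemma normal_euler_homog:
  "p \<in> homog_poly d \<Longrightarrow> normal_euler b p = scl (falling (of_nat d) b) p"
proof (induction b arbitrary: d p)
  case (Suc b)
  show ?case
  proof (cases d)
    case 0
    then show ?thesis using Suc.prems homog_poly_deriv_0[of p]
      by (simp add: linear_op_zero[OF linear_op_normal_euler] falling_Suc_left)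
  next
    case (Suc d')
    have "normal_euler b (coord_deriv i p) = scl (falling (of_nat d') b) (coord_deriv i p)" for i
      using Suc.IH homog_poly_deriv Suc.prems \<open>d = Suc d'\<close> by blast
    then have "normal_euler (Suc b) p = scl (falling (of_nat d') b) (euler p)"
      by (simp add: coord_simps euler_def superpoly.scale_sum_right)
    also have "euler p = scl (of_nat d) p" using Suc.prems by (simp add: homog_poly_iff_euler)
    finally show ?thesis using \<open>d = Suc d'\<close> by (simp add: falling_Suc_left mult.commute)
  qed
qed simp

context super_form_dim
begin

lemma Lap_pow_diff_ops_part: "A \<in> diff_ops_part d e \<Longrightarrow> (\<lambda>p. A ((Lap ^^ a) p)) \<in> diff_ops_part d (e + 2 * a)"
proof (induction a arbitrary: A e)
  case (Suc a)
  have "(\<lambda>p. A (Lap p)) = (\<lambda>p. \<Sum>i\<in>UNIV. \<Sum>j\<in>UNIV. scl (G i j) (A (coord_deriv i (coord_deriv j p))))"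
    by (simp add: Lap_def linear_op_simps[OF linear_op_diff_ops_part[OF Suc.prems]])
  also have "\<dots> \<in> diff_ops_part d (Suc (Suc e))"
    by (intro diff_ops_part_sum diff_ops_part_scl diff_ops_part_deriv_right Suc)
  finally have "(\<lambda>p. A (Lap ((Lap ^^ a) p))) \<in> diff_ops_part d (Suc (Suc e) + 2 * a)" by (rule Suc.IH)
  then show ?case by simp
qed simp

lemma R2_pow_diff_ops_part: "A \<in> diff_ops_part d e \<Longrightarrow> (\<lambda>p. (R2 ^^ a) (A p)) \<in> diff_ops_part (d + 2 * a) e"
proof (induction a)
  case (Suc a)
  have "(\<lambda>p. R2 ((R2 ^^ a) (A p))) \<in> diff_ops_part (Suc (Suc (d + 2 * a))) e"
    unfolding R2_def[of "(R2 ^^ a) _"] by (intro diff_ops_part_sum diff_ops_part_scl diff_ops_part_mult Suc)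
  then show ?case by simp
qed simp

text \<open>Every summand has bidegree (d, d). The powers of 4 cancel those in
  \<open>R2_pow_Lap_pow\<close>, so that in degree d the \<open>C a\<close> are Newton coefficients
  up to the factorials from the Euler factors.\<close>

definition capelli_op :: "nat \<Rightarrow> (nat \<Rightarrow> complex) \<Rightarrow> ('a, 'b) superpoly \<Rightarrow> ('a, 'b) superpoly" where
  "capelli_op d C p = (\<Sum>a\<le>d div 2. scl (C a / 4 ^ a) ((R2 ^^ a) (normal_euler (d - 2 * a) ((Lap ^^ a) p))))"

definition eigen_poly :: "nat \<Rightarrow> (nat \<Rightarrow> complex) \<Rightarrow> nat \<Rightarrow> complex poly" where
  "eigen_poly d C e = (\<Sum>a\<le>d div 2. smult (C a * falling (of_nat e - 2 * of_nat a) (d - 2 * a)) (node_poly e a))"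

lemma capelli_op_diff_ops_part: "capelli_op d C \<in> diff_ops_part d d"
proof -
  have "(\<lambda>p. (R2 ^^ a) (normal_euler (d - 2 * a) ((Lap ^^ a) p))) \<in> diff_ops_part d d"
    if "a \<in> {..d div 2}" for a
    using R2_pow_diff_ops_part[OF Lap_pow_diff_ops_part[OF normal_euler_diff_ops_part[of "d - 2 * a"]], of a a] that
    by simp
  then show ?thesis unfolding capelli_op_def[abs_def] by (intro diff_ops_part_sum diff_ops_part_scl)
qed

lemma linear_op_capelli_op: "linear_op (capelli_op d C)"
  by (rule linear_op_diff_ops_part[OF capelli_op_diff_ops_part])

lemma capelli_op_homog:
  assumes "p \<in> homog_poly e"
  shows "capelli_op d C p = poly_op Q (eigen_poly d C e) p"
proof -
  have "(R2 ^^ a) (normal_euler b ((Lap ^^ a) p))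
      = scl (falling (of_nat e - 2 * of_nat a) b * 4 ^ a) (poly_op Q (node_poly e a) p)" for a b
  proof (cases "2 * a \<le> e")
    case True
    then have "(Lap ^^ a) p \<in> homog_poly (e - 2 * a)"
      using assms by (intro homog_poly_Lap_pow) simp
    from normal_euler_homog[OF this] show ?thesis
      using R2_pow_Lap_pow[OF assms] True
      by (simp add: linear_op_simps[OF linear_op_funpow[OF linear_op_R2]] of_nat_diff)
  next
    \<comment> \<open>For 2a > e both sides vanish, the right one because the node polynomial
      annihilates degree e; the falling factorial need not be 0 there.\<close>
    case False
    then show ?thesis
      using Lap_pow_low_degree[OF assms, of a] node_poly_annihilates[OF assms, of a]
      by (simp add: linear_op_zero[OF linear_op_funpow[OF linear_op_R2]] linear_op_zero[OF linear_op_normal_euler])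
  qed
  then show ?thesis by (simp add: capelli_op_def eigen_poly_def poly_op_sum poly_op_smult)
qed

text \<open>A degree-preserving operator that commutes with R and \<Delta> commutes with Q and hence
  with polynomials in Q. It is applied to the action of \<open>osp\<close> and to the parity
  involution.\<close>

lemma capelli_op_commute:
  assumes B: "linear_op B" and "\<And>d p. p \<in> homog_poly d \<Longrightarrow> B p \<in> homog_poly d"
    and "\<And>p. B (R2 p) = R2 (B p)" "\<And>p. B (Lap p) = Lap (B p)"
  shows "B (capelli_op d C p) = capelli_op d C (B p)"
proof -
  have BQ: "B (Q p) = Q (B p)" for p
    by (simp add: Q_def linear_op_simps[OF B] assms)
  have "(\<lambda>p. B (capelli_op d C p)) = (\<lambda>p. capelli_op d C (B p))"
  proof (rule linear_op_eq_homog)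
    fix e and q :: "('a, 'b) superpoly"
    assume q: "q \<in> homog_poly e"
    have "B (poly_op Q (eigen_poly d C e) q) = poly_op Q (eigen_poly d C e) (B q)"
      by (rule poly_op_commute[OF B, of UNIV]) (simp_all add: BQ)
    then show "B (capelli_op d C q) = capelli_op d C (B q)"
      using capelli_op_homog[OF q] capelli_op_homog[OF assms(2)[OF q]] by simp
  qed (rule linear_op_comp[OF B linear_op_capelli_op] linear_op_comp[OF linear_op_capelli_op B])+
  then show ?thesis by (rule fun_cong)
qed

text \<open>With \<tau>_(l2) the value at s = l2, \<tau>_(l2) - \<tau>_s = (l1 - k - 1 - s)(l2 - s)
  in degree l1 + l2. This factorization is why eigenvalues are symmetric polynomials in the shifted
  coordinates l1 - k - 1 and l2.\<close>

lemma poly_node_poly: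
  assumes "e = l1 + l2"
  shows "poly (node_poly e a) (of_nat l2 * (of_nat l1 - of_nat k - 1))
     = falling (of_nat l1 - of_nat k - 1) a * falling (of_nat l2) a"
  unfolding node_poly_def poly_prod falling_def prod.distrib[symmetric]
  by (intro prod.cong refl) (simp add: node_def assms algebra_simps)

lemma poly_eigen_poly:
  "poly (eigen_poly d C (l1 + l2)) (of_nat l2 * (of_nat l1 - of_nat k - 1))
     = poly2 (\<Sum>a\<le>d div 2. smult [:C a:] (basis_poly (of_nat k) d a)) (of_nat l1 - of_nat k - 1) (of_nat l2)"
  unfolding eigen_poly_def poly_sum poly_smult poly_node_poly[OF refl] poly2_sum poly2_smult poly2_basis_poly
  by (intro sum.cong refl) (simp add: mult.assoc)

end

context osp_form
begin

text \<open>Minus the identity on V is the identity on linear forms, and its extension by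
  derivations is E.\<close>

lemma act_minus_identity: "act (mat (-1)) p = euler p"
  for p :: "('a, 'b) superpoly"
proof -
  have "scl (act_sign i j * mat (-1) $ i $ j) (coord_mult j (coord_deriv i p))
      = - (if i = j then coord_mult j (coord_deriv i p) else 0)" for i j :: "'a + 'b"
    using parity_index_cases[of i] by (auto simp: mat_def)
  then show ?thesis by (simp add: act_def euler_def sum_negf)
qed

text \<open>The operator commutes with the parity involution, so the conjugation drops out and the
  supercommutator becomes an ordinary commutator.\<close>

lemma capelli_op_invariant: "capelli_op d C \<in> invariant_diff_ops \<omega>"
proof -
  let ?D = "capelli_op d C"
  have parity: "parity_involution (?D p) = ?D (parity_involution p)" for p
    by (rule capelli_op_commute) (auto intro: linear_op_parity homog_poly_parity simp: parity_R2 parity_Lap)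
  have parity_pow': "(parity_involution ^^ b) (?D ((parity_involution ^^ b) p)) = ?D p"
    if "b \<in> {0, 1}" for b p
    using that by (auto simp: parity)
  have "act X (?D p) = ?D (act X p)" if "osp_matrix X" for X p
    by (rule capelli_op_commute)
      (auto intro: linear_op_act homog_poly_act simp: act_R2[OF that] act_Lap[OF that])
  then have 1: "supercommutator b (act X) ?D p = 0" if "b \<in> {0, 1}" "X \<in> osp_part \<omega> b" for b X p
    using that osp_part_eq[OF that(1)] by (simp add: supercommutator_def parity_pow'[OF that(1)])
  have "euler (?D p) = ?D (euler p)" for p
  proof -
    have "(\<lambda>p. euler (?D p)) = (\<lambda>p. ?D (euler p))"
    proof (rule linear_op_eq_homog)
      fix e and q :: "('a, 'b) superpoly"
      assume q: "q \<in> homog_poly e"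
      have "?D q \<in> homog_poly e" unfolding capelli_op_homog[OF q] by (rule homog_poly_poly_op_Q[OF q])
      then show "euler (?D q) = ?D (euler q)"
        using q by (simp add: homog_poly_iff_euler linear_op_scl[OF linear_op_capelli_op])
    qed (rule linear_op_comp[OF linear_op_euler linear_op_capelli_op]
        linear_op_comp[OF linear_op_capelli_op linear_op_euler])+
    then show ?thesis by (rule fun_cong)
  qed
  then have 2: "supercommutator 0 (act (mat (-1))) ?D p = 0" for p
    by (simp add: supercommutator_def act_minus_identity)
  show ?thesis
    unfolding invariant_diff_ops_def
    using 1 2 capelli_op_diff_ops_part[of d C] diff_ops_part_subset_diff_ops by blast
qed

text \<open>The index set omits the singular partitions, but the node of a singular (d - s, s) is
  also that of its dagger, which is quasiregular.\<close>

lemma singular_node: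
  assumes "s \<le> d div 2"
  obtains u1 u2 where "(u1, u2) \<in> index_set k" "u1 + u2 = d"
    "node d s = of_nat u2 * (of_nat u1 - of_nat k - 1)"
proof (cases "(d - s, s) \<in> index_set k")
  case True
  moreover have "node d s = of_nat s * (of_nat (d - s) - of_nat k - 1)"
    using assms by (simp add: node_def of_nat_diff algebra_simps)
  ultimately show thesis using that assms by fastforce
next
  case False
  have le: "2 * s \<le> d" using assms by linarith
  then have *: "d - s \<ge> k + 1" "d - s - s \<ge> k + 2" "d - s - s \<le> 2 * k + 2"
    using False by (auto simp: index_set_def regular_def quasiregular_def partitions2_def)
  have "(s + k + 1, d - s - k - 1) \<in> index_set k"
    using * le by (auto simp: index_set_def quasiregular_def partitions2_def)
  moreover have "s + k + 1 + (d - s - k - 1) = d" using * le by linarith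
  moreover have "node d s = of_nat (d - s - k - 1) * (of_nat (s + k + 1) - of_nat k - 1)"
  proof -
    have e: "of_nat (d - s - k - 1) = (of_nat d - of_nat s - of_nat k - 1 :: complex)"
      using * le by (simp add: of_nat_diff)
    show ?thesis unfolding e node_def by (simp add: algebra_simps)
  qed
  ultimately show thesis using that by blast
qed

text \<open>A product over the nodes annihilates p, so p splits into generalized eigenvectors of Q;
  by \<open>singular_node\<close> each of them lies in a module of the index set.\<close>

lemma homog_poly_spanned:
  assumes B: "linear_op B" and "\<And>u p. u \<in> index_set k \<Longrightarrow> psize u = d \<Longrightarrow> p \<in> V_module k \<omega> u \<Longrightarrow> B p = 0"
    and p: "p \<in> homog_poly d"
  shows "B p = 0"
proof -
  define n where "n = Suc (d div 2)"
  define S where "S = node d ` {..<n}"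
  \<comment> \<open>Nodes may repeat, so multiplicities are bounded crudely: every distinct value
    gets the exponent n.\<close>
  have "node_poly d m dvd (\<Prod>t\<in>S. [:- t, 1:]) ^ m" if "m \<le> n" for m
    using that
  proof (induction m)
    case (Suc m)
    have "[:- node d m, 1:] dvd (\<Prod>t\<in>S. [:- t, 1:])"
      using Suc.prems by (intro dvd_prodI) (auto simp: S_def)
    then have "node_poly d m * [:- node d m, 1:] dvd (\<Prod>t\<in>S. [:- t, 1:]) ^ m * (\<Prod>t\<in>S. [:- t, 1:])"
      using Suc by (intro mult_dvd_mono) auto
    then show ?case by (simp add: node_poly_def mult.commute del: mult_pCons_left mult_pCons_right)
  qed (simp add: node_poly_def)
  then have "node_poly d n dvd (\<Prod>t\<in>S. [:- t, 1:] ^ n)"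
    by (simp add: prod_power_distrib)
  moreover have "d < 2 * n" unfolding n_def by presburger
  then have "poly_op Q (node_poly d n) p = 0" by (rule node_poly_annihilates[OF p])
  ultimately have 0: "poly_op Q (\<Prod>t\<in>S. [:- t, 1:] ^ n) p = 0"
    by (rule poly_op_dvd[OF linear_op_Q])
  show ?thesis
  proof (rule poly_op_root_space_induct[OF linear_op_Q _ 0 B p])
    show "finite S" by (simp add: S_def)
  next
    fix t q assume t: "t \<in> S" and q: "q \<in> homog_poly d" "poly_op Q ([:- t, 1:] ^ n) q = 0"
    obtain s where "s \<le> d div 2" and s: "t = node d s" using t by (auto simp: S_def n_def less_Suc_eq_le)
    obtain u1 u2 where u: "(u1, u2) \<in> index_set k" "u1 + u2 = d"
      "node d s = of_nat u2 * (of_nat u1 - of_nat k - 1)"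
      using singular_node[OF \<open>s \<le> d div 2\<close>] by blast
    have "q \<in> V_module k \<omega> (u1, u2)"
      unfolding V_module_iff using q u s by auto
    then show "B q = 0" using assms(2)[OF u(1)] u(2) by (simp add: psize_def)
  qed (rule homog_poly_poly_op_Q)
qed

text \<open>Two candidates differ by an operator of bidegree (d, d) that kills the modules spanning
  P^d(V); by \<open>diff_ops_part_eq_zero\<close> the difference is 0.\<close>

lemma capelli_eqI:
  assumes "psize l = d"
    and "\<And>p. p \<in> V_module k \<omega> l \<Longrightarrow> capelli_op d C p = p"
    and "\<And>u p. u \<in> index_set k \<Longrightarrow> psize u = d \<Longrightarrow> u \<noteq> l \<Longrightarrow> p \<in> V_module k \<omega> u \<Longrightarrow> capelli_op d C p = 0"
  shows "capelli k \<omega> l = capelli_op d C"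
  unfolding capelli_def
proof (rule the_equality)
  show "capelli_op d C \<in> invariant_diff_ops \<omega> \<and> capelli_op d C \<in> diff_ops_part (psize l) (psize l) \<and>
     (\<forall>p\<in>V_module k \<omega> l. capelli_op d C p = p) \<and>
     (\<forall>u\<in>index_set k. psize u = psize l \<and> u \<noteq> l \<longrightarrow> (\<forall>p\<in>V_module k \<omega> u. capelli_op d C p = 0))"
    using assms capelli_op_invariant capelli_op_diff_ops_part by metis
next
  fix D
  assume D: "D \<in> invariant_diff_ops \<omega> \<and> D \<in> diff_ops_part (psize l) (psize l) \<and>
     (\<forall>p\<in>V_module k \<omega> l. D p = p) \<and>
     (\<forall>u\<in>index_set k. psize u = psize l \<and> u \<noteq> l \<longrightarrow> (\<forall>p\<in>V_module k \<omega> u. D p = 0))"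
  define E where "E = (\<lambda>p. D p - capelli_op d C p)"
  have E: "E \<in> diff_ops_part d d"
    using D assms(1) capelli_op_diff_ops_part unfolding E_def by (intro diff_ops_part_diff) auto
  have "E = (\<lambda>p. 0)"
  proof (rule diff_ops_part_eq_zero[OF E])
    fix p :: "('a, 'b) superpoly"
    assume p: "p \<in> homog_poly d"
    show "E p = 0"
    proof (rule homog_poly_spanned[OF linear_op_diff_ops_part[OF E] _ p])
      fix u q assume u: "u \<in> index_set k" "psize u = d" "q \<in> V_module k \<omega> u"
      show "E q = 0"
        using u D assms by (cases "u = l") (auto simp: E_def)
    qed
  qed
  then show "D = capelli_op d C"
    by (metis E_def eq_iff_diff_eq_0 ext)
qed

lemma eigenvalues_on_capelli_op:
  assumes "CARD('a) \<ge> 2" "l1 \<ge> l2"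
  shows "eigenvalues_on (capelli_op d C) (V_module k \<omega> (l1, l2))
    = {poly (eigen_poly d C (l1 + l2)) (of_nat l2 * (of_nat l1 - of_nat k - 1))}"
proof -
  let ?t = "of_nat l2 * (of_nat l1 - of_nat k - 1) :: complex"
  have "c = poly (eigen_poly d C (l1 + l2)) ?t"
    if p: "p \<in> V_module k \<omega> (l1, l2)" "p \<noteq> 0" "capelli_op d C p = scl c p" for c p
  proof -
    obtain r where "p \<in> homog_poly (l1 + l2)" "poly_op Q ([:- ?t, 1:] ^ r) p = 0"
      using p(1) unfolding V_module_iff by blast
    then show ?thesis
      using poly_op_eigenvalue_on_root_space[OF linear_op_Q p(2)] p(3) capelli_op_homog by metis
  qed
  moreover obtain p where p: "p \<noteq> 0" "p \<in> homog_poly (l1 + l2)" "Q p = scl ?t p"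
  proof -
    obtain p where "p \<noteq> 0" "p \<in> homog_poly (l1 - l2 + 2 * l2)"
      "Q p = scl (of_nat l2 * (of_nat (l1 - l2 + l2) - of_nat k - 1)) p"
      using ex_Q_eigenvector[OF assms(1)] by blast
    moreover have "l1 - l2 + 2 * l2 = l1 + l2" "l1 - l2 + l2 = l1" using assms(2) by auto
    ultimately show thesis using that by metis
  qed
  have "poly_op Q ([:- ?t, 1:] ^ 1) p = 0"
    using p(3) by (simp only: power_one_right poly_op_linear_factor[OF linear_op_Q]) simp
  then have "p \<in> V_module k \<omega> (l1, l2)"
    unfolding V_module_iff using p(2) by blast
  moreover have "capelli_op d C p = scl (poly (eigen_poly d C (l1 + l2)) ?t) p"
    unfolding capelli_op_homog[OF p(2)] by (rule poly_op_eigenvector[OF linear_op_Q p(3)])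
  ultimately show ?thesis
    unfolding eigenvalues_on_def using p(1) by blast
qed

lemma eigenvalue_poly_capelli_op:
  assumes "CARD('a) \<ge> 2"
  shows "eigenvalue_poly k \<omega> (capelli_op d C) = (\<Sum>a\<le>d div 2. smult [:C a:] (basis_poly (of_nat k) d a))"
    (is "_ = ?F")
  unfolding eigenvalue_poly_def
proof (rule the_equality)
  have ev: "eigenvalues_on (capelli_op d C) (V_module k \<omega> u)
      = {poly2 ?F (of_nat (fst u) - of_nat k - 1) (of_nat (snd u))}" if "u \<in> index_set k" for u
  proof -
    obtain l1 l2 where u: "u = (l1, l2)" by (cases u)
    then have "l2 \<le> l1"
      using that by (auto simp: index_set_def regular_def quasiregular_def partitions2_def)
    from eigenvalues_on_capelli_op[OF assms this] show ?thesis
      unfolding u fst_conv snd_conv poly_eigen_poly .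
  qed
  have "symmetric_poly2 ?F"
    by (intro symmetric_poly2_sum symmetric_poly2_smult symmetric_poly2_basis_poly)
  with ev show "symmetric_poly2 ?F \<and> (\<forall>u\<in>index_set k. eigenvalues_on (capelli_op d C) (V_module k \<omega> u)
      = {poly2 ?F (of_nat (fst u) - of_nat k - 1) (of_nat (snd u))})" by blast
  fix f
  assume f: "symmetric_poly2 f \<and> (\<forall>u\<in>index_set k. eigenvalues_on (capelli_op d C) (V_module k \<omega> u)
      = {poly2 f (of_nat (fst u) - of_nat k - 1) (of_nat (snd u))})"
  have "f - ?F = 0"
  proof (rule index_set_Zariski_dense)
    fix u assume u: "u \<in> index_set k"
    have "{poly2 f (of_nat (fst u) - of_nat k - 1) (of_nat (snd u))}
        = {poly2 ?F (of_nat (fst u) - of_nat k - 1) (of_nat (snd u))}"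
      using f ev[OF u] u by blast
    then show "poly2 (f - ?F) (of_nat (fst u) - of_nat k - 1) (of_nat (snd u)) = 0"
      by (simp only: poly2_diff) simp
  qed
  then show "f = ?F" by simp
qed

end


section \<open>Knop--Sahi polynomials\<close>

lemma falling_add: "falling x (m + n) = falling x m * falling (x - of_nat m) n"
  by (induction n) (simp_all add: falling_Suc algebra_simps)

lemma Vandermonde_falling:
  "falling (x + y) n = (\<Sum>i\<le>n. of_nat (n choose i) * (falling x i * falling y (n - i)))"
  for x y :: "'c::comm_ring_1"
proof (induction n)
  case (Suc n)
  let ?h = "\<lambda>i. falling x i * falling y (Suc n - i)"
  \<comment> \<open>The factor x + y - n is split as (x - i) + (y - (n - i)), one part for each
    falling factorial.\<close>
  have step: "(falling x i * falling y (n - i)) * (x + y - of_nat n) = ?h (Suc i) + ?h i" if "i \<le> n" for i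
  proof -
    have "(of_nat n :: 'c) = of_nat i + of_nat (n - i)" using that by (simp flip: of_nat_add)
    then have "(falling x i * falling y (n - i)) * (x + y - of_nat n)
        = falling x i * (x - of_nat i) * falling y (n - i) + falling x i * (falling y (n - i) * (y - of_nat (n - i)))"
      by (simp only: algebra_simps)
    also have "\<dots> = falling x (Suc i) * falling y (n - i) + falling x i * falling y (Suc (n - i))"
      by (simp only: falling_Suc)
    finally show ?thesis using that by (simp add: Suc_diff_le)
  qed
  have "falling (x + y) (Suc n)
      = (\<Sum>i\<le>n. of_nat (n choose i) * ((falling x i * falling y (n - i)) * (x + y - of_nat n)))"
    by (simp only: falling_Suc Suc sum_distrib_right mult.assoc)
  also have "\<dots> = (\<Sum>i\<le>n. of_nat (n choose i) * (?h (Suc i) + ?h i))"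
    by (intro sum.cong refl arg_cong2[where f = "(*)"] step) simp
  also have "\<dots> = (\<Sum>i\<le>n. of_nat (n choose i) * ?h (Suc i)) + (\<Sum>i\<le>n. of_nat (n choose i) * ?h i)"
    by (simp only: distrib_left sum.distrib)
  also have "(\<Sum>i\<le>n. of_nat (n choose i) * ?h i) = (\<Sum>i\<le>Suc n. of_nat (n choose i) * ?h i)"
    by (simp add: binomial_eq_0)
  also have "\<dots> = ?h 0 + (\<Sum>i\<le>n. of_nat (n choose Suc i) * ?h (Suc i))"
    by (subst sum.atMost_Suc_shift) simp
  also have "(\<Sum>i\<le>n. of_nat (n choose i) * ?h (Suc i)) + (?h 0 + (\<Sum>i\<le>n. of_nat (n choose Suc i) * ?h (Suc i)))
      = ?h 0 + (\<Sum>i\<le>n. of_nat (Suc n choose Suc i) * ?h (Suc i))"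
    by (simp add: distrib_right sum.distrib)
  also have "\<dots> = (\<Sum>i\<le>Suc n. of_nat (Suc n choose i) * ?h i)"
    by (subst sum.atMost_Suc_shift) simp
  finally show ?case .
qed simp

lemma sum_triangle: "(\<Sum>i\<le>m. \<Sum>j\<le>m - i. f i j) = (\<Sum>(i, j)\<in>{(i, j). i + j \<le> m}. f i j)"
  for m :: nat
proof -
  have "{(i, j). i + j \<le> m} = (SIGMA i:{..m}. {..m - i})" by auto
  then show ?thesis by (simp add: sum.Sigma)
qed

lemma finite_triangle [simp]: "finite {(i, j). i + j \<le> (m :: nat)}"
proof -
  have "{(i, j). i + j \<le> m} = (SIGMA i:{..m}. {..m - i})" by auto
  then show ?thesis by simp
qed

lemma Vandermonde_falling_3:
  "falling (x + y + z) m = (\<Sum>(i, j)\<in>{(i, j). i + j \<le> m}.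
     of_nat ((m choose i) * (m - i choose j)) * (falling x i * falling y j * falling z (m - i - j)))"
  for x y z :: "'c::comm_ring_1"
proof -
  have "falling (x + y + z) m = (\<Sum>i\<le>m. \<Sum>j\<le>m - i.
     of_nat ((m choose i) * (m - i choose j)) * (falling x i * falling y j * falling z (m - i - j)))"
    unfolding add.assoc Vandermonde_falling[of x] Vandermonde_falling[of y]
    by (simp add: sum_distrib_left mult_ac)
  then show ?thesis by (simp only: sum_triangle)
qed

lemma falling_const_poly2: "falling [:[:c:]:] n = ([:[:falling c n:]:] :: complex poly poly)"
  by (induction n) (simp_all add: falling_Suc of_nat_poly2 one_pCons)

text \<open>For \<lambda> = (n + r, r) and a = r + b, the argument x + y + \<kappa> + 1 - 2a is (x -
  a) + (y - a) + (\<kappa> + 1). The threefold Vandermonde sum then merges with the other factors of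
  \<open>basis_poly\<close> into longer falling factorials of x and y.\<close>

lemma basis_poly_expansion:
  assumes "2 * b \<le> n"
  shows "basis_poly \<kappa> (n + 2 * r) (r + b) = (\<Sum>(i, j)\<in>{(i, j). i + j \<le> n}.
     smult [:if b \<le> i \<and> b \<le> j then fact (n - 2 * b) / (fact (i - b) * fact (j - b) * fact (n - i - j))
         * falling (\<kappa> + 1) (n - i - j) else 0:] (falling PX (r + i) * falling PY (r + j)))"
proof -
  let ?a = "r + b" and ?m = "n - 2 * b"
  have arg: "PX + PY + [:[:\<kappa> + 1 - 2 * of_nat ?a:]:]
      = (PX - of_nat ?a) + (PY - of_nat ?a) + [:[:\<kappa> + 1:]:]"
    by (simp add: of_nat_poly2)
  have m: "n + 2 * r - 2 * ?a = ?m" by simp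
  have "basis_poly \<kappa> (n + 2 * r) ?a = (\<Sum>(i, j)\<in>{(i, j). i + j \<le> ?m}.
      smult [:of_nat ((?m choose i) * (?m - i choose j)) * falling (\<kappa> + 1) (?m - i - j):]
        (falling PX (?a + i) * falling PY (?a + j)))"
    unfolding basis_poly_def m arg Vandermonde_falling_3 sum_distrib_right falling_add falling_const_poly2
      of_nat_poly2 case_prod_beta
    by (intro sum.cong refl) (simp add: mult_ac)
  also have "\<dots> = (\<Sum>(i, j)\<in>{(i, j). i + j \<le> n \<and> b \<le> i \<and> b \<le> j}.
      smult [:fact ?m / (fact (i - b) * fact (j - b) * fact (n - i - j)) * falling (\<kappa> + 1) (n - i - j):]
        (falling PX (r + i) * falling PY (r + j)))"
  proof (rule sum.reindex_bij_witness[of _ "\<lambda>(i, j). (i - b, j - b)" "\<lambda>(i, j). (i + b, j + b)"], goal_cases)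
    case (5 x)
    obtain i j where x: "x = (i, j)" by (cases x)
    with 5 have ij: "i + j \<le> ?m" by simp
    have "of_nat ((?m choose i) * (?m - i choose j)) = (fact ?m / (fact i * fact j * fact (?m - i - j)) :: complex)"
      using ij by (simp add: binomial_fact field_simps)
    moreover have "n - (i + b) - (j + b) = ?m - i - j" using assms by simp
    ultimately show ?case by (simp add: x add_ac)
  qed (use assms in auto)
  also have "\<dots> = (\<Sum>(i, j)\<in>{(i, j). i + j \<le> n}.
     smult [:if b \<le> i \<and> b \<le> j then fact (n - 2 * b) / (fact (i - b) * fact (j - b) * fact (n - i - j))
         * falling (\<kappa> + 1) (n - i - j) else 0:] (falling PX (r + i) * falling PY (r + j)))"
    by (rule sum.mono_neutral_cong_left) (auto split: if_splits)
  finally show ?thesis .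
qed

text \<open>The difference of the nodes r and s for a general parameter, already factored
  (\<open>node_gap_eq\<close>). For r \<noteq> s it can vanish only at an integer \<kappa>.\<close>

definition node_gap :: "nat \<Rightarrow> complex \<Rightarrow> nat \<Rightarrow> nat \<Rightarrow> complex" where
  "node_gap d \<kappa> r s = (of_nat r - of_nat s) * (of_nat d - \<kappa> - 1 - of_nat r - of_nat s)"

text \<open>The factors with s < r give \<open>fact r\<close> and the falling factorial of
  \<open>knop_sahi_norm\<close>; those with r < s \<le> r + b give the denominators of the
  Chu-Vandermonde sum.\<close>

lemma prod_node_gap:
  "(\<Prod>s\<in>{..r + b} - {r}. node_gap (n + 2 * r) \<kappa> r s)
     = fact r * falling (of_nat (n + r) - 1 - \<kappa>) r * (fact b * falling (\<kappa> + 1 - of_nat n + of_nat b) b)"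
proof (induction b)
  case 0
  have "{..r} - {r} = {..<r}" by auto
  then have "(\<Prod>s\<in>{..r} - {r}. node_gap (n + 2 * r) \<kappa> r s)
      = (\<Prod>s<r. of_nat r - of_nat s) * (\<Prod>s<r. of_nat (n + r) - 1 - \<kappa> - of_nat s)"
    by (simp add: node_gap_def prod.distrib[symmetric] algebra_simps)
  then show ?case by (simp add: falling_self[symmetric] falling_def)
next
  case (Suc b)
  have "{..r + Suc b} - {r} = insert (r + Suc b) ({..r + b} - {r})" by auto
  then have "(\<Prod>s\<in>{..r + Suc b} - {r}. node_gap (n + 2 * r) \<kappa> r s)
      = node_gap (n + 2 * r) \<kappa> r (r + Suc b) * (\<Prod>s\<in>{..r + b} - {r}. node_gap (n + 2 * r) \<kappa> r s)"
    by simp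
  also have "node_gap (n + 2 * r) \<kappa> r (r + Suc b) = of_nat (Suc b) * (\<kappa> + 1 - of_nat n + of_nat (Suc b))"
    by (simp add: node_gap_def algebra_simps)
  finally show ?case
    unfolding Suc falling_Suc_left by (simp add: algebra_simps)
qed

text \<open>The divided difference over the nodes 0, ..., a of the Lagrange polynomial at node r,
  that is, its coefficient in Newton form; see \<open>newton_form_of_Lagrange\<close>.\<close>

definition newton_coef :: "nat \<Rightarrow> complex \<Rightarrow> nat \<Rightarrow> nat \<Rightarrow> complex" where
  "newton_coef d \<kappa> r a = (if r \<le> a then 1 / (\<Prod>s\<in>{..a} - {r}. node_gap d \<kappa> r s) else 0)"

lemma falling_nonzero:
  fixes x :: complex
  assumes "x \<notin> \<int>"
  shows "falling x n \<noteq> 0"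
  unfolding falling_def using assms by (auto simp: prod_zero_iff)

text \<open>The Chu--Vandermonde summation \<open>2F1(-I, -J; z; 1) = (z + J)\<^sub>I / (z)\<^sub>I\<close> with \<open>z = c - n + 1\<close>.\<close>

lemma Chu_Vandermonde_falling:
  fixes c :: complex
  assumes c: "c \<notin> \<int>" and IJ: "I + J \<le> n"
  shows "falling c (n - I) * falling c (n - J) / (fact I * fact J * fact (n - I - J) * falling c n)
    = (\<Sum>b\<le>n div 2. if b \<le> I \<and> b \<le> J then falling c (n - I - J) /
        (fact b * falling (c - of_nat n + of_nat b) b * (fact (I - b) * fact (J - b) * fact (n - I - J))) else 0)"
proof -
  have nonint: "c - of_nat n + of_nat i \<notin> \<int>" for i
    using c Ints_diff[of "c - of_nat n + of_nat i" "of_nat i - of_nat n"] by auto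
  \<comment> \<open>This is the rising factorial (z)_I. The identities \<open>cn\<close> and
    \<open>cJ\<close> split off what both sides share, and the quotient (z + J)_I / (z)_I remains to
    be expanded.\<close>
  define F where "F = falling (c - of_nat n + of_nat I) I"
  have F: "F \<noteq> 0" unfolding F_def by (rule falling_nonzero[OF nonint])
  have cn: "falling c n = falling c (n - I) * F"
    using falling_add[of c "n - I" I] IJ by (simp add: F_def of_nat_diff algebra_simps)
  have cJ: "falling c (n - J) = falling c (n - I - J) * falling (c - of_nat n + of_nat I + of_nat J) I"
  proof -
    have "n - J = (n - I - J) + I" using IJ by simp
    then have "falling c (n - J) = falling c (n - I - J) * falling (c - of_nat (n - I - J)) I"
      using falling_add[of c "n - I - J" I] by simp
    also have "c - of_nat (n - I - J) = c - of_nat n + of_nat I + of_nat J"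
      using IJ by (simp add: of_nat_diff)
    finally show ?thesis .
  qed
  have summand: "of_nat (I choose b) * (falling (of_nat J) b * falling (c - of_nat n + of_nat I) (I - b))
      = (if b \<le> J then F * fact I * fact J / (fact b * falling (c - of_nat n + of_nat b) b * (fact (I - b) * fact (J - b))) else 0)"
    if b: "b \<le> I" for b
  proof (cases "b \<le> J")
    case True
    have "F = falling (c - of_nat n + of_nat I) (I - b) * falling (c - of_nat n + of_nat b) b"
      using falling_add[of "c - of_nat n + of_nat I" "I - b" b] b by (simp add: F_def of_nat_diff algebra_simps)
    moreover have "falling (c - of_nat n + of_nat b) b \<noteq> 0" by (rule falling_nonzero[OF nonint])
    moreover have "falling (of_nat J) b = (fact J / fact (J - b) :: complex)"
    proof -
      have "falling (of_nat J) J = falling (of_nat J) b * (falling (of_nat (J - b)) (J - b) :: complex)"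
        using falling_add[of "of_nat J :: complex" b "J - b"] True by (simp add: of_nat_diff)
      then show ?thesis by (simp add: falling_self)
    qed
    ultimately show ?thesis using b True by (simp add: binomial_fact field_simps)
  next
    case False
    then have "falling (of_nat J) b = (0 :: complex)"
      unfolding falling_def by (subst prod_zero_iff) auto
    then show ?thesis using False by simp
  qed
  have "falling (c - of_nat n + of_nat I + of_nat J) I
      = (\<Sum>b\<le>I. of_nat (I choose b) * (falling (of_nat J) b * falling (c - of_nat n + of_nat I) (I - b)))"
    using Vandermonde_falling[of "of_nat J :: complex" "c - of_nat n + of_nat I" I] by (simp add: add.commute)
  also have "\<dots> = (\<Sum>b\<le>I. if b \<le> J then F * fact I * fact J / (fact b * falling (c - of_nat n + of_nat b) b * (fact (I - b) * fact (J - b))) else 0)"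
    by (intro sum.cong refl summand) simp
  also have "\<dots> = (\<Sum>b\<le>n div 2. if b \<le> I \<and> b \<le> J then F * fact I * fact J / (fact b * falling (c - of_nat n + of_nat b) b * (fact (I - b) * fact (J - b))) else 0)"
    by (rule sum.mono_neutral_cong) (use IJ in auto)
  finally have V: "falling (c - of_nat n + of_nat I + of_nat J) I / (F * fact I * fact J)
      = (\<Sum>b\<le>n div 2. if b \<le> I \<and> b \<le> J then 1 / (fact b * falling (c - of_nat n + of_nat b) b * (fact (I - b) * fact (J - b))) else 0)"
    using F by (simp add: sum_divide_distrib if_distrib[of "\<lambda>x. x / _"] cong: if_cong)
  have "falling c (n - I) * falling c (n - J) / (fact I * fact J * fact (n - I - J) * falling c n)
      = falling c (n - I - J) / fact (n - I - J)
        * (falling (c - of_nat n + of_nat I + of_nat J) I / (F * fact I * fact J))"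
    unfolding cn cJ using F falling_nonzero[OF c, of "n - I"] by (simp add: field_simps)
  also have "\<dots> = (\<Sum>b\<le>n div 2. if b \<le> I \<and> b \<le> J then falling c (n - I - J) /
        (fact b * falling (c - of_nat n + of_nat b) b * (fact (I - b) * fact (J - b) * fact (n - I - J))) else 0)"
    unfolding V sum_distrib_left by (intro sum.cong refl) (simp add: field_simps)
  finally show ?thesis .
qed

lemma smult_sum_poly2: "smult [:\<Sum>i\<in>I. c i:] f = (\<Sum>i\<in>I. smult [:c i:] f)" for f :: "complex poly poly"
proof (induction I rule: infinite_finite_induct)
  case (insert x F)
  have "smult [:\<Sum>i\<in>insert x F. c i:] f = smult ([:c x:] + [:\<Sum>i\<in>F. c i:]) f"
    using insert.hyps by simp
  then show ?case using insert by (simp only: smult_add_left) simp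
qed simp_all

lemma smult_sum_right: "smult c (\<Sum>i\<in>I. f i) = (\<Sum>i\<in>I. smult c (f i))"
  by (induction I rule: infinite_finite_induct) (simp_all add: smult_add_right)

text \<open>Both sides are expanded in products of falling factorials. Chu-Vandermonde turns each
  coefficient on the left into a sum over b, whose b-th term belongs to \<open>basis_poly\<close>
  with a = l2 + b; norm and denominator combine to \<open>newton_coef\<close> by
  \<open>prod_node_gap\<close>.\<close>

lemma knop_sahi_expansion:
  assumes \<kappa>: "\<kappa> \<notin> \<int>" and l: "l2 \<le> l1"
  shows "smult [:1 / knop_sahi_norm (l1, l2) \<kappa>:] (knop_sahi (l1, l2) \<kappa>)
     = (\<Sum>a\<le>(l1 + l2) div 2. smult [:newton_coef (l1 + l2) \<kappa> l2 a / fact (l1 + l2 - 2 * a):] (basis_poly \<kappa> (l1 + l2) a))"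
proof -
  define n where "n = l1 - l2"
  define r where "r = l2"
  define c where "c = \<kappa> + 1"
  have l1: "l1 = n + r" and d: "l1 + l2 = n + 2 * r" using l by (simp_all add: n_def r_def)
  have c: "c \<notin> \<int>" using \<kappa> Ints_diff[of c 1] by (auto simp: c_def)
  define H where "H = fact r * falling (of_nat (n + r) - 1 - \<kappa>) r"
  have norm: "knop_sahi_norm (l1, l2) \<kappa> = fact n * H"
    by (simp add: knop_sahi_norm_def H_def l1 r_def[symmetric])
  let ?M = "\<lambda>i j. falling PX (r + i) * falling PY (r + j)"
  have kn: "knop_sahi (l1, l2) \<kappa> = (\<Sum>(i, j)\<in>{(i, j). i + j \<le> n}.
       smult [:fact n * falling c (n - i) * falling c (n - j) /
               (fact i * fact j * fact (n - i - j) * falling c n):] (?M i j))"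
    unfolding knop_sahi_def n_def r_def c_def by (simp only: Let_def case_prod_conv)
  have "smult [:1 / knop_sahi_norm (l1, l2) \<kappa>:] (knop_sahi (l1, l2) \<kappa>)
     = (\<Sum>(i, j)\<in>{(i, j). i + j \<le> n}. smult [:1 / H * (falling c (n - i) * falling c (n - j)
          / (fact i * fact j * fact (n - i - j) * falling c n)):] (?M i j))"
    unfolding norm kn smult_sum_right by (intro sum.cong refl) (auto simp: mult_ac)
  also have "\<dots> = (\<Sum>(i, j)\<in>{(i, j). i + j \<le> n}. \<Sum>b\<le>n div 2. smult [:1 / H * (if b \<le> i \<and> b \<le> j then falling c (n - i - j) /
        (fact b * falling (c - of_nat n + of_nat b) b * (fact (i - b) * fact (j - b) * fact (n - i - j))) else 0):] (?M i j))"
    by (rule sum.cong[OF refl], clarify)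
      (simp only: case_prod_conv Chu_Vandermonde_falling[OF c] sum_distrib_left smult_sum_poly2)
  also have "\<dots> = (\<Sum>b\<le>n div 2. \<Sum>(i, j)\<in>{(i, j). i + j \<le> n}. smult [:1 / H * (if b \<le> i \<and> b \<le> j then falling c (n - i - j) /
        (fact b * falling (c - of_nat n + of_nat b) b * (fact (i - b) * fact (j - b) * fact (n - i - j))) else 0):] (?M i j))"
    unfolding case_prod_beta by (rule sum.swap)
  also have "\<dots> = (\<Sum>b\<le>n div 2. smult [:newton_coef (n + 2 * r) \<kappa> r (r + b) / fact (n - 2 * b):] (basis_poly \<kappa> (n + 2 * r) (r + b)))"
  proof (rule sum.cong[OF refl])
    fix b assume "b \<in> {..n div 2}"
    then have b: "2 * b \<le> n" by auto
    have "newton_coef (n + 2 * r) \<kappa> r (r + b) = 1 / (H * (fact b * falling (c - of_nat n + of_nat b) b))"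
      by (simp add: newton_coef_def prod_node_gap H_def c_def)
    then show "(\<Sum>(i, j)\<in>{(i, j). i + j \<le> n}. smult [:1 / H * (if b \<le> i \<and> b \<le> j then falling c (n - i - j) /
        (fact b * falling (c - of_nat n + of_nat b) b * (fact (i - b) * fact (j - b) * fact (n - i - j))) else 0):] (?M i j))
        = smult [:newton_coef (n + 2 * r) \<kappa> r (r + b) / fact (n - 2 * b):] (basis_poly \<kappa> (n + 2 * r) (r + b))"
      unfolding basis_poly_expansion[OF b] smult_sum_right c_def[symmetric] case_prod_beta
      by (intro sum.cong refl) (auto simp: field_simps)
  qed
  also have "\<dots> = (\<Sum>a\<in>{r..(n + 2 * r) div 2}. smult [:newton_coef (n + 2 * r) \<kappa> r a / fact (n + 2 * r - 2 * a):] (basis_poly \<kappa> (n + 2 * r) a))"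
    by (rule sum.reindex_bij_witness[of _ "\<lambda>a. a - r" "\<lambda>b. r + b"]) auto
  also have "\<dots> = (\<Sum>a\<le>(n + 2 * r) div 2. smult [:newton_coef (n + 2 * r) \<kappa> r a / fact (n + 2 * r - 2 * a):] (basis_poly \<kappa> (n + 2 * r) a))"
    by (rule sum.mono_neutral_left) (auto simp: newton_coef_def)
  finally show ?thesis unfolding d unfolding r_def[symmetric] .
qed


section \<open>The limit\<close>

definition node_at :: "nat \<Rightarrow> complex \<Rightarrow> nat \<Rightarrow> complex" where
  "node_at d \<kappa> s = of_nat s * (of_nat d - \<kappa> - 1 - of_nat s)"

lemma node_gap_eq: "node_gap d \<kappa> r s = node_at d \<kappa> r - node_at d \<kappa> s"
  by (simp add: node_gap_def node_at_def algebra_simps)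

lemma node_gap_nonzero:
  assumes "\<kappa> \<notin> \<int>" "r \<noteq> s"
  shows "node_gap d \<kappa> r s \<noteq> 0"
proof
  assume "node_gap d \<kappa> r s = 0"
  then have "of_nat d - \<kappa> - 1 - of_nat r - of_nat s = 0"
    using assms(2) by (simp add: node_gap_def)
  then have "\<kappa> = of_nat d - 1 - of_nat r - of_nat s" by (simp add: algebra_simps)
  then show False using assms(1) by auto
qed

text \<open>A new node x multiplies the Lagrange product by (t - x)/(x_r - x) = 1 + (t - x_r)/(x_r -
  x), and the second summand produces the new Newton term.\<close>

lemma newton_form_of_Lagrange:
  assumes "\<kappa> \<notin> \<int>" "r \<le> M"
  shows "(\<Sum>a\<le>M. newton_coef d \<kappa> r a * (\<Prod>s<a. t - node_at d \<kappa> s))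
    = (\<Prod>s\<in>{..M} - {r}. (t - node_at d \<kappa> s) / node_gap d \<kappa> r s)"
  using assms(2)
proof (induction M rule: dec_induct)
  case base
  have "(\<Sum>a\<le>r. newton_coef d \<kappa> r a * (\<Prod>s<a. t - node_at d \<kappa> s))
      = newton_coef d \<kappa> r r * (\<Prod>s<r. t - node_at d \<kappa> s)"
    by (subst sum.remove[of _ r]) (auto simp: newton_coef_def intro!: sum.neutral)
  moreover have "{..r} - {r} = {..<r}" by auto
  ultimately show ?case by (simp add: newton_coef_def prod_dividef)
next
  case (step M)
  let ?g = "\<lambda>s. node_gap d \<kappa> r s" and ?x = "node_at d \<kappa>"
  have ins: "{..Suc M} - {r} = insert (Suc M) ({..M} - {r})" using step.hyps by auto
  have "(\<Prod>s<Suc M. t - ?x s) = (t - ?x r) * (\<Prod>s\<in>{..M} - {r}. t - ?x s)"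
    unfolding lessThan_Suc_atMost using step.hyps by (intro prod.remove) auto
  then have A: "newton_coef d \<kappa> r (Suc M) * (\<Prod>s<Suc M. t - ?x s)
      = (\<Prod>s\<in>{..M} - {r}. (t - ?x s) / ?g s) * ((t - ?x r) / ?g (Suc M))"
    using step.hyps by (simp add: newton_coef_def ins prod_dividef mult.commute del: prod.lessThan_Suc)
  have B: "1 + (t - ?x r) / ?g (Suc M) = (t - ?x (Suc M)) / ?g (Suc M)"
    using node_gap_nonzero[OF assms(1), of r "Suc M" d] step.hyps
    by (simp add: node_gap_eq field_simps)
  let ?P = "\<Prod>s\<in>{..M} - {r}. (t - ?x s) / ?g s"
  have "(\<Sum>a\<le>Suc M. newton_coef d \<kappa> r a * (\<Prod>s<a. t - ?x s)) = ?P * (1 + (t - ?x r) / ?g (Suc M))"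
    by (simp only: sum.atMost_Suc step.IH A distrib_left mult_1_right)
  also have "\<dots> = (\<Prod>s\<in>{..Suc M} - {r}. (t - ?x s) / ?g s)"
    unfolding B ins by (subst prod.insert) (auto simp: mult.commute)
  finally show ?case .
qed

text \<open>More than a derivative: both arguments and all roots move with the parameter. The
  induction uses the product rule for difference quotients.\<close>

lemma tendsto_difference_quotient_prod:
  fixes x :: "'s \<Rightarrow> 'b \<Rightarrow> complex"
  assumes u: "(u \<longlongrightarrow> t0) F" and v: "(v \<longlongrightarrow> t0) F" and uv: "eventually (\<lambda>z. u z \<noteq> v z) F"
    and "finite S" and x: "\<And>s. s \<in> S \<Longrightarrow> (x s \<longlongrightarrow> x0 s) F"
  shows "((\<lambda>z. ((\<Prod>s\<in>S. u z - x s z) - (\<Prod>s\<in>S. v z - x s z)) / (u z - v z))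
     \<longlongrightarrow> poly (pderiv (\<Prod>s\<in>S. [:- x0 s, 1:])) t0) F"
  using \<open>finite S\<close> x
proof (induction S rule: finite_induct)
  case (insert s S)
  let ?X = "\<lambda>w z. \<Prod>s\<in>S. w z - x s z"
  have "((\<lambda>z. (u z - x s z) * ((?X u z - ?X v z) / (u z - v z)) + ?X v z)
     \<longlongrightarrow> (t0 - x0 s) * poly (pderiv (\<Prod>s\<in>S. [:- x0 s, 1:])) t0 + (\<Prod>s\<in>S. t0 - x0 s)) F"
    by (intro tendsto_intros u v insert.IH insert.prems) auto
  moreover have "poly (pderiv (\<Prod>s\<in>insert s S. [:- x0 s, 1:])) t0
      = (t0 - x0 s) * poly (pderiv (\<Prod>s\<in>S. [:- x0 s, 1:])) t0 + (\<Prod>s\<in>S. t0 - x0 s)"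
    using insert.hyps by (simp add: pderiv_mult poly_prod pderiv_pCons del: mult_pCons_left mult_pCons_right)
  moreover have "eventually (\<lambda>z. (u z - x s z) * ((?X u z - ?X v z) / (u z - v z)) + ?X v z
      = ((\<Prod>s\<in>insert s S. u z - x s z) - (\<Prod>s\<in>insert s S. v z - x s z)) / (u z - v z)) F"
    using uv insert.hyps by (auto elim!: eventually_mono simp: field_simps)
  ultimately show ?case by (simp add: tendsto_cong)
qed simp

section \<open>The pair of colliding nodes\<close>

locale quasiregular_partition =
  fixes k l1 l2 :: nat
  assumes quasi: "quasiregular k (l1, l2)"
begin

abbreviation "d \<equiv> l1 + l2"
abbreviation "r \<equiv> l2"
text \<open>The second entry of the dagger. Quasiregularity makes the truncated subtraction exact
  and gives r' < r \<le> M, so that both nodes are among those of degree d.\<close>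

abbreviation "r' \<equiv> l1 - k - 1"
abbreviation "M \<equiv> d div 2"

lemma nodes_less: "r' < r" "r \<le> M" "k + 1 \<le> l1" "l2 \<le> l1" "l1 - l2 \<le> k"
  using quasi by (auto simp: quasiregular_def partitions2_def)

lemma sum_nodes: "r + r' + k + 1 = d"
  using nodes_less by linarith

text \<open>At \<kappa> = k one has d - k - 1 = r + r'. Hence both gaps factor in the same way: the
  nodes r and r' coincide, and no other node meets them.\<close>

lemma node_gap_k: "node_gap d (of_nat k) r s = (of_nat r - of_nat s) * (of_nat r' - of_nat s)"
  "node_gap d (of_nat k) r' s = (of_nat r - of_nat s) * (of_nat r' - of_nat s)"
proof -
  have "of_nat d - of_nat k - 1 = (of_nat r + of_nat r' :: complex)"
    using arg_cong[OF sum_nodes, of "of_nat :: nat \<Rightarrow> complex"] by (simp add: algebra_simps)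
  then show "node_gap d (of_nat k) r s = (of_nat r - of_nat s) * (of_nat r' - of_nat s)"
    "node_gap d (of_nat k) r' s = (of_nat r - of_nat s) * (of_nat r' - of_nat s)"
    unfolding node_gap_def by (simp_all add: algebra_simps)
qed

definition t0 :: complex where "t0 = node_at d (of_nat k) r"

lemma t0_eq: "node_at d (of_nat k) r = t0" "node_at d (of_nat k) r' = t0"
  using node_gap_k(1)[of r'] by (simp_all add: t0_def node_gap_eq)

lemma node_at_neq_t0: "s \<noteq> r \<Longrightarrow> s \<noteq> r' \<Longrightarrow> t0 - node_at d (of_nat k) s \<noteq> 0"
  using node_gap_k(1)[of s] by (simp add: t0_def node_gap_eq[symmetric])

lemma tendsto_node_at: "((\<lambda>\<kappa>. node_at d \<kappa> s) \<longlongrightarrow> node_at d (of_nat k) s) (at (of_nat k))"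
  unfolding node_at_def by (intro tendsto_intros)

lemma tendsto_t0: "((\<lambda>\<kappa>. node_at d \<kappa> r) \<longlongrightarrow> t0) (at (of_nat k))"
  "((\<lambda>\<kappa>. node_at d \<kappa> r') \<longlongrightarrow> t0) (at (of_nat k))"
  using tendsto_node_at[of r] tendsto_node_at[of r'] by (simp_all only: t0_eq)

lemma eventually_nonint: "eventually (\<lambda>\<kappa> :: complex. \<kappa> \<notin> \<int>) (at (of_nat k))"
  unfolding eventually_at
proof (intro exI[of _ 1] conjI ballI impI)
  fix \<kappa> :: complex
  assume "\<kappa> \<noteq> of_nat k \<and> dist \<kappa> (of_nat k) < 1"
  then show "\<kappa> \<notin> \<int>"
  proof (intro notI, elim Ints_cases conjE)
    fix z assume z: "\<kappa> = of_int z" "\<kappa> \<noteq> of_nat k" "dist \<kappa> (of_nat k) < 1"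
    have "norm (of_int (z - int k) :: complex) < 1" using z by (simp add: dist_norm)
    then have "\<bar>z - int k\<bar> < 1" unfolding norm_of_int by linarith
    then show False using z by auto
  qed
qed simp

lemma tendsto_quotient_nodes:
  assumes "finite S"
  shows "((\<lambda>\<kappa>. ((\<Prod>s\<in>S. node_at d \<kappa> r - node_at d \<kappa> s) - (\<Prod>s\<in>S. node_at d \<kappa> r' - node_at d \<kappa> s))
       / (node_at d \<kappa> r - node_at d \<kappa> r'))
     \<longlongrightarrow> poly (pderiv (\<Prod>s\<in>S. [:- node_at d (of_nat k) s, 1:])) t0) (at (of_nat k))"
proof (rule tendsto_difference_quotient_prod[OF _ _ _ assms])
  show "((\<lambda>\<kappa>. node_at d \<kappa> r) \<longlongrightarrow> t0) (at (of_nat k))" "((\<lambda>\<kappa>. node_at d \<kappa> r') \<longlongrightarrow> t0) (at (of_nat k))"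
    by (rule tendsto_t0)+
  show "eventually (\<lambda>\<kappa>. node_at d \<kappa> r \<noteq> node_at d \<kappa> r') (at (of_nat k))"
    using eventually_nonint
  proof eventually_elim
    case (elim \<kappa>)
    then show ?case using node_gap_nonzero[OF elim, of r r' d] nodes_less(1) by (simp add: node_gap_eq)
  qed
qed (rule tendsto_node_at)

definition pair_coef :: "complex \<Rightarrow> nat \<Rightarrow> complex" where
  "pair_coef \<kappa> a = newton_coef d \<kappa> r a + newton_coef d \<kappa> r' a"

text \<open>Below r at most the coefficient of r' is present, and its denominator stays away from 0.
  From r on both are present, each with a simple pole at \<kappa> = k, and the poles cancel.\<close>

lemma pair_coef_convergent: "\<exists>L. ((\<lambda>\<kappa>. pair_coef \<kappa> a) \<longlongrightarrow> L) (at (of_nat k))"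
proof -
  consider "a < r'" | "r' \<le> a" "a < r" | "r \<le> a" by linarith
  then show ?thesis
  proof cases
    case 1
    then show ?thesis using nodes_less(1) by (auto simp: pair_coef_def newton_coef_def intro!: exI[of _ 0])
  next
    case 2
    have "((\<lambda>\<kappa>. 1 / (\<Prod>s\<in>{..a} - {r'}. node_at d \<kappa> r' - node_at d \<kappa> s))
      \<longlongrightarrow> 1 / (\<Prod>s\<in>{..a} - {r'}. t0 - node_at d (of_nat k) s)) (at (of_nat k))"
      using 2 node_at_neq_t0 tendsto_node_at[of r'] unfolding t0_eq
      by (intro tendsto_intros tendsto_node_at) (auto simp: prod_zero_iff)
    then show ?thesis using 2 by (auto simp: pair_coef_def newton_coef_def node_gap_eq)
  next
    case 3
    define S where "S = {..a} - {r, r'}"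
    let ?u = "\<lambda>\<kappa>. node_at d \<kappa> r" and ?v = "\<lambda>\<kappa>. node_at d \<kappa> r'"
    let ?W = "\<lambda>w \<kappa>. \<Prod>s\<in>S. w \<kappa> - node_at d \<kappa> s"
    let ?w = "\<Prod>s\<in>S. t0 - node_at d (of_nat k) s"
    have w: "?w \<noteq> 0" using node_at_neq_t0 by (auto simp: S_def prod_zero_iff)
    have W: "(?W ?u \<longlongrightarrow> ?w) (at (of_nat k))" "(?W ?v \<longlongrightarrow> ?w) (at (of_nat k))"
      by (intro tendsto_prod tendsto_diff tendsto_t0 tendsto_node_at)+
    \<comment> \<open>With D the difference of the two nodes and A, B the products over the
      remaining nodes, the coefficients are 1/(D A) and -1/(D B). Their sum is minus the difference
      quotient (A - B)/D, divided by A B.\<close>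
    have "((\<lambda>\<kappa>. - ((?W ?u \<kappa> - ?W ?v \<kappa>) / (?u \<kappa> - ?v \<kappa>)) / (?W ?u \<kappa> * ?W ?v \<kappa>))
        \<longlongrightarrow> - poly (pderiv (\<Prod>s\<in>S. [:- node_at d (of_nat k) s, 1:])) t0 / (?w * ?w)) (at (of_nat k))"
      using w by (intro tendsto_intros tendsto_quotient_nodes W) (auto simp: S_def)
    moreover have "eventually (\<lambda>\<kappa>. - ((?W ?u \<kappa> - ?W ?v \<kappa>) / (?u \<kappa> - ?v \<kappa>)) / (?W ?u \<kappa> * ?W ?v \<kappa>) = pair_coef \<kappa> a) (at (of_nat k))"
      using eventually_nonint
    proof eventually_elim
      case (elim \<kappa>)
      have nz: "?W ?u \<kappa> \<noteq> 0" "?W ?v \<kappa> \<noteq> 0"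
        using node_gap_nonzero[OF elim] by (auto simp: S_def prod_zero_iff node_gap_eq[symmetric])
      have uv: "?u \<kappa> - ?v \<kappa> \<noteq> 0"
        using node_gap_nonzero[OF elim, of r r' d] nodes_less(1) by (simp add: node_gap_eq)
      have "{..a} - {r} = insert r' S" "{..a} - {r'} = insert r S" "r \<notin> S" "r' \<notin> S" "finite S"
        using 3 nodes_less(1) by (auto simp: S_def)
      then have "pair_coef \<kappa> a = 1 / ((?u \<kappa> - ?v \<kappa>) * ?W ?u \<kappa>) + 1 / ((?v \<kappa> - ?u \<kappa>) * ?W ?v \<kappa>)"
        using 3 nodes_less(1) by (simp add: pair_coef_def newton_coef_def node_gap_eq)
      also have "?v \<kappa> - ?u \<kappa> = - (?u \<kappa> - ?v \<kappa>)" by simp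
      also have "1 / (D * A) + 1 / (- D * B) = - ((A - B) / D) / (A * B)"
        if "D \<noteq> 0" "A \<noteq> 0" "B \<noteq> 0" for A B D :: complex
        using that by (simp add: field_simps)
      note this[OF uv nz]
      finally show ?case by (rule sym)
    qed
    ultimately show ?thesis by (auto simp: tendsto_cong)
  qed
qed

definition limit_coef :: "nat \<Rightarrow> complex" where
  "limit_coef a = (SOME L. ((\<lambda>\<kappa>. pair_coef \<kappa> a) \<longlongrightarrow> L) (at (of_nat k)))"

lemma tendsto_pair_coef: "((\<lambda>\<kappa>. pair_coef \<kappa> a) \<longlongrightarrow> limit_coef a) (at (of_nat k))"
  unfolding limit_coef_def using pair_coef_convergent by (rule someI_ex)

definition W0 :: "complex poly" where
  "W0 = (\<Prod>s\<in>{..M} - {r, r'}. [:- node_at d (of_nat k) s, 1:])"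

text \<open>W0 times the first-order Taylor polynomial of 1/W0 at t0: the interpolant with value 1
  and derivative 0 at the double node and zeros at the other nodes.\<close>

definition hermite :: "complex poly" where
  "hermite = smult (1 / (poly W0 t0 * poly W0 t0))
     (W0 * ([:poly W0 t0:] - smult (poly (pderiv W0) t0) [:- t0, 1:]))"

lemma W0_nonzero: "poly W0 t0 \<noteq> 0"
  using node_at_neq_t0 by (auto simp: W0_def poly_prod prod_zero_iff)

text \<open>For every t the Newton form at \<kappa> has two limits, one taken termwise and one read
  off from the sum of the two Lagrange products. Their equality identifies the polynomial although
  the limit coefficients are known only by a choice.\<close>

lemma limit_newton_form:
  "(\<Sum>a\<le>M. smult (limit_coef a) (\<Prod>s<a. [:- node_at d (of_nat k) s, 1:])) = hermite"
proof -
  have "poly (\<Sum>a\<le>M. smult (limit_coef a) (\<Prod>s<a. [:- node_at d (of_nat k) s, 1:])) t = poly hermite t" for t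
  proof -
    define S where "S = {..M} - {r, r'}"
    let ?u = "\<lambda>\<kappa>. node_at d \<kappa> r" and ?v = "\<lambda>\<kappa>. node_at d \<kappa> r'"
    let ?W = "\<lambda>w \<kappa>. \<Prod>s\<in>S. w \<kappa> - node_at d \<kappa> s"
    let ?w = "poly W0 t0"
    let ?h = "\<lambda>\<kappa>. \<Sum>a\<le>M. pair_coef \<kappa> a * (\<Prod>s<a. t - node_at d \<kappa> s)"
    have w: "(\<Prod>s\<in>S. x - node_at d (of_nat k) s) = poly W0 x" for x
      by (simp add: W0_def S_def poly_prod)
    have W: "(?W ?u \<longlongrightarrow> ?w) (at (of_nat k))" "(?W ?v \<longlongrightarrow> ?w) (at (of_nat k))"
      unfolding w[symmetric] by (intro tendsto_prod tendsto_diff tendsto_t0 tendsto_node_at)+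
    have Wt: "(?W (\<lambda>_. t) \<longlongrightarrow> poly W0 t) (at (of_nat k))"
      unfolding w[symmetric] by (intro tendsto_intros tendsto_node_at)
    have "((\<lambda>\<kappa>. (?W ?u \<kappa> - ?W ?v \<kappa>) / (?u \<kappa> - ?v \<kappa>)) \<longlongrightarrow> poly (pderiv W0) t0) (at (of_nat k))"
      unfolding W0_def S_def[symmetric] by (rule tendsto_quotient_nodes) (simp add: S_def)
    then have "((\<lambda>\<kappa>. ?W (\<lambda>_. t) \<kappa> * (?W ?u \<kappa> - (t - ?v \<kappa>) * ((?W ?u \<kappa> - ?W ?v \<kappa>) / (?u \<kappa> - ?v \<kappa>))) / (?W ?u \<kappa> * ?W ?v \<kappa>))
      \<longlongrightarrow> poly W0 t * (?w - (t - t0) * poly (pderiv W0) t0) / (?w * ?w)) (at (of_nat k))"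
      using W0_nonzero by (intro tendsto_intros tendsto_t0 W Wt) auto
    moreover have "poly W0 t * (?w - (t - t0) * poly (pderiv W0) t0) / (?w * ?w) = poly hermite t"
    proof -
      have "poly ([:?w:] - smult (poly (pderiv W0) t0) [:- t0, 1:]) t = ?w - (t - t0) * poly (pderiv W0) t0"
        by (simp add: algebra_simps)
      then show ?thesis unfolding hermite_def poly_smult poly_mult by simp
    qed
    moreover have "eventually (\<lambda>\<kappa>. ?W (\<lambda>_. t) \<kappa> * (?W ?u \<kappa> - (t - ?v \<kappa>) * ((?W ?u \<kappa> - ?W ?v \<kappa>) / (?u \<kappa> - ?v \<kappa>))) / (?W ?u \<kappa> * ?W ?v \<kappa>)
        = ?h \<kappa>) (at (of_nat k))"
      using eventually_nonint
    proof eventually_elim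
      case (elim \<kappa>)
      have nz: "?W ?u \<kappa> \<noteq> 0" "?W ?v \<kappa> \<noteq> 0"
        using node_gap_nonzero[OF elim] by (auto simp: S_def prod_zero_iff node_gap_eq[symmetric])
      have uv: "?u \<kappa> - ?v \<kappa> \<noteq> 0"
        using node_gap_nonzero[OF elim, of r r' d] nodes_less(1) by (simp add: node_gap_eq)
      have S: "{..M} - {r} = insert r' S" "{..M} - {r'} = insert r S" "r \<notin> S" "r' \<notin> S" "finite S"
        using nodes_less(1,2) by (auto simp: S_def)
      have "?h \<kappa> = (\<Sum>a\<le>M. newton_coef d \<kappa> r a * (\<Prod>s<a. t - node_at d \<kappa> s))
          + (\<Sum>a\<le>M. newton_coef d \<kappa> r' a * (\<Prod>s<a. t - node_at d \<kappa> s))"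
        by (simp only: pair_coef_def distrib_right sum.distrib)
      also have "\<dots> = (t - ?v \<kappa>) / (?u \<kappa> - ?v \<kappa>) * (?W (\<lambda>_. t) \<kappa> / ?W ?u \<kappa>)
          + (t - ?u \<kappa>) / (- (?u \<kappa> - ?v \<kappa>)) * (?W (\<lambda>_. t) \<kappa> / ?W ?v \<kappa>)"
        using nodes_less(1,2) S
        by (simp add: newton_form_of_Lagrange[OF elim] node_gap_eq prod_dividef)
      \<comment> \<open>Combining the Lagrange terms leaves the vanishing denominator u - v only in
        (A - B)/(u - v), which converges to a derivative of W0.\<close>
      also have "(t - v) / (u - v) * (T / A) + (t - u) / (- (u - v)) * (T / B)
          = T * (A - (t - v) * ((A - B) / (u - v))) / (A * B)"
        if "u - v \<noteq> 0" "A \<noteq> 0" "B \<noteq> 0" for u v A B T :: complex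
      proof -
        have "(t - v) * B - (t - u) * A = A * (u - v) - (t - v) * (A - B)"
          by (simp add: algebra_simps)
        then have "T * ((t - v) * B - (t - u) * A) / ((u - v) * (A * B))
            = T * (A * (u - v) - (t - v) * (A - B)) / ((u - v) * (A * B))" by (simp only:)
        moreover have "(t - v) / (u - v) * (T / A) + (t - u) / (- (u - v)) * (T / B)
            = T * ((t - v) * B - (t - u) * A) / ((u - v) * (A * B))"
          unfolding divide_minus_right using that by (simp add: divide_simps) (simp add: algebra_simps)
        moreover have "T * (A - (t - v) * ((A - B) / (u - v))) / (A * B)
            = T * (A * (u - v) - (t - v) * (A - B)) / ((u - v) * (A * B))"
          using that by (simp add: divide_simps)
        ultimately show ?thesis by (simp only:)
      qed
      note this[OF uv nz]
      finally show ?case by (rule sym)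
    qed
    ultimately have h1: "(?h \<longlongrightarrow> poly hermite t) (at (of_nat k))"
      by (simp only: tendsto_cong)
    have h2: "(?h \<longlongrightarrow> (\<Sum>a\<le>M. limit_coef a * (\<Prod>s<a. t - node_at d (of_nat k) s))) (at (of_nat k))"
      by (intro tendsto_intros tendsto_pair_coef tendsto_node_at)
    have "(\<Sum>a\<le>M. limit_coef a * (\<Prod>s<a. t - node_at d (of_nat k) s)) = poly hermite t"
      by (rule tendsto_unique[OF at_neq_bot h2 h1])
    then show ?thesis by (simp add: poly_sum poly_prod)
  qed
  then show ?thesis by (simp add: poly_eq_poly_eq_iff[symmetric] fun_eq_iff)
qed

lemma prod_nodes: "(\<Prod>s<Suc M. [:- node_at d (of_nat k) s, 1:]) = W0 * [:- t0, 1:] ^ 2"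
proof -
  have "(\<Prod>s\<le>M. [:- node_at d (of_nat k) s, 1:])
      = [:- t0, 1:] * (\<Prod>s\<in>{..M} - {r}. [:- node_at d (of_nat k) s, 1:])"
    using nodes_less by (subst prod.remove[of _ r]) (auto simp: t0_eq)
  also have "(\<Prod>s\<in>{..M} - {r}. [:- node_at d (of_nat k) s, 1:]) = [:- t0, 1:] * W0"
  proof -
    have "(\<Prod>s\<in>{..M} - {r}. [:- node_at d (of_nat k) s, 1:])
        = [:- node_at d (of_nat k) r', 1:] * (\<Prod>s\<in>{..M} - {r} - {r'}. [:- node_at d (of_nat k) s, 1:])"
      using nodes_less(1,2) by (intro prod.remove) auto
    moreover have "{..M} - {r} - {r'} = {..M} - {r, r'}" by auto
    ultimately show ?thesis unfolding W0_def t0_eq by (simp only:)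
  qed
  finally show ?thesis unfolding lessThan_Suc_atMost
    by (simp only: power2_eq_square mult_ac)
qed

lemma hermite_dvd: "W0 dvd hermite"
  unfolding hermite_def by (rule dvd_smult, rule dvd_triv_left)

text \<open>With X = x - t0 the Taylor expansion W0 = w + w' X + S X^2 gives W0 (w - w' X) - w^2 =
  X^2 (S (w - w' X) - w'^2), and dividing by w^2 yields the claim.\<close>

lemma hermite_minus_one_dvd: "[:- t0, 1:] ^ 2 dvd hermite - 1"
proof -
  let ?X = "[:- t0, 1:]"
  define w where "w = poly W0 t0"
  define w' where "w' = poly (pderiv W0) t0"
  define T where "T = synthetic_div W0 t0"
  have W0: "W0 = ?X * T + [:w:]" unfolding T_def w_def by (rule synthetic_div_correct'[symmetric])
  have "pderiv W0 = ?X * pderiv T + T"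
    unfolding W0 pderiv_add pderiv_mult by (simp add: pderiv_pCons del: mult_pCons_left mult_pCons_right)
  then have "w' = poly T t0" by (simp add: w'_def)
  then obtain S where T: "T = ?X * S + [:w':]" using synthetic_div_correct'[of t0 T] by metis
  define R where "R = S * ([:w:] - [:w':] * ?X) - [:w':] * [:w':]"
  have "W0 * ([:w:] - [:w':] * ?X) - [:w:] * [:w:] = ?X ^ 2 * R"
    unfolding W0 T R_def by (simp only: power2_eq_square ring_distribs right_diff_distrib left_diff_distrib mult_ac)
      (simp only: algebra_simps)
  then have "smult (1 / (w * w)) (W0 * ([:w:] - [:w':] * ?X) - [:w:] * [:w:])
      = smult (1 / (w * w)) (?X ^ 2 * R)" by (simp only:)
  then have "smult (1 / (w * w)) (W0 * ([:w:] - [:w':] * ?X)) - smult (1 / (w * w)) ([:w:] * [:w:])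
      = ?X ^ 2 * smult (1 / (w * w)) R"
    by (simp only: smult_diff_right mult_smult_right)
  moreover have "smult (1 / (w * w)) ([:w:] * [:w:]) = 1"
    using W0_nonzero by (simp add: w_def one_pCons)
  moreover have "hermite = smult (1 / (w * w)) (W0 * ([:w:] - [:w':] * ?X))"
  proof -
    have "smult w' ?X = [:w':] * ?X" by simp
    then show ?thesis by (simp only: hermite_def w_def w'_def)
  qed
  ultimately have "hermite - 1 = ?X ^ 2 * smult (1 / (w * w)) R"
    by (simp only:)
  then show ?thesis by (rule dvdI)
qed

end


section \<open>Coefficientwise limits\<close>

definition coeffs_tendsto :: "(complex \<Rightarrow> complex poly poly) \<Rightarrow> complex poly poly \<Rightarrow> complex filter \<Rightarrow> bool" where
  "coeffs_tendsto f L F \<longleftrightarrow> (\<forall>i j. ((\<lambda>z. coeff (coeff (f z) i) j) \<longlongrightarrow> coeff (coeff L i) j) F)"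

lemma coeffs_tendsto_const: "coeffs_tendsto (\<lambda>_. f) f F"
  by (simp add: coeffs_tendsto_def)

lemma coeffs_tendsto_add:
  "coeffs_tendsto f L F \<Longrightarrow> coeffs_tendsto g L' F \<Longrightarrow> coeffs_tendsto (\<lambda>z. f z + g z) (L + L') F"
  by (auto simp: coeffs_tendsto_def intro!: tendsto_intros)

lemma coeffs_tendsto_diff:
  "coeffs_tendsto f L F \<Longrightarrow> coeffs_tendsto g L' F \<Longrightarrow> coeffs_tendsto (\<lambda>z. f z - g z) (L - L') F"
  by (auto simp: coeffs_tendsto_def intro!: tendsto_intros)

lemma coeffs_tendsto_mult:
  "coeffs_tendsto f L F \<Longrightarrow> coeffs_tendsto g L' F \<Longrightarrow> coeffs_tendsto (\<lambda>z. f z * g z) (L * L') F"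
  by (auto simp: coeffs_tendsto_def coeff_coeff_mult intro!: tendsto_intros)

lemma coeffs_tendsto_sum:
  "(\<And>i. i \<in> I \<Longrightarrow> coeffs_tendsto (f i) (L i) F) \<Longrightarrow> coeffs_tendsto (\<lambda>z. \<Sum>i\<in>I. f i z) (\<Sum>i\<in>I. L i) F"
  by (induction I rule: infinite_finite_induct) (simp_all add: coeffs_tendsto_const coeffs_tendsto_add)

lemma coeffs_tendsto_prod:
  "(\<And>i. i \<in> I \<Longrightarrow> coeffs_tendsto (f i) (L i) F) \<Longrightarrow> coeffs_tendsto (\<lambda>z. \<Prod>i\<in>I. f i z) (\<Prod>i\<in>I. L i) F"
  by (induction I rule: infinite_finite_induct) (simp_all add: coeffs_tendsto_const coeffs_tendsto_mult)

lemma coeffs_tendsto_constant_poly: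
  "(c \<longlongrightarrow> c0) F \<Longrightarrow> coeffs_tendsto (\<lambda>z. [:[:c z:]:]) [:[:c0:]:] F"
  by (auto simp: coeffs_tendsto_def coeff_pCons split: nat.splits)

lemma coeffs_tendsto_smult:
  "(c \<longlongrightarrow> c0) F \<Longrightarrow> coeffs_tendsto f L F \<Longrightarrow> coeffs_tendsto (\<lambda>z. smult [:c z:] (f z)) (smult [:c0:] L) F"
  by (auto simp: coeffs_tendsto_def intro!: tendsto_intros)

lemma coeffs_tendsto_cong:
  assumes "coeffs_tendsto f L F" "eventually (\<lambda>z. f z = g z) F"
  shows "coeffs_tendsto g L F"
  unfolding coeffs_tendsto_def
proof (intro allI)
  fix i j
  have "((\<lambda>z. coeff (coeff (f z) i) j) \<longlongrightarrow> coeff (coeff L i) j) F"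
    using assms(1) by (simp add: coeffs_tendsto_def)
  moreover have "eventually (\<lambda>z. coeff (coeff (f z) i) j = coeff (coeff (g z) i) j) F"
    using assms(2) by (rule eventually_mono) simp
  ultimately show "((\<lambda>z. coeff (coeff (g z) i) j) \<longlongrightarrow> coeff (coeff L i) j) F"
    by (rule Lim_transform_eventually)
qed

lemma coeffs_tendsto_basis_poly: "coeffs_tendsto (\<lambda>\<kappa>. basis_poly \<kappa> d a) (basis_poly \<kappa>0 d a) (at \<kappa>0)"
  unfolding basis_poly_def falling_def
  by (intro coeffs_tendsto_mult coeffs_tendsto_prod coeffs_tendsto_diff coeffs_tendsto_add
      coeffs_tendsto_const coeffs_tendsto_constant_poly tendsto_intros)

context quasiregular_partition
begin

lemma dagger_partition: "dagger k (l1, l2) = (l2 + k + 1, r')"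
  by (simp add: dagger_def)

text \<open>A partition and its dagger have the same size, so for noninteger \<kappa> both
  expansions use the same \<open>basis_poly\<close>. Their coefficients add up to
  \<open>pair_coef\<close>, which converges although its summands need not.\<close>

lemma knop_sahi_pair_tendsto:
  "coeffs_tendsto (\<lambda>\<kappa>. smult [:1 / knop_sahi_norm (l1, l2) \<kappa>:] (knop_sahi (l1, l2) \<kappa>) +
      smult [:1 / knop_sahi_norm (dagger k (l1, l2)) \<kappa>:] (knop_sahi (dagger k (l1, l2)) \<kappa>))
    (\<Sum>a\<le>M. smult [:limit_coef a / fact (d - 2 * a):] (basis_poly (of_nat k) d a)) (at (of_nat k))"
proof -
  have "coeffs_tendsto (\<lambda>\<kappa>. \<Sum>a\<le>M. smult [:pair_coef \<kappa> a / fact (d - 2 * a):] (basis_poly \<kappa> d a))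
      (\<Sum>a\<le>M. smult [:limit_coef a / fact (d - 2 * a):] (basis_poly (of_nat k) d a)) (at (of_nat k))"
    by (intro coeffs_tendsto_sum coeffs_tendsto_smult coeffs_tendsto_basis_poly tendsto_divide
        tendsto_pair_coef tendsto_const) simp
  moreover have "eventually (\<lambda>\<kappa>. (\<Sum>a\<le>M. smult [:pair_coef \<kappa> a / fact (d - 2 * a):] (basis_poly \<kappa> d a))
      = smult [:1 / knop_sahi_norm (l1, l2) \<kappa>:] (knop_sahi (l1, l2) \<kappa>) +
        smult [:1 / knop_sahi_norm (dagger k (l1, l2)) \<kappa>:] (knop_sahi (dagger k (l1, l2)) \<kappa>)) (at (of_nat k))"
    using eventually_nonint
  proof eventually_elim
    case (elim \<kappa>)
    have d: "l2 + k + 1 + r' = d" and le: "r' \<le> l2 + k + 1"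
      using nodes_less by linarith+
    have "smult [:pair_coef \<kappa> a / fact (d - 2 * a):] (basis_poly \<kappa> d a)
        = smult [:newton_coef d \<kappa> r a / fact (d - 2 * a):] (basis_poly \<kappa> d a)
        + smult [:newton_coef d \<kappa> r' a / fact (d - 2 * a):] (basis_poly \<kappa> d a)" for a
      unfolding smult_add_left[symmetric] by (simp add: pair_coef_def add_divide_distrib)
    then show ?case
      unfolding dagger_partition knop_sahi_expansion[OF elim nodes_less(4)]
        knop_sahi_expansion[OF elim le] d
      by (simp only: sum.distrib)
  qed
  ultimately show ?thesis by (rule coeffs_tendsto_cong)
qed

end

text \<open>Dividing by the factorial undoes the Euler factor in degree d, so that there the
  operator is \<open>P.hermite\<close> evaluated at Q. Its two divisibility properties then give 1
  on V_\<lambda> and 0 on the other modules.\<close>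

lemma (in osp_form) capelli_quasiregular:
  assumes "quasiregular k (l1, l2)"
  shows "capelli k \<omega> (l1, l2) = capelli_op (l1 + l2)
    (\<lambda>a. quasiregular_partition.limit_coef k l1 l2 a / fact (l1 + l2 - 2 * a))"
proof -
  interpret P: quasiregular_partition k l1 l2 by standard fact
  let ?d = "l1 + l2" and ?M = "(l1 + l2) div 2"
  let ?C = "\<lambda>a. P.limit_coef a / fact (?d - 2 * a)"
  have node: "node e s = node_at e (of_nat k) s" for e s
    by (simp add: node_def node_at_def)
  have eigen: "eigen_poly ?d ?C ?d = P.hermite"
  proof -
    have "falling (of_nat ?d - 2 * of_nat a) (?d - 2 * a) = (fact (?d - 2 * a) :: complex)" if "a \<le> ?M" for a
    proof -
      have "of_nat ?d - 2 * of_nat a = (of_nat (?d - 2 * a) :: complex)"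
        using that by (subst of_nat_diff) auto
      then show ?thesis by (simp only: falling_self)
    qed
    then show ?thesis
      unfolding P.limit_newton_form[symmetric] eigen_poly_def node_poly_def node
      by (intro sum.cong refl) simp
  qed
  have annihilated: "poly_op Q (P.W0 * [:- P.t0, 1:] ^ 2) p = 0" if "p \<in> homog_poly ?d" for p
    using node_poly_annihilates[OF that, of "Suc ?M"]
    unfolding node_poly_def node P.prod_nodes by simp
  show ?thesis
  proof (rule capelli_eqI)
    show "psize (l1, l2) = ?d" by (simp add: psize_def)
  next
    fix p assume "p \<in> V_module k \<omega> (l1, l2)"
    moreover have "of_nat l2 * (of_nat l1 - of_nat k - 1) = P.t0"
      by (simp add: P.t0_def node_at_def algebra_simps)
    ultimately obtain e where p: "p \<in> homog_poly ?d" "poly_op Q ([:- P.t0, 1:] ^ e) p = 0"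
      unfolding V_module_iff by auto
    \<comment> \<open>On V_\<lambda> the factor W0 can be cancelled from the annihilator W0 (x -
      t0)^2, which leaves (x - t0)^2.\<close>
    obtain a b where "a * [:- P.t0, 1:] ^ e + b * P.W0 = 1"
      using bezout_linear_factor_power[OF P.W0_nonzero] by blast
    from poly_op_bezout[OF linear_op_Q this p(2) annihilated[OF p(1)]]
    have "poly_op Q (P.hermite - 1) p = 0"
      by (rule poly_op_dvd[OF linear_op_Q P.hermite_minus_one_dvd])
    then have "poly_op Q ((P.hermite - 1) + 1) p = p"
      by (simp only: poly_op_add poly_op_1[OF linear_op_Q] add_0_left)
    then show "capelli_op ?d ?C p = p" unfolding capelli_op_homog[OF p(1)] eigen by simp
  next
    fix u p assume u: "u \<in> index_set k" "psize u = ?d" "u \<noteq> (l1, l2)" "p \<in> V_module k \<omega> u"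
    obtain u1 u2 where u12: "u = (u1, u2)" by (cases u)
    define t :: complex where "t = of_nat u2 * (of_nat u1 - of_nat k - 1)"
    have sum: "u1 + u2 = ?d" using u(2) by (simp add: u12 psize_def)
    obtain e where p: "p \<in> homog_poly ?d" "poly_op Q ([:- t, 1:] ^ e) p = 0"
      using u(4) unfolding u12 V_module_iff t_def[symmetric] sum by blast
    \<comment> \<open>The node t0 belongs only to \<lambda> and its dagger, and the dagger is
      singular, hence outside the index set.\<close>
    have "t \<noteq> P.t0"
    proof -
      have "u2 \<noteq> l2" using u(3) sum by (auto simp: u12)
      moreover have "u2 \<noteq> l1 - k - 1"
      proof
        assume "u2 = l1 - k - 1"
        then have "u = (l2 + k + 1, l1 - k - 1)" using sum P.nodes_less by (auto simp: u12)
        then show False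
          using u(1) P.nodes_less by (auto simp: index_set_def regular_def quasiregular_def)
      qed
      moreover have "t = node_at ?d (of_nat k) u2"
        unfolding t_def node_at_def sum[symmetric] by (simp add: algebra_simps)
      ultimately show ?thesis using P.node_at_neq_t0[of u2] by simp
    qed
    then have "poly ([:- P.t0, 1:] ^ 2) t \<noteq> 0" by simp
    then obtain a b where "a * [:- t, 1:] ^ e + b * [:- P.t0, 1:] ^ 2 = 1"
      using bezout_linear_factor_power by blast
    moreover have "poly_op Q ([:- P.t0, 1:] ^ 2 * P.W0) p = 0"
      using annihilated[OF p(1)] by (simp only: mult.commute)
    \<comment> \<open>On the other modules it is (x - t0)^2 that can be cancelled, so W0 already
      annihilates them.\<close>
    ultimately have "poly_op Q P.W0 p = 0" by (rule poly_op_bezout[OF linear_op_Q _ p(2)])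
    then have "poly_op Q P.hermite p = 0" by (rule poly_op_dvd[OF linear_op_Q P.hermite_dvd])
    then show "capelli_op ?d ?C p = 0" unfolding capelli_op_homog[OF p(1)] eigen .
  qed
qed

theorem theoremC:
  fixes \<omega> :: "complex^('a::finite + 'b::{finite,linorder}) \<Rightarrow> complex^('a + 'b) \<Rightarrow> complex"
    and m n k :: nat and l :: "nat \<times> nat"
  assumes "m \<ge> 1" and "n \<ge> m" and "k = n - m"
    and "CARD('a) = 2 * m" and "CARD('b) = 2 * n"
    and "supersymmetric_form \<omega>"
    and "quasiregular k l"
  shows "\<forall>i j. ((\<lambda>\<kappa>. coeff (coeff
             (smult [:1 / knop_sahi_norm l \<kappa>:] (knop_sahi l \<kappa>) +
              smult [:1 / knop_sahi_norm (dagger k l) \<kappa>:] (knop_sahi (dagger k l) \<kappa>)) i) j)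
           \<longlongrightarrow> coeff (coeff (eigenvalue_poly k \<omega> (capelli k \<omega> l)) i) j) (at (of_nat k))"
proof -
  obtain l1 l2 where l: "l = (l1, l2)" by (cases l)
  have "of_nat CARD('a) - of_nat CARD('b) = (- 2 * of_nat k :: complex)"
    using assms(2-5) by (simp add: of_nat_diff)
  then obtain G where "osp_form (\<lambda>i j. \<omega> (axis i 1) (axis j 1)) G k \<omega>"
    using supersymmetric_form_imp_osp_form[OF assms(6)] by blast
  then interpret osp_form "\<lambda>i j. \<omega> (axis i 1) (axis j 1)" G k \<omega> .
  have q: "quasiregular k (l1, l2)" using assms(7) by (simp add: l)
  interpret P: quasiregular_partition k l1 l2 by standard (rule q)
  \<comment> \<open>Two even coordinates are what the isotropic linear form behind the eigenvectors
    requires.\<close>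
  have "CARD('a) \<ge> 2" using assms(1,4) by simp
  from eigenvalue_poly_capelli_op[OF this] P.knop_sahi_pair_tendsto show ?thesis
    unfolding l capelli_quasiregular[OF q] coeffs_tendsto_def by simp
qed

end
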